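(* Let $n\in\{2,3\}$ and let $V=\chi_\Omega\varphi$ be a (qualitatively) admissible potential on $\mathbb{R}^n$. Assume that $k>0$ is a transmission eigenvalue, i.e. there exist $v,w\in L^2(\Omega)$ such that $$(\Delta+k^2)v=0\ \text{ in }\Omega,\qquad (\Delta+k^2(1+V))w=0\ \text{ in }\Omega,\qquad w-v\in H^2_0(\Omega),\qquad \|v\|_{L^2(\Omega)}=1.$$ If $v$ can be approximated in the $L^2(\Omega)$-norm by a sequence of Herglotz waves (of wavenumber $k$) whose kernels are uniformly bounded in $L^2(\mathbb{S}^{n-1})$, then $$\lim_{r\to 0}\frac{1}{m(B(x_c,r))}\int_{B(x_c,r)\cap\Omega}|v(x)|\,dx=0$$ for every vertex $x_c$ of $\Omega$ such that $\varphi(x_c)\neq 0$.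
   Context: Notation: $B(x,r)$ is the open ball of radius $r$ centred at $x$ in $\mathbb{R}^n$; $B_R=B(0,R)$ with $R>1$ fixed; $m$ is Lebesgue measure; $\sigma$ is the surface measure on the unit sphere $\mathbb{S}^{n-1}$; $\chi_\Omega$ is the indicator function of $\Omega$. The equations for $v,w\in L^2(\Omega)$ are understood in the sense of distributions. Admissible potential: $V$ is (qualitatively) admissible if (1) $V=\chi_\Omega\varphi$; (2) $\Omega\subset B_R$ is an open convex polygon if $n=2$, or an open cuboid if $n\geq 3$; (3) $\varphi\in C^\alpha(\mathbb{R}^n)$ (Hölder continuous) for some $\alpha>0$ if $n=2$, and some $\alpha>1/4$ if $n\geq 3$; (4) $\varphi\neq 0$ at some vertex of $\Omega$. Herglotz waves: a Herglotz wave of wavenumber $k$ is a function $u(x)=\int_{\mathbb{S}^{n-1}}e^{ik\theta\cdot x}g(\theta)\,d\sigma(\theta)$ with kernel $g\in L^2(\mathbb{S}^{n-1})$. The approximation hypothesis means: there are Herglotz waves $v_j$ with kernels $g_j$ such that $\|v-v_j\|_{L^2(\Omega)}\to 0$ as $j\to\infty$ and $\sup_j\|g_j\|_{L^2(\mathbb{S}^{n-1})}<\infty$. *)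

theory Defs
  imports "HOL-Analysis.Analysis"
begin

text \<open>
  Elements of \<open>L\<^sup>2\<close> are represented by measurable functions; no
  quotient by null functions is taken.
\<close>

definition square_integrable :: "'a measure \<Rightarrow> ('a \<Rightarrow> complex) \<Rightarrow> bool" where
  "square_integrable M f \<longleftrightarrow>
     f \<in> borel_measurable M \<and> integrable M (\<lambda>x. (norm (f x))\<^sup>2)"

definition L2_norm :: "'a measure \<Rightarrow> ('a \<Rightarrow> complex) \<Rightarrow> real" where
  "L2_norm M f = sqrt (\<integral>x. (norm (f x))\<^sup>2 \<partial>M)"


definition partial_deriv :: "'a::euclidean_space \<Rightarrow> ('a \<Rightarrow> complex) \<Rightarrow> 'a \<Rightarrow> complex" where
  "partial_deriv i f x = frechet_derivative f (at x) i"

text \<open>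
  A multi-index is encoded as a list of coordinate directions. A mixed derivative may then be
  listed several times, which changes Sobolev norms only up to equivalence.
\<close>

definition multi_indices :: "'a::euclidean_space list set" where
  "multi_indices = {\<alpha>. set \<alpha> \<subseteq> Basis}"

definition iter_deriv :: "'a::euclidean_space list \<Rightarrow> ('a \<Rightarrow> complex) \<Rightarrow> 'a \<Rightarrow> complex" where
  "iter_deriv \<alpha> f = foldr partial_deriv \<alpha> f"

definition laplacian :: "('a::euclidean_space \<Rightarrow> complex) \<Rightarrow> 'a \<Rightarrow> complex" where
  "laplacian f x = (\<Sum>i\<in>Basis. iter_deriv [i, i] f x)"

definition smooth :: "('a::euclidean_space \<Rightarrow> complex) \<Rightarrow> bool" where
  "smooth f \<longleftrightarrow> (\<forall>\<alpha>\<in>multi_indices. \<forall>x. iter_deriv \<alpha> f differentiable (at x))"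

definition test_function :: "'a::euclidean_space set \<Rightarrow> ('a \<Rightarrow> complex) \<Rightarrow> bool" where
  "test_function \<Omega> \<psi> \<longleftrightarrow>
     smooth \<psi> \<and> compact (closure {x. \<psi> x \<noteq> 0}) \<and> closure {x. \<psi> x \<noteq> 0} \<subseteq> \<Omega>"

text \<open>\<open>(\<Delta> + q) u = 0\<close> in \<open>\<Omega>\<close> in the sense of distributions.\<close>

definition helmholtz_distr ::
    "'a::euclidean_space set \<Rightarrow> ('a \<Rightarrow> complex) \<Rightarrow> ('a \<Rightarrow> complex) \<Rightarrow> bool" where
  "helmholtz_distr \<Omega> q u \<longleftrightarrow> (\<forall>\<psi>. test_function \<Omega> \<psi> \<longrightarrow>
     (\<integral>x. u x * laplacian \<psi> x \<partial>lebesgue_on \<Omega>) + (\<integral>x. q x * u x * \<psi> x \<partial>lebesgue_on \<Omega>) = 0)"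


definition has_weak_deriv ::
    "'a::euclidean_space set \<Rightarrow> 'a list \<Rightarrow> ('a \<Rightarrow> complex) \<Rightarrow> ('a \<Rightarrow> complex) \<Rightarrow> bool" where
  "has_weak_deriv \<Omega> \<alpha> u g \<longleftrightarrow> (\<forall>\<psi>. test_function \<Omega> \<psi> \<longrightarrow>
     (\<integral>x. u x * iter_deriv \<alpha> \<psi> x \<partial>lebesgue_on \<Omega>) =
       (- 1) ^ length \<alpha> * (\<integral>x. g x * \<psi> x \<partial>lebesgue_on \<Omega>))"

text \<open>The Sobolev space \<open>H\<^sup>m(\<Omega>)\<close>.\<close>

definition sobolev_H :: "nat \<Rightarrow> 'a::euclidean_space set \<Rightarrow> ('a \<Rightarrow> complex) set" where
  "sobolev_H m \<Omega> = {u. square_integrable (lebesgue_on \<Omega>) u \<and>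
     (\<forall>\<alpha>\<in>multi_indices. length \<alpha> \<le> m \<longrightarrow>
        (\<exists>g. square_integrable (lebesgue_on \<Omega>) g \<and> has_weak_deriv \<Omega> \<alpha> u g))}"

text \<open>For \<open>\<Omega>\<close> open, the chosen representative is unique up to null sets.\<close>

definition weak_deriv ::
    "'a::euclidean_space set \<Rightarrow> 'a list \<Rightarrow> ('a \<Rightarrow> complex) \<Rightarrow> 'a \<Rightarrow> complex" where
  "weak_deriv \<Omega> \<alpha> u =
     (SOME g. square_integrable (lebesgue_on \<Omega>) g \<and> has_weak_deriv \<Omega> \<alpha> u g)"

definition sobolev_norm :: "nat \<Rightarrow> 'a::euclidean_space set \<Rightarrow> ('a \<Rightarrow> complex) \<Rightarrow> real" where
  "sobolev_norm m \<Omega> u =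
     sqrt (\<Sum>\<alpha> | \<alpha> \<in> multi_indices \<and> length \<alpha> \<le> m.
       (L2_norm (lebesgue_on \<Omega>) (weak_deriv \<Omega> \<alpha> u))\<^sup>2)"

text \<open>\<open>H\<^sup>m\<^sub>0(\<Omega>)\<close>: the closure of the test functions in \<open>H\<^sup>m(\<Omega>)\<close>.\<close>

definition sobolev_H0 :: "nat \<Rightarrow> 'a::euclidean_space set \<Rightarrow> ('a \<Rightarrow> complex) set" where
  "sobolev_H0 m \<Omega> = {u \<in> sobolev_H m \<Omega>. \<exists>\<psi>. (\<forall>j::nat. test_function \<Omega> (\<psi> j)) \<and>
     (\<lambda>j. sobolev_norm m \<Omega> (\<lambda>x. u x - \<psi> j x)) \<longlonglongrightarrow> 0}"


text \<open>
  Surface measure on the unit sphere as cone measure: by polar coordinates, the area of a Borel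
  set \<open>A\<close> in the sphere is \<open>n\<close> times the volume of \<open>{t *\<^sub>R \<theta> | t \<theta>. 0 < t \<and> t < 1 \<and> \<theta> \<in> A}\<close>.
\<close>

definition sphere_measure :: "'a::euclidean_space measure" where
  "sphere_measure = scale_measure (of_nat DIM('a))
     (distr (restrict_space lborel (ball 0 1 - {0})) (restrict_space borel (sphere 0 1))
       (\<lambda>x. x /\<^sub>R norm x))"

lemma emeasure_sphere_measure:
  fixes A :: "'a::euclidean_space set"
  assumes "A \<in> sets borel" "A \<subseteq> sphere 0 1"
  shows "emeasure sphere_measure A =
    of_nat DIM('a) * emeasure lborel {x \<in> ball 0 1 - {0}. x /\<^sub>R norm x \<in> A}"
proof -
  have meas: "(\<lambda>x. x /\<^sub>R norm x) \<in>
      restrict_space lborel (ball 0 1 - {0::'a}) \<rightarrow>\<^sub>M restrict_space borel (sphere 0 1)"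
    by (intro measurable_restrict_space2 measurable_restrict_space1) auto
  have "A \<in> sets (restrict_space borel (sphere 0 1))"
    using assms by (auto simp: sets_restrict_space_iff)
  moreover have "(\<lambda>x. x /\<^sub>R norm x) -` A \<inter> (ball 0 1 - {0})
      = {x \<in> ball 0 1 - {0}. x /\<^sub>R norm x \<in> A}"
    by auto
  ultimately show ?thesis
    unfolding sphere_measure_def using meas
    by (simp add: emeasure_distr space_restrict_space emeasure_restrict_space[of _ lborel]
        subset_iff)
qed

definition herglotz_wave ::
    "real \<Rightarrow> ('a::euclidean_space \<Rightarrow> complex) \<Rightarrow> 'a \<Rightarrow> complex" where
  "herglotz_wave k g x = (\<integral>\<theta>. exp (\<i> * of_real (k * (\<theta> \<bullet> x))) * g \<theta> \<partial>sphere_measure)"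


text \<open>The Hoelder space \<open>C\<^sup>\<alpha>(\<real>\<^sup>n)\<close>, for \<open>0 < \<alpha> \<le> 1\<close>.\<close>

definition hoelder :: "real \<Rightarrow> ('a::euclidean_space \<Rightarrow> complex) \<Rightarrow> bool" where
  "hoelder \<alpha> f \<longleftrightarrow> bounded (range f) \<and> (\<exists>C. \<forall>x y. dist (f x) (f y) \<le> C * dist x y powr \<alpha>)"

definition open_convex_polytope :: "'a::euclidean_space set \<Rightarrow> bool" where
  "open_convex_polytope \<Omega> \<longleftrightarrow> \<Omega> \<noteq> {} \<and> (\<exists>P. polytope P \<and> \<Omega> = interior P)"

text \<open>A cuboid need not be axis-parallel; translations are absorbed in \<open>a\<close> and \<open>b\<close>.\<close>

definition open_cuboid :: "'a::euclidean_space set \<Rightarrow> bool" where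
  "open_cuboid \<Omega> \<longleftrightarrow>
     \<Omega> \<noteq> {} \<and> (\<exists>(T :: 'a \<Rightarrow> 'a) a b. orthogonal_transformation T \<and> \<Omega> = T ` box a b)"

definition vertices :: "'a::euclidean_space set \<Rightarrow> 'a set" where
  "vertices \<Omega> = {x. x extreme_point_of (closure \<Omega>)}"

text \<open>
  Restricting to \<open>\<alpha> \<le> 1\<close> loses nothing, since \<open>C\<^sup>\<alpha>(\<real>\<^sup>n)\<close> is contained in the bounded
  Lipschitz functions for \<open>\<alpha> > 1\<close>.
\<close>

definition admissible_potential ::
    "real \<Rightarrow> 'a::euclidean_space set \<Rightarrow> ('a \<Rightarrow> complex) \<Rightarrow> ('a \<Rightarrow> complex) \<Rightarrow> bool" where
  "admissible_potential R \<Omega> \<phi> V \<longleftrightarrow>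
     V = (\<lambda>x. indicator \<Omega> x * \<phi> x) \<and>
     \<Omega> \<subseteq> ball 0 R \<and>
     (DIM('a) = 2 \<and> open_convex_polytope \<Omega> \<and> (\<exists>\<alpha>. 0 < \<alpha> \<and> \<alpha> \<le> 1 \<and> hoelder \<alpha> \<phi>) \<or>
      DIM('a) \<ge> 3 \<and> open_cuboid \<Omega> \<and> (\<exists>\<alpha>. 1 / 4 < \<alpha> \<and> \<alpha> \<le> 1 \<and> hoelder \<alpha> \<phi>)) \<and>
     (\<exists>x\<in>vertices \<Omega>. \<phi> x \<noteq> 0)"

end

theory Submission
  imports Defs "HOL-Computational_Algebra.Polynomial"
begin

text \<open>
  The proof is the classical argument that a corner of the potential always scatters, in an
  elementary form which suffices here because the eigenfunction is well behaved at the corner.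

  \<^item> A sequence of Herglotz waves with bounded kernels is equibounded and equi-Lipschitz. Hence its
    \<open>L\<^sup>2\<close> limit \<open>v\<close> is almost everywhere Lipschitz continuous at the vertex \<open>z\<close>, with a value \<open>c\<close> there
    (\<open>herglotz_limit_Lipschitz\<close>). If \<open>c = 0\<close>, the averages of \<open>|v|\<close> are of order \<open>r\<close>; so
    it remains to show that \<open>\<phi>(z) c = 0\<close>.

  \<^item> The difference \<open>u = w - v\<close> lies in \<open>H\<^sup>2\<^sub>0(\<Omega>)\<close> and solves \<open>\<Delta>u + k\<^sup>2(1 + V) u = - k\<^sup>2 V v\<close>. Test this
    equation with \<open>E\<^sub>m(x) = e\<^bsup>m \<rho>\<cdot>(x - z)\<^esup>\<close>, where \<open>\<rho> = p + i q\<close> satisfies \<open>\<rho>\<cdot>\<rho> = 0\<close>, so that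
    \<open>E\<^sub>m\<close> is harmonic, and \<open>p\<close> is negative on the cone that \<open>\<Omega>\<close> fills near \<open>z\<close>. Since \<open>u\<close> is a limit of
    test functions, no boundary terms appear (\<open>sobolev_H0_harmonic_orthogonality\<close>) and
    \<open>\<integral> V v E\<^sub>m = - \<integral> (1 + V) u E\<^sub>m\<close> over \<open>\<Omega>\<close>.

  \<^item> By scaling the left side is \<open>m\<^bsup>-n\<^esup> (\<phi>(z) c J + o(1))\<close>, where \<open>J\<close> is the integral of \<open>e\<^bsup>\<rho>\<cdot>y\<^esup>\<close> over the
    cone (\<open>leading_term_tendsto\<close>); and \<open>J \<noteq> 0\<close> because the cone is simplicial (\<open>laplace_nonzero\<close>).

  \<^item> The right side is smaller. Integrating by parts twice against an exponential weight gives
    a weighted norm of \<open>u\<close> of order \<open>m\<^sup>-\<^sup>2\<close> (\<open>sobolev_H0_exponential_decay\<close>), and with the Cauchy-Schwarz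
    inequality the integral is of order \<open>m\<^bsup>-2-n/2\<^esup>\<close>, which is \<open>o(m\<^bsup>-n\<^esup>)\<close> for \<open>n < 4\<close>
    (\<open>remainder_tendsto_0\<close>).

  Comparing both sides yields \<open>\<phi>(z) c = 0\<close>. The geometric input is that at each vertex of a convex polygon
  or of a cuboid a suitable \<open>\<rho>\<close> exists (\<open>polygon_corner\<close>, \<open>cuboid_corner\<close>).
\<close>

section \<open>Smooth functions\<close>

text \<open>Smoothness is established by exhibiting a set of differentiable functions that is stable under
  partial derivatives.\<close>

lemma smooth_coinduct:
  assumes "f \<in> S"
    and "\<And>f x. f \<in> S \<Longrightarrow> f differentiable (at x)"
    and "\<And>f i. f \<in> S \<Longrightarrow> i \<in> Basis \<Longrightarrow> partial_deriv i f \<in> S"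
  shows "smooth f"
proof -
  have "iter_deriv \<alpha> f \<in> S" if "\<alpha> \<in> multi_indices" for \<alpha>
    using that
  proof (induction \<alpha>)
    case Nil
    then show ?case using assms(1) by (simp add: iter_deriv_def)
  next
    case (Cons i \<alpha>)
    then show ?case using assms(3)[of "iter_deriv \<alpha> f" i]
      by (auto simp: iter_deriv_def multi_indices_def)
  qed
  then show ?thesis using assms(2) by (auto simp: smooth_def)
qed

lemma smooth_differentiable: "smooth f \<Longrightarrow> f differentiable (at x)"
  unfolding smooth_def by (erule ballE[of _ _ "[]"]) (auto simp: iter_deriv_def multi_indices_def)

lemma smooth_partial_deriv:
  assumes "smooth f" "i \<in> Basis"
  shows "smooth (partial_deriv i f)"
  unfolding smooth_def
proof (intro ballI allI)
  fix \<alpha> :: "'a list" and x :: 'a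
  assume "\<alpha> \<in> multi_indices"
  then have "\<alpha> @ [i] \<in> multi_indices" using assms(2) by (auto simp: multi_indices_def)
  then have "iter_deriv (\<alpha> @ [i]) f differentiable at x" using assms(1) by (auto simp: smooth_def)
  then show "iter_deriv \<alpha> (partial_deriv i f) differentiable at x" by (simp add: iter_deriv_def)
qed

lemma smooth_iter_deriv: "smooth f \<Longrightarrow> \<alpha> \<in> multi_indices \<Longrightarrow> smooth (iter_deriv \<alpha> f)"
proof (induction \<alpha>)
  case (Cons i \<alpha>)
  then show ?case using smooth_partial_deriv[of "iter_deriv \<alpha> f" i]
    by (auto simp: iter_deriv_def multi_indices_def)
qed (simp add: iter_deriv_def)

lemma has_derivative_imp_partial_deriv:
  "(f has_derivative f') (at x) \<Longrightarrow> partial_deriv i f x = f' i"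
  unfolding partial_deriv_def by (metis frechet_derivative_at)

lemma smooth_has_derivative: "smooth f \<Longrightarrow> (f has_derivative frechet_derivative f (at x)) (at x)"
  using smooth_differentiable frechet_derivative_works by blast

lemma smooth_continuous_on: "smooth f \<Longrightarrow> continuous_on S f"
  by (meson differentiable_imp_continuous_within smooth_differentiable
      continuous_at_imp_continuous_on)

lemma partial_deriv_const: "partial_deriv i (\<lambda>x. c) = (\<lambda>x. 0)"
  by (rule ext, rule has_derivative_imp_partial_deriv) auto

lemma partial_deriv_add_at:
  assumes "f differentiable (at x)" "g differentiable (at x)"
  shows "partial_deriv i (\<lambda>x. f x + g x) x = partial_deriv i f x + partial_deriv i g x"
  using has_derivative_imp_partial_deriv[OF has_derivative_add[OF
      assms(1)[unfolded frechet_derivative_works] assms(2)[unfolded frechet_derivative_works]]]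
  by (simp add: partial_deriv_def)

lemma partial_deriv_add:
  assumes "smooth f" "smooth g"
  shows "partial_deriv i (\<lambda>x. f x + g x) = (\<lambda>x. partial_deriv i f x + partial_deriv i g x)"
  using partial_deriv_add_at smooth_differentiable assms by blast

lemma partial_deriv_mult_at:
  assumes "f differentiable (at x)" "g differentiable (at x)"
  shows "partial_deriv i (\<lambda>x. f x * g x) x = f x * partial_deriv i g x + partial_deriv i f x * g x"
  using has_derivative_imp_partial_deriv[OF has_derivative_mult[OF
      assms(1)[unfolded frechet_derivative_works] assms(2)[unfolded frechet_derivative_works]]]
  by (simp add: partial_deriv_def)

lemma partial_deriv_mult:
  assumes "smooth f" "smooth g"
  shows "partial_deriv i (\<lambda>x. f x * g x) =
    (\<lambda>x. f x * partial_deriv i g x + partial_deriv i f x * g x)"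
  using partial_deriv_mult_at smooth_differentiable assms by blast

lemma smooth_const: "smooth (\<lambda>x. c)"
  by (rule smooth_coinduct[of _ "{f. \<exists>c. f = (\<lambda>x. c)}"]) (auto simp: partial_deriv_const)

text \<open>The product of two smooth functions has derivatives of growing length; by Leibniz' rule the algebra
  generated by the smooth functions is nevertheless stable under partial derivatives.\<close>

inductive_set smooth_algebra :: "('a::euclidean_space \<Rightarrow> complex) set" where
  base: "smooth f \<Longrightarrow> f \<in> smooth_algebra"
| add: "f \<in> smooth_algebra \<Longrightarrow> g \<in> smooth_algebra \<Longrightarrow> (\<lambda>x. f x + g x) \<in> smooth_algebra"
| mult: "f \<in> smooth_algebra \<Longrightarrow> g \<in> smooth_algebra \<Longrightarrow> (\<lambda>x. f x * g x) \<in> smooth_algebra"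

lemma smooth_algebra_differentiable:
  "f \<in> smooth_algebra \<Longrightarrow> f differentiable (at x)"
  by (induction rule: smooth_algebra.induct) (auto intro: smooth_differentiable)

lemma smooth_algebra_partial_deriv:
  assumes "f \<in> smooth_algebra" "i \<in> Basis"
  shows "partial_deriv i f \<in> smooth_algebra"
  using assms
proof (induction rule: smooth_algebra.induct)
  case (base f)
  then show ?case by (intro smooth_algebra.base smooth_partial_deriv)
next
  case (add f g)
  have "partial_deriv i (\<lambda>x. f x + g x) = (\<lambda>x. partial_deriv i f x + partial_deriv i g x)"
    using partial_deriv_add_at smooth_algebra_differentiable add.hyps by blast
  then show ?case using add by (auto intro: smooth_algebra.add)
next
  case (mult f g)
  have "partial_deriv i (\<lambda>x. f x * g x) =
      (\<lambda>x. f x * partial_deriv i g x + partial_deriv i f x * g x)"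
    using partial_deriv_mult_at smooth_algebra_differentiable mult.hyps by blast
  then show ?case using mult by (auto intro!: smooth_algebra.add smooth_algebra.mult)
qed

lemma smooth_algebra_smooth: "f \<in> smooth_algebra \<Longrightarrow> smooth f"
  by (erule smooth_coinduct)
     (auto intro: smooth_algebra_differentiable smooth_algebra_partial_deriv)

lemma smooth_add: "smooth f \<Longrightarrow> smooth g \<Longrightarrow> smooth (\<lambda>x. f x + g x)"
  and smooth_mult: "smooth f \<Longrightarrow> smooth g \<Longrightarrow> smooth (\<lambda>x. f x * g x)"
  by (auto intro: smooth_algebra_smooth smooth_algebra.intros)

lemma partial_deriv_cmult: "smooth f \<Longrightarrow> partial_deriv i (\<lambda>x. c * f x) = (\<lambda>x. c * partial_deriv i f x)"
  by (subst partial_deriv_mult) (auto simp: smooth_const partial_deriv_const)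

lemma smooth_prod:
  assumes "finite I" "\<And>i. i \<in> I \<Longrightarrow> smooth (f i)"
  shows "smooth (\<lambda>x. \<Prod>i\<in>I. f i x)"
  using assms by (induction I rule: finite_induct) (auto intro: smooth_const smooth_mult)

lemma partial_deriv_cnj:
  assumes "smooth f"
  shows "partial_deriv i (\<lambda>x. cnj (f x)) = (\<lambda>x. cnj (partial_deriv i f x))"
proof
  fix x
  show "partial_deriv i (\<lambda>x. cnj (f x)) x = cnj (partial_deriv i f x)"
    using has_derivative_imp_partial_deriv[OF bounded_linear.has_derivative[OF bounded_linear_cnj
          smooth_has_derivative[OF assms]]]
    by (simp add: partial_deriv_def)
qed

lemma smooth_cnj:
  assumes "smooth f"
  shows "smooth (\<lambda>x. cnj (f x))"
proof (rule smooth_coinduct[of _ "{(\<lambda>x. cnj (f x)) | f. smooth f}"])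
  show "f differentiable (at x)" if "f \<in> {(\<lambda>x. cnj (f x)) | f. smooth f}"
    for x :: 'a and f :: "'a \<Rightarrow> complex"
    using that bounded_linear.has_derivative[OF bounded_linear_cnj smooth_has_derivative]
    by (auto simp: differentiable_def)
qed (use assms in \<open>auto simp: partial_deriv_cnj intro: smooth_partial_deriv\<close>)

text \<open>The exponential of \<open>(p + i q)\<cdot>x\<close>. It is harmonic exactly if \<open>p\<close> and \<open>q\<close> are orthogonal and of
  equal length.\<close>

definition cexp :: "'a::euclidean_space \<Rightarrow> 'a \<Rightarrow> 'a \<Rightarrow> complex" where
  "cexp p q x = exp (Complex (p \<bullet> x) (q \<bullet> x))"

lemma norm_cexp: "norm (cexp p q x) = exp (p \<bullet> x)"
  by (simp add: cexp_def norm_exp_eq_Re)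

lemma cexp_add: "cexp p q (x + y) = cexp p q x * cexp p q y"
  by (simp add: cexp_def inner_add_right exp_add[symmetric] plus_complex.ctr)

lemma has_derivative_cexp:
  "(cexp p q has_derivative (\<lambda>h. Complex (p \<bullet> h) (q \<bullet> h) * cexp p q x)) (at x)"
proof -
  have *: "(\<lambda>x. Complex (p \<bullet> x) (q \<bullet> x)) = (\<lambda>x. of_real (p \<bullet> x) + \<i> * of_real (q \<bullet> x))"
    by (auto simp: complex_eq_iff)
  have "((\<lambda>x. of_real (p \<bullet> x) + \<i> * of_real (q \<bullet> x)) has_derivative
     (\<lambda>h. of_real (p \<bullet> h) + \<i> * of_real (q \<bullet> h))) (at x)"
    by (auto intro!: derivative_eq_intros)
  then have "((\<lambda>x. Complex (p \<bullet> x) (q \<bullet> x)) has_derivative (\<lambda>x. Complex (p \<bullet> x) (q \<bullet> x))) (at x)"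
    unfolding * .
  then have "((\<lambda>x. exp (Complex (p \<bullet> x) (q \<bullet> x))) has_derivative 
     (\<lambda>h. Complex (p \<bullet> h) (q \<bullet> h) * exp (Complex (p \<bullet> x) (q \<bullet> x)))) (at x)"
    using has_derivative_compose[of _ _ x UNIV exp "(*) (exp (Complex (p \<bullet> x) (q \<bullet> x)))"]
      DERIV_exp[of "Complex (p \<bullet> x) (q \<bullet> x)"]
    by (simp add: has_field_derivative_def o_def mult.commute)
  then show ?thesis unfolding cexp_def[abs_def] by simp
qed

lemma partial_deriv_cexp:
  "partial_deriv i (cexp p q) = (\<lambda>x. Complex (p \<bullet> i) (q \<bullet> i) * cexp p q x)"
  by (rule ext, rule has_derivative_imp_partial_deriv, rule has_derivative_cexp)

lemma partial_deriv_cmult_at: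
  assumes "f differentiable (at x)"
  shows "partial_deriv i (\<lambda>x. c * f x) x = c * partial_deriv i f x"
  by (subst partial_deriv_mult_at) (auto simp: assms partial_deriv_const)

lemma smooth_cexp: "smooth (cexp p q)"
proof (rule smooth_coinduct[of _ "{(\<lambda>x. c * cexp p q x) | c. True}"])
  have d: "cexp p q differentiable (at x)" for x
    using has_derivative_cexp by (auto simp: differentiable_def)
  show "cexp p q \<in> {(\<lambda>x. c * cexp p q x) | c. True}"
    by (auto intro!: exI[of _ 1])
  show "f differentiable (at x)" if "f \<in> {(\<lambda>x. c * cexp p q x) | c. True}" for f x
    using that d by auto
  fix f and i :: 'a assume "f \<in> {(\<lambda>x. c * cexp p q x) | c. True}"
  then obtain c where f: "f = (\<lambda>x. c * cexp p q x)" by auto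
  have "partial_deriv i f = (\<lambda>x. (c * Complex (p \<bullet> i) (q \<bullet> i)) * cexp p q x)"
    unfolding f by (auto simp: partial_deriv_cmult_at[OF d] partial_deriv_cexp)
  then show "partial_deriv i f \<in> {(\<lambda>x. c * cexp p q x) | c. True}" by blast
qed

text \<open>The functions \<open>P(1/t) e\<^bsup>-1/t\<^esup>\<close>, continued by zero to \<open>t \<le> 0\<close>. The polynomial is
  there to make the family stable under differentiation; the cutoff functions below use \<open>P = 1\<close>.\<close>

definition flat :: "real poly \<Rightarrow> real \<Rightarrow> real" where
  "flat P t = (if t \<le> 0 then 0 else poly P (1 / t) * exp (- 1 / t))"

lemma flat_tendsto_0: "((\<lambda>t::real. poly P (1 / t) * exp (- 1 / t)) \<longlongrightarrow> 0) (at_right 0)"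
proof -
  have "((\<lambda>s. poly P s * exp (- s)) \<longlongrightarrow> 0) at_top"
  proof -
    have "((\<lambda>s. \<Sum>k\<le>degree P. coeff P k * (s ^ k / exp s)) \<longlongrightarrow> (\<Sum>k\<le>degree P. coeff P k * 0)) at_top"
      by (intro tendsto_sum tendsto_mult tendsto_const) (rule tendsto_power_div_exp_0)
    then show ?thesis
      by (simp add: poly_altdef sum_distrib_right exp_minus divide_inverse mult.assoc)
  qed
  from filterlim_compose[OF this filterlim_inverse_at_top_right]
  show ?thesis by (simp add: divide_inverse)
qed

text \<open>The inner derivative of \<open>1/t\<close> produces the factor \<open>monom 1 2\<close>. At \<open>0\<close> the difference quotient is again
  such a function and tends to zero.\<close>

lemma flat_has_derivative:
  "(flat P has_real_derivative flat (monom 1 2 * (P - pderiv P)) t) (at t)"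
proof (cases t "0::real" rule: linorder_cases)
  case less
  have "(flat P has_real_derivative 0) (at t)"
    by (rule has_field_derivative_transform_within_open[of "\<lambda>t. 0" _ _ "{..<0}"])
       (use less in \<open>auto simp: flat_def\<close>)
  then show ?thesis using less by (simp add: flat_def)
next
  case greater
  have "((\<lambda>t. poly P (1 / t) * exp (- 1 / t)) has_real_derivative
      flat (monom 1 2 * (P - pderiv P)) t) (at t)"
  proof -
    have 1: "((\<lambda>t. 1 / t) has_real_derivative - ((1 / t)\<^sup>2)) (at t)"
      using greater by (auto intro!: derivative_eq_intros simp: power2_eq_square)
    have 2: "((\<lambda>t. - 1 / t) has_real_derivative (1 / t)\<^sup>2) (at t)"
      using DERIV_minus[OF 1] by simp
    have "((\<lambda>t. poly P (1 / t) * exp (- 1 / t)) has_real_derivative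
        poly P (1 / t) * (exp (- 1 / t) * (1 / t)\<^sup>2)
          + poly (pderiv P) (1 / t) * - ((1 / t)\<^sup>2) * exp (- 1 / t)) (at t)"
      by (rule DERIV_mult'[OF DERIV_chain2[OF poly_DERIV 1] DERIV_chain2[OF DERIV_exp 2]])
    then show ?thesis
      using greater by (simp add: flat_def poly_monom algebra_simps)
  qed
  then show ?thesis
    by (rule has_field_derivative_transform_within_open[of _ _ _ "{0<..}"])
       (use greater in \<open>auto simp: flat_def\<close>)
next
  case equal
  have "((\<lambda>s. flat P s / s) \<longlongrightarrow> 0) (at 0)"
  proof (rule filterlim_split_at_real)
    have "\<forall>\<^sub>F s in at_left (0::real). 0 = flat P s / s"
      by (auto simp: eventually_at_filter flat_def)
    then show "((\<lambda>s. flat P s / s) \<longlongrightarrow> 0) (at_left 0)"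
      by (rule Lim_transform_eventually[rotated]) simp
    have "\<forall>\<^sub>F s in at_right (0::real). poly (monom 1 1 * P) (1 / s) * exp (- 1 / s) = flat P s / s"
      by (auto simp: eventually_at_filter flat_def poly_monom)
    then show "((\<lambda>s. flat P s / s) \<longlongrightarrow> 0) (at_right 0)"
      by (rule Lim_transform_eventually[OF flat_tendsto_0])
  qed
  then show ?thesis using equal by (simp add: has_field_derivative_iff flat_def)
qed

lemma smooth_flat: "smooth (\<lambda>x. of_real (flat P (a \<bullet> x + b)))"
proof (rule smooth_coinduct[of _ "{(\<lambda>x. of_real (flat P (a \<bullet> x + b))) | P. True}"])
  have D: "((\<lambda>x. of_real (flat P (a \<bullet> x + b))) has_derivative
     (\<lambda>h. of_real (flat (monom 1 2 * (P - pderiv P)) (a \<bullet> x + b) * (a \<bullet> h)))) (at x)" for P x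
  proof (rule has_derivative_of_real)
    have "((\<lambda>x. a \<bullet> x + b) has_derivative (\<lambda>h. a \<bullet> h)) (at x)"
      by (auto intro!: derivative_eq_intros)
    from has_derivative_compose[OF this, of "flat P"] 
    show "((\<lambda>x. flat P (a \<bullet> x + b)) has_derivative
     (\<lambda>h. flat (monom 1 2 * (P - pderiv P)) (a \<bullet> x + b) * (a \<bullet> h))) (at x)"
      using flat_has_derivative[of P "a \<bullet> x + b"] by (simp add: has_field_derivative_def)
  qed
  let ?S = "{(\<lambda>x. of_real (flat P (a \<bullet> x + b))) | P. True} :: ('a \<Rightarrow> complex) set"
  show "(\<lambda>x. of_real (flat P (a \<bullet> x + b))) \<in> ?S" by auto
  show "f differentiable (at x)" if "f \<in> ?S" for f x
    using that D by (auto simp: differentiable_def)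
  fix f and i :: 'a assume "f \<in> ?S"
  then obtain P where f: "f = (\<lambda>x. of_real (flat P (a \<bullet> x + b)))" by auto
  have "partial_deriv i f = (\<lambda>x. of_real (flat (smult (a \<bullet> i) (monom 1 2 * (P - pderiv P))) (a \<bullet> x + b)))"
    unfolding f by (rule ext, subst has_derivative_imp_partial_deriv[OF D])
      (simp add: flat_def mult_ac)
  then show "partial_deriv i f \<in> ?S" by blast
qed

section \<open>Test functions\<close>

lemma test_functionI:
  assumes "test_function \<Omega> \<eta>" "smooth f" "{x. f x \<noteq> 0} \<subseteq> closure {x. \<eta> x \<noteq> 0}"
  shows "test_function \<Omega> f"
proof -
  have "closure {x. f x \<noteq> 0} \<subseteq> closure {x. \<eta> x \<noteq> 0}"
    using assms(3) by (simp add: closure_minimal)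
  moreover from this have "compact (closure {x. f x \<noteq> 0})"
    using assms(1) by (auto simp: test_function_def compact_eq_bounded_closed dest: bounded_subset)
  ultimately show ?thesis using assms by (auto simp: test_function_def)
qed

lemma test_function_smooth: "test_function \<Omega> \<eta> \<Longrightarrow> smooth \<eta>"
  by (simp add: test_function_def)

lemma test_function_mult:
  assumes "smooth f" "test_function \<Omega> \<eta>"
  shows "test_function \<Omega> (\<lambda>x. f x * \<eta> x)"
  using assms closure_subset[of "{x. \<eta> x \<noteq> 0}"]
  by (intro test_functionI[OF assms(2)] smooth_mult) (auto simp: test_function_smooth)

lemma test_function_cnj:
  assumes "test_function \<Omega> \<eta>"
  shows "test_function \<Omega> (\<lambda>x. cnj (\<eta> x))"
  using assms closure_subset[of "{x. \<eta> x \<noteq> 0}"]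
  by (intro test_functionI[OF assms] smooth_cnj) (auto simp: test_function_smooth)

lemma partial_deriv_eq_0_outside:
  assumes "x \<notin> closure {x. f x \<noteq> 0}"
  shows "partial_deriv i f x = 0"
proof -
  have "((\<lambda>x. 0) has_derivative (\<lambda>h. 0)) (at x)" by simp
  then have "(f has_derivative (\<lambda>h. 0)) (at x)"
    by (rule has_derivative_transform_within_open[where s="- closure {x. f x \<noteq> 0}"])
      (use assms closure_subset[of "{x. f x \<noteq> 0}"] in auto)
  then show ?thesis by (rule has_derivative_imp_partial_deriv)
qed

lemma test_function_partial_deriv:
  assumes "test_function \<Omega> \<eta>" "i \<in> Basis"
  shows "test_function \<Omega> (partial_deriv i \<eta>)"
  using assms partial_deriv_eq_0_outside[of _ \<eta> i]
  by (intro test_functionI[OF assms(1)] smooth_partial_deriv) (auto simp: test_function_smooth)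

lemma test_function_iter_deriv:
  "test_function \<Omega> \<eta> \<Longrightarrow> \<alpha> \<in> multi_indices \<Longrightarrow> test_function \<Omega> (iter_deriv \<alpha> \<eta>)"
proof (induction \<alpha>)
  case (Cons i \<alpha>)
  then show ?case using test_function_partial_deriv[of \<Omega> "iter_deriv \<alpha> \<eta>" i]
    by (auto simp: iter_deriv_def multi_indices_def)
qed (simp add: iter_deriv_def)

lemma test_function_indicator:
  assumes "test_function \<Omega> \<eta>"
  shows "indicator \<Omega> x *\<^sub>R \<eta> x = \<eta> x"
  using assms closure_subset[of "{x. \<eta> x \<noteq> 0}"] by (auto simp: test_function_def indicator_def)

lemma test_function_borel:
  assumes "test_function \<Omega> \<eta>"
  shows "\<eta> \<in> borel_measurable borel"
  by (rule borel_measurable_continuous_onI[OF smooth_continuous_on[OF test_function_smooth[OF assms]]])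

lemma test_function_integrable:
  assumes "test_function \<Omega> \<eta>"
  shows "integrable lborel \<eta>"
proof -
  have "integrable lborel (\<lambda>x. indicator (closure {x. \<eta> x \<noteq> 0}) x *\<^sub>R \<eta> x)"
    using assms by (intro borel_integrable_compact smooth_continuous_on) (auto simp: test_function_def)
  moreover have "(\<lambda>x. indicator (closure {x. \<eta> x \<noteq> 0}) x *\<^sub>R \<eta> x) = \<eta>"
    using closure_subset[of "{x. \<eta> x \<noteq> 0}"] by (auto simp: indicator_def fun_eq_iff)
  ultimately show ?thesis by simp
qed

lemma test_function_bounded:
  assumes "test_function \<Omega> \<eta>"
  obtains B where "0 \<le> B" "\<And>x. norm (\<eta> x) \<le> B"
proof -
  have "compact (\<eta> ` closure {x. \<eta> x \<noteq> 0})"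
    using assms by (intro compact_continuous_image smooth_continuous_on) (auto simp: test_function_def)
  then obtain B where B: "B > 0" "\<And>x. x \<in> closure {x. \<eta> x \<noteq> 0} \<Longrightarrow> norm (\<eta> x) \<le> B"
    by (auto dest!: compact_imp_bounded simp: bounded_pos)
  have "norm (\<eta> x) \<le> B" for x
    using B closure_subset[of "{x. \<eta> x \<noteq> 0}"] by (cases "\<eta> x = 0") auto
  with B show ?thesis by (intro that[of B]) auto
qed

lemma integral_lebesgue_on_test:
  assumes "test_function \<Omega> \<eta>" "\<Omega> \<in> sets lebesgue"
  shows "(\<integral>x. \<eta> x \<partial>lebesgue_on \<Omega>) = (\<integral>x. \<eta> x \<partial>lborel)"
  using assms test_function_borel[OF assms(1)]
  by (simp add: integral_restrict_space test_function_indicator integral_completion)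

lemma integrable_lebesgue_on_test:
  assumes "test_function \<Omega> \<eta>" "\<Omega> \<in> sets lebesgue"
  shows "integrable (lebesgue_on \<Omega>) \<eta>"
  using assms test_function_borel[OF assms(1)] test_function_integrable[OF assms(1)]
  by (simp add: integrable_restrict_space test_function_indicator integrable_completion)

text \<open>The integral of a difference quotient vanishes because Lebesgue measure is translation
  invariant; let the step tend to zero under the integral sign.\<close>

lemma integral_partial_deriv_test:
  assumes "test_function \<Omega> \<eta>" "i \<in> Basis"
  shows "(\<integral>x. partial_deriv i \<eta> x \<partial>lborel) = 0"
proof -
  note [measurable] = test_function_borel[OF assms(1)]
    test_function_borel[OF test_function_partial_deriv[OF assms]]
  obtain B where B: "0 \<le> B" "\<And>x. norm (partial_deriv i \<eta> x) \<le> B"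
    using test_function_bounded[OF test_function_partial_deriv[OF assms]] by blast
  obtain r where r: "\<And>x. \<eta> x \<noteq> 0 \<Longrightarrow> norm x \<le> r"
    using assms(1) closure_subset[of "{x. \<eta> x \<noteq> 0}"]
    unfolding test_function_def compact_eq_bounded_closed bounded_iff by blast
  define s :: "nat \<Rightarrow> real" where "s n = 1 / (real n + 1)" for n
  have s: "0 < s n" "s n \<le> 1" for n by (auto simp: s_def)
  have s0: "s \<longlonglongrightarrow> 0"
    using LIMSEQ_inverse_real_of_nat by (simp add: s_def[abs_def] divide_inverse add.commute)
  define D where "D n x = (\<eta> (x + s n *\<^sub>R i) - \<eta> x) /\<^sub>R s n" for n x
  have line: "((\<lambda>t. \<eta> (x + t *\<^sub>R i)) has_derivative (\<lambda>h. h *\<^sub>R partial_deriv i \<eta> (x + t *\<^sub>R i))) (at t within S)"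
    for x t S
  proof -
    have 1: "((\<lambda>t. x + t *\<^sub>R i) has_derivative (\<lambda>h. h *\<^sub>R i)) (at t within S)"
      by (auto intro!: derivative_eq_intros)
    have 2: "(\<eta> has_derivative frechet_derivative \<eta> (at (x + t *\<^sub>R i))) (at (x + t *\<^sub>R i))"
      by (rule smooth_has_derivative[OF test_function_smooth[OF assms(1)]])
    from has_derivative_compose[OF 1 2] linear_scale[OF has_derivative_linear[OF 2]]
    show ?thesis by (simp add: partial_deriv_def)
  qed
  have D_bound: "norm (D n x) \<le> B" for n x
  proof -
    have "norm (\<eta> (x + s n *\<^sub>R i) - \<eta> (x + 0 *\<^sub>R i)) \<le> B * norm (s n - 0)"
    proof (rule differentiable_bound[OF _ line, of UNIV])
      show "onorm (\<lambda>h. h *\<^sub>R partial_deriv i \<eta> (x + t *\<^sub>R i)) \<le> B" for t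
        using B by (intro onorm_le) (auto simp: mult.commute[of B] intro: mult_left_mono)
    qed auto
    moreover have "norm (D n x) = norm (\<eta> (x + s n *\<^sub>R i) - \<eta> x) / s n"
      using s[of n] unfolding D_def by (simp only: norm_scaleR) (simp add: divide_inverse mult.commute)
    ultimately show ?thesis using s[of n] by (simp add: pos_divide_le_eq)
  qed
  have D_zero: "D n x = 0" if "x \<notin> cball 0 (r + 1)" for n x
  proof -
    have "norm (x + s n *\<^sub>R i) \<ge> norm x - norm (s n *\<^sub>R i)"
      using norm_diff_ineq by blast
    then have "norm (x + s n *\<^sub>R i) > r" using that s[of n] assms(2) by auto
    then have "\<eta> (x + s n *\<^sub>R i) = 0" "\<eta> x = 0" using r that by force+
    then show ?thesis by (simp add: D_def)
  qed
  have "(\<lambda>n. \<integral>x. D n x \<partial>lborel) \<longlonglongrightarrow> (\<integral>x. partial_deriv i \<eta> x \<partial>lborel)"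
  proof (rule integral_dominated_convergence[where w="\<lambda>x. indicator (cball 0 (r+1)) x *\<^sub>R B"])
    show "integrable lborel (\<lambda>x. indicator (cball (0::'a) (r+1)) x *\<^sub>R B)"
      by (intro borel_integrable_compact) auto
    show "AE x in lborel. norm (D n x) \<le> indicator (cball 0 (r+1)) x *\<^sub>R B" for n
      using D_bound[of n] D_zero[of _ n] by (intro AE_I2) (auto simp: indicator_def)
    show "AE x in lborel. (\<lambda>n. D n x) \<longlonglongrightarrow> partial_deriv i \<eta> x"
    proof (intro AE_I2)
      fix x
      have "((\<lambda>h. norm (\<eta> (x + h *\<^sub>R i) - \<eta> x - h *\<^sub>R partial_deriv i \<eta> x) / norm h) \<longlongrightarrow> 0) (at 0)"
        using line[of x 0 UNIV] by (simp add: has_derivative_at)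
      moreover have "norm (\<eta> (x + h *\<^sub>R i) - \<eta> x - h *\<^sub>R partial_deriv i \<eta> x) / norm h =
          norm ((\<eta> (x + h *\<^sub>R i) - \<eta> x) /\<^sub>R h - partial_deriv i \<eta> x)" if "h \<noteq> 0" for h
      proof -
        have "(\<eta> (x + h *\<^sub>R i) - \<eta> x) /\<^sub>R h - partial_deriv i \<eta> x =
            (\<eta> (x + h *\<^sub>R i) - \<eta> x - h *\<^sub>R partial_deriv i \<eta> x) /\<^sub>R h"
          using that by (simp only: scaleR_diff_right[of "inverse h" _ "h *\<^sub>R _"]) simp
        then show ?thesis by (simp add: divide_inverse mult.commute)
      qed
      ultimately have "((\<lambda>h. norm ((\<eta> (x + h *\<^sub>R i) - \<eta> x) /\<^sub>R h - partial_deriv i \<eta> x)) \<longlongrightarrow> 0) (at 0)"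
        by (elim Lim_transform_eventually) (auto simp: eventually_at_filter)
      then have "((\<lambda>h. (\<eta> (x + h *\<^sub>R i) - \<eta> x) /\<^sub>R h) \<longlongrightarrow> partial_deriv i \<eta> x) (at 0)"
        by (subst Lim_null) (rule tendsto_norm_zero_cancel)
      moreover have "filterlim s (at 0) sequentially"
        using s0 less_imp_neq[OF s(1)] by (auto simp: filterlim_at intro!: always_eventually)
      ultimately show "(\<lambda>n. D n x) \<longlonglongrightarrow> partial_deriv i \<eta> x"
        unfolding D_def by (rule filterlim_compose)
    qed
  qed (auto simp: D_def)
  moreover have "(\<integral>x. D n x \<partial>lborel) = 0" for n
  proof -
    have tr: "integrable lborel (\<lambda>x. \<eta> (x + s n *\<^sub>R i))"
      "(\<integral>x. \<eta> (x + s n *\<^sub>R i) \<partial>lborel) = (\<integral>x. \<eta> x \<partial>lborel)"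
      using test_function_integrable[OF assms(1)]
        integrable_distr_eq[of "(+) (s n *\<^sub>R i)" lborel borel \<eta>]
        integral_distr[of "(+) (s n *\<^sub>R i)" lborel borel \<eta>]
      by (auto simp: lborel_distr_plus add.commute)
    have "(\<integral>x. D n x \<partial>lborel) = ((\<integral>x. \<eta> (x + s n *\<^sub>R i) \<partial>lborel) - (\<integral>x. \<eta> x \<partial>lborel)) /\<^sub>R s n"
      unfolding D_def using tr(1) test_function_integrable[OF assms(1)] by simp
    then show ?thesis using tr by simp
  qed
  ultimately show ?thesis by (simp add: LIMSEQ_const_iff)
qed

lemma integral_by_parts_test:
  assumes "smooth f" "test_function \<Omega> \<eta>" "i \<in> Basis"
  shows "(\<integral>x. f x * partial_deriv i \<eta> x \<partial>lborel) = - (\<integral>x. partial_deriv i f x * \<eta> x \<partial>lborel)"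
proof -
  have "(\<integral>x. f x * partial_deriv i \<eta> x + partial_deriv i f x * \<eta> x \<partial>lborel) = 0"
    using integral_partial_deriv_test[OF test_function_mult[OF assms(1,2)] assms(3)]
    by (simp add: partial_deriv_mult assms test_function_smooth[OF assms(2)])
  moreover have "integrable lborel (\<lambda>x. f x * partial_deriv i \<eta> x)"
    "integrable lborel (\<lambda>x. partial_deriv i f x * \<eta> x)"
    using test_function_integrable test_function_mult smooth_partial_deriv
      test_function_partial_deriv assms by blast+
  ultimately show ?thesis by (simp add: eq_neg_iff_add_eq_0)
qed

text \<open>Each integration by parts removes the outermost derivative of the test function and puts it
  innermost on the other factor; this reverses the multi-index.\<close>

lemma has_weak_deriv_smooth:
  assumes "smooth f" "\<alpha> \<in> multi_indices" "\<Omega> \<in> sets lebesgue"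
  shows "has_weak_deriv \<Omega> \<alpha> f (iter_deriv (rev \<alpha>) f)"
proof -
  have "(\<integral>x. f x * iter_deriv \<alpha> \<eta> x \<partial>lborel) =
      (- 1) ^ length \<alpha> * (\<integral>x. iter_deriv (rev \<alpha>) f x * \<eta> x \<partial>lborel)"
    if "test_function \<Omega> \<eta>" for \<eta>
    using assms(1,2)
  proof (induction \<alpha> arbitrary: f)
    case Nil
    then show ?case by (simp add: iter_deriv_def)
  next
    case (Cons i \<alpha>)
    have i: "i \<in> Basis" "\<alpha> \<in> multi_indices" using Cons.prems by (auto simp: multi_indices_def)
    have "(\<integral>x. f x * iter_deriv (i # \<alpha>) \<eta> x \<partial>lborel) =
        - (\<integral>x. partial_deriv i f x * iter_deriv \<alpha> \<eta> x \<partial>lborel)"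
      using integral_by_parts_test[OF Cons.prems(1) test_function_iter_deriv[OF that i(2)] i(1)]
      by (simp add: iter_deriv_def)
    then show ?case
      using Cons.IH[OF smooth_partial_deriv[OF Cons.prems(1) i(1)] i(2)] by (simp add: iter_deriv_def)
  qed
  moreover have "rev \<alpha> \<in> multi_indices" using assms(2) by (simp add: multi_indices_def)
  ultimately show ?thesis unfolding has_weak_deriv_def
    using assms by (auto simp: integral_lebesgue_on_test test_function_mult smooth_iter_deriv
        test_function_iter_deriv)
qed

section \<open>The fundamental lemma of the calculus of variations\<close>

lemma flat_1: "flat 1 t = (if t \<le> 0 then 0 else exp (- 1 / t))"
  by (simp add: flat_def)

lemma flat_1_bounds: "0 \<le> flat 1 t" "flat 1 t \<le> 1"
  by (auto simp: flat_1)

lemma flat_1_scaled_tendsto: "0 < t \<Longrightarrow> (\<lambda>m. flat 1 (real m * t)) \<longlonglongrightarrow> 1"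
proof -
  assume t: "0 < t"
  have "(\<lambda>m. exp (- (1 / t) * inverse (real m))) \<longlonglongrightarrow> exp (- (1 / t) * 0)"
    by (intro tendsto_intros lim_inverse_n)
  moreover have "\<forall>\<^sub>F m in sequentially. exp (- (1 / t) * inverse (real m)) = flat 1 (real m * t)"
    using eventually_gt_at_top[of 0]
  proof eventually_elim
    case (elim m)
    then have "\<not> real m * t \<le> 0" using t by (simp add: not_le)
    then show ?case by (simp add: flat_1 field_simps)
  qed
  ultimately show ?thesis by (auto elim: Lim_transform_eventually)
qed

text \<open>As \<open>m\<close> grows, \<open>flat 1 (m t)\<close> increases to the indicator function of \<open>t > 0\<close>; the approximants are products of
  such factors, one for each face of the box.\<close>

lemma box_approx_test_functions:
  fixes a b :: "'a::euclidean_space"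
  assumes "cbox a b \<subseteq> \<Omega>"
  obtains \<zeta> :: "nat \<Rightarrow> 'a \<Rightarrow> complex" where "\<And>m. test_function \<Omega> (\<zeta> m)" "\<And>m x. norm (\<zeta> m x) \<le> 1"
    "\<And>x. (\<lambda>m. \<zeta> m x) \<longlonglongrightarrow> indicator (box a b) x"
proof
  define \<zeta> :: "nat \<Rightarrow> 'a \<Rightarrow> complex" where
    "\<zeta> m x = (\<Prod>i\<in>Basis. of_real (flat 1 (real m * (x \<bullet> i - a \<bullet> i))) * of_real (flat 1 (real m * (b \<bullet> i - x \<bullet> i))))"
    for m x
  have out: "\<zeta> m x = 0" if "x \<notin> box a b" for m x
  proof -
    have "\<exists>i\<in>Basis. x \<bullet> i \<le> a \<bullet> i \<or> b \<bullet> i \<le> x \<bullet> i"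
      using that unfolding mem_box by (meson not_less)
    then obtain i where i: "i \<in> Basis" "x \<bullet> i \<le> a \<bullet> i \<or> b \<bullet> i \<le> x \<bullet> i" by blast
    then have "flat 1 (real m * (x \<bullet> i - a \<bullet> i)) = 0 \<or> flat 1 (real m * (b \<bullet> i - x \<bullet> i)) = 0"
      by (auto simp: flat_1 mult_nonneg_nonpos)
    then show ?thesis unfolding \<zeta>_def using i(1) by (intro prod_zero) auto
  qed
  show "test_function \<Omega> (\<zeta> m)" for m
  proof -
    have 1: "smooth (\<lambda>x. of_real (flat 1 (real m * (x \<bullet> i - a \<bullet> i))) :: complex)" for i
      using smooth_flat[of 1 "real m *\<^sub>R i" "- real m * (a \<bullet> i)"] 
      by (simp add: algebra_simps inner_commute)
    have 2: "smooth (\<lambda>x. of_real (flat 1 (real m * (b \<bullet> i - x \<bullet> i))) :: complex)" for i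
      using smooth_flat[of 1 "- (real m *\<^sub>R i)" "real m * (b \<bullet> i)"] 
      by (simp add: algebra_simps inner_commute)
    have "smooth (\<zeta> m)"
      unfolding \<zeta>_def[abs_def] by (intro smooth_prod smooth_mult 1 2) auto
    moreover have sub: "closure {x. \<zeta> m x \<noteq> 0} \<subseteq> cbox a b"
      using out[of _ m] box_subset_cbox[of a b] by (intro closure_minimal) auto
    moreover have "compact (closure {x. \<zeta> m x \<noteq> 0})"
      using bounded_subset[OF bounded_cbox sub] by (simp add: compact_eq_bounded_closed)
    ultimately show ?thesis using assms by (auto simp: test_function_def)
  qed
  show "norm (\<zeta> m x) \<le> 1" for m x
    unfolding \<zeta>_def prod_norm[symmetric]
    by (intro prod_le_1) (auto simp: norm_mult flat_1_bounds intro!: mult_le_one)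
  show "(\<lambda>m. \<zeta> m x) \<longlonglongrightarrow> indicator (box a b) x" for x
  proof (cases "x \<in> box a b")
    case True
    have "(\<lambda>m. \<zeta> m x) \<longlonglongrightarrow> (\<Prod>i\<in>(Basis::'a set). of_real 1 * of_real 1)"
      unfolding \<zeta>_def
      by (rule Limits.tendsto_prod, rule tendsto_mult)
        (use True in \<open>auto intro!: tendsto_of_real flat_1_scaled_tendsto simp: box_def simp del: of_real_1\<close>)
    then show ?thesis using True by simp
  next
    case False
    then show ?thesis using out by (simp add: indicator_def)
  qed
qed

text \<open>By dominated convergence the integral over every box inside \<open>\<Omega>\<close> vanishes. Boxes are stable under
  intersection and generate the Borel sets, so inside one such box all set integrals vanish; and countably
  many closed boxes cover \<open>\<Omega>\<close>.\<close>

lemma fundamental_lemma_variations: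
  fixes f :: "'a::euclidean_space \<Rightarrow> complex"
  assumes "open \<Omega>" "integrable (lebesgue_on \<Omega>) f"
    and zero: "\<And>\<eta>. test_function \<Omega> \<eta> \<Longrightarrow> (\<integral>x. f x * \<eta> x \<partial>lebesgue_on \<Omega>) = 0"
  shows "AE x in lebesgue_on \<Omega>. f x = 0"
proof -
  have \<Omega>: "\<Omega> \<in> sets lebesgue" using assms(1) by simp
  define F where "F x = indicator \<Omega> x *\<^sub>R f x" for x
  have F: "integrable lebesgue F"
    using assms(2) \<Omega> by (simp add: integrable_restrict_space F_def[abs_def])
  have FB: "integrable lebesgue (\<lambda>x. indicator B x *\<^sub>R F x)" if "B \<in> sets lebesgue" for B
    using F that by (intro integrable_mult_indicator)
  have box_zero: "(\<integral>x. indicator (box a b) x *\<^sub>R F x \<partial>lebesgue) = 0" if ab: "cbox a b \<subseteq> \<Omega>" for a b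
  proof -
    obtain \<zeta> :: "nat \<Rightarrow> 'a \<Rightarrow> complex" where \<zeta>: "\<And>m. test_function \<Omega> (\<zeta> m)" "\<And>m x. norm (\<zeta> m x) \<le> 1"
      "\<And>x. (\<lambda>m. \<zeta> m x) \<longlonglongrightarrow> indicator (box a b) x"
      using box_approx_test_functions[OF ab] by blast
    have [measurable]: "\<zeta> m \<in> borel_measurable lebesgue" for m
      using test_function_borel[OF \<zeta>(1)] by (simp add: measurable_completion)
    have [measurable]: "F \<in> borel_measurable lebesgue" using F by auto
    have "(\<lambda>m. \<integral>x. F x * \<zeta> m x \<partial>lebesgue) \<longlonglongrightarrow> (\<integral>x. indicator (box a b) x *\<^sub>R F x \<partial>lebesgue)"
    proof (rule integral_dominated_convergence[where w="\<lambda>x. norm (F x)"])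
      show "AE x in lebesgue. (\<lambda>m. F x * \<zeta> m x) \<longlonglongrightarrow> indicator (box a b) x *\<^sub>R F x"
      proof (intro AE_I2)
        fix x
        have "(\<lambda>m. F x * \<zeta> m x) \<longlonglongrightarrow> F x * indicator (box a b) x"
          by (intro tendsto_intros \<zeta>)
        then show "(\<lambda>m. F x * \<zeta> m x) \<longlonglongrightarrow> indicator (box a b) x *\<^sub>R F x"
          by (auto simp: indicator_def split: if_splits)
      qed
      show "AE x in lebesgue. norm (F x * \<zeta> m x) \<le> norm (F x)" for m
        using \<zeta>(2)[of m] by (auto simp: norm_mult intro!: AE_I2 mult_left_le)
    qed (use F FB[of "box a b"] in auto)
    moreover have "(\<integral>x. F x * \<zeta> m x \<partial>lebesgue) = 0" for m
      using zero[OF \<zeta>(1)] \<Omega> by (simp add: integral_restrict_space F_def)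
    ultimately show ?thesis by (simp add: LIMSEQ_const_iff)
  qed
  have cbox_AE: "AE x in lebesgue. x \<in> cbox a b \<longrightarrow> f x = 0" if ab: "cbox a b \<subseteq> \<Omega>" for a b
  proof -
    let ?U = "box a b"
    let ?P = "\<lambda>B. (\<integral>x. indicator B x *\<^sub>R (indicator ?U x *\<^sub>R F x) \<partial>lebesgue) = 0"
    have FU: "integrable lebesgue (\<lambda>x. indicator ?U x *\<^sub>R F x)" by (intro FB) auto
    have sigma_boxes: "A \<in> sets lebesgue" if "A \<in> sigma_sets UNIV (range (\<lambda>(a, b). box a b))" for A :: "'a set"
    proof -
      have "A \<in> sets borel" using that by (subst borel_eq_box) (simp add: sets_measure_of)
      then show ?thesis by simp
    qed
    have borelP: "?P B" if B: "B \<in> sets borel" for B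
    proof -
      have mem: "B \<in> sigma_sets UNIV (range (\<lambda>(a, b). box a b))"
        using B by (subst (asm) borel_eq_box) (simp add: sets_measure_of)
      have stable: "Int_stable (range (\<lambda>(a, b). box a b :: 'a set))"
        unfolding Int_stable_def by (auto simp: box_Int_box)
      have pow: "range (\<lambda>(a, b). box a b :: 'a set) \<subseteq> Pow UNIV" by simp
      from stable pow mem show ?thesis
      proof (induction rule: sigma_sets_induct_disjoint)
        case (basic A)
        then obtain c d where A: "A = box c d" by auto
        obtain c' d' where cd: "box c d \<inter> ?U = box c' d'" using box_Int_box[of c d a b] by blast
        show ?case
        proof (cases "box c' d' = {}")
          case True
          then have z: "indicator A x *\<^sub>R (indicator ?U x *\<^sub>R F x) = 0" for x
            using cd A by (auto simp: indicator_def)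
          show ?thesis unfolding z by simp
        next
          case False
          have "cbox c' d' \<subseteq> \<Omega>"
          proof -
            have "closure (box c' d') \<subseteq> cbox a b"
              using cd box_subset_cbox[of a b] by (intro closure_minimal) auto
            then show ?thesis using False ab closure_box[of c' d'] by auto
          qed
          from box_zero[OF this] have "(\<integral>x. indicator (box c' d') x *\<^sub>R F x \<partial>lebesgue) = 0" .
          then show ?thesis unfolding A cd[symmetric] by (simp add: indicator_inter_arith)
        qed
      next
        case empty
        show ?case by simp
      next
        case (compl A)
        have A: "A \<in> sets lebesgue"
          using compl.hyps by (intro sigma_boxes)
        have eq: "indicator (UNIV - A) x *\<^sub>R (indicator ?U x *\<^sub>R F x) =
            indicator ?U x *\<^sub>R F x - indicator A x *\<^sub>R (indicator ?U x *\<^sub>R F x)" for x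
          by (auto simp: indicator_def)
        show ?case
          unfolding eq using compl.IH box_zero[OF ab]
          by (subst Bochner_Integration.integral_diff[OF FU integrable_mult_indicator[OF A FU]]) simp
      next
        case (union A)
        have A: "A i \<in> sets lebesgue" for i
          using union.hyps by (intro sigma_boxes) auto
        have "(LINT x:(\<Union>i. A i)|lebesgue. indicator ?U x *\<^sub>R F x) =
            (\<Sum>i. (LINT x:(A i)|lebesgue. indicator ?U x *\<^sub>R F x))"
        proof (rule lebesgue_integral_countable_add)
          show "set_integrable lebesgue (\<Union>i. A i) (\<lambda>x. indicator ?U x *\<^sub>R F x)"
            unfolding set_integrable_def using A by (intro integrable_mult_indicator[OF _ FU]) auto
        qed (use A union.hyps(1) in \<open>auto simp: disjoint_family_on_def\<close>)
        then show ?case using union.IH by (simp add: set_lebesgue_integral_def)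
      qed
    qed
    have lebP: "?P B" if B: "B \<in> sets lebesgue" for B
    proof -
      obtain S N N' where S: "B = S \<union> N" "N \<subseteq> N'" "N' \<in> null_sets lborel" "S \<in> sets lborel"
        using sets_completionE[OF B] by blast
      have "AE x in lebesgue. x \<notin> N'" using S(3) by (intro AE_completion AE_not_in)
      then have "AE x in lebesgue. indicator B x *\<^sub>R (indicator ?U x *\<^sub>R F x) =
          indicator S x *\<^sub>R (indicator ?U x *\<^sub>R F x)"
        by eventually_elim (use S in \<open>auto simp: indicator_def\<close>)
      then have "(\<integral>x. indicator B x *\<^sub>R (indicator ?U x *\<^sub>R F x) \<partial>lebesgue) =
          (\<integral>x. indicator S x *\<^sub>R (indicator ?U x *\<^sub>R F x) \<partial>lebesgue)"
        by (intro integral_cong_AE[OF borel_measurable_integrable[OF integrable_mult_indicator[OF B FU]]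
              borel_measurable_integrable[OF integrable_mult_indicator[OF _ FU]]])
          (use S(4) in auto)
      then show ?thesis using borelP S(4) by simp
    qed
    interpret finite_measure "lebesgue_on ?U"
      by (intro finite_measure_lebesgue_on) auto
    have "AE x in lebesgue_on ?U. F x = 0"
    proof (rule density_zero)
      show "integrable (lebesgue_on ?U) F" using FU by (simp add: integrable_restrict_space)
      fix A assume "A \<in> sets (lebesgue_on ?U)"
      then have "A \<in> sets lebesgue" by (auto simp: sets_restrict_space)
      from lebP[OF this] show "set_lebesgue_integral (lebesgue_on ?U) A F = 0"
        by (simp add: set_lebesgue_integral_def integral_restrict_space mult.commute)
    qed
    then have "AE x in lebesgue. x \<in> ?U \<longrightarrow> F x = 0" by (simp add: AE_restrict_space_iff)
    moreover have "AE x in lebesgue. x \<notin> cbox a b - ?U"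
      by (intro AE_completion AE_not_in null_sets_cbox_Diff_box)
    ultimately show ?thesis
      by eventually_elim (use ab in \<open>auto simp: F_def indicator_def\<close>)
  qed
  obtain D where D: "countable D" "D \<subseteq> Pow \<Omega>" "\<And>X. X \<in> D \<Longrightarrow> \<exists>a b. X = cbox a b" "\<Union>D = \<Omega>"
    using open_countable_Union_open_cbox[OF assms(1)] by metis
  have "AE x in lebesgue. \<forall>X\<in>D. x \<in> X \<longrightarrow> f x = 0"
    unfolding AE_ball_countable[OF D(1)]
  proof
    fix X assume X: "X \<in> D"
    obtain a b where ab: "X = cbox a b" using D(3)[OF X] by blast
    have "cbox a b \<subseteq> \<Omega>" using D(2) X ab by auto
    from cbox_AE[OF this] show "AE x in lebesgue. x \<in> X \<longrightarrow> f x = 0" using ab by simp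
  qed
  then have "AE x in lebesgue. x \<in> \<Omega> \<longrightarrow> f x = 0"
    by eventually_elim (use D(4) in blast)
  then show ?thesis using \<Omega> by (simp add: AE_restrict_space_iff)
qed

section \<open>Square integrable functions\<close>

lemma square_integrableD:
  assumes "square_integrable M f"
  shows "f \<in> borel_measurable M" "integrable M (\<lambda>x. (norm (f x))\<^sup>2)"
  using assms by (auto simp: square_integrable_def)

lemma L2_norm_nonneg: "0 \<le> L2_norm M f"
  by (simp add: L2_norm_def)

lemma L2_norm_square: "(L2_norm M f)\<^sup>2 = (\<integral>x. (norm (f x))\<^sup>2 \<partial>M)"
  by (simp add: L2_norm_def)

lemma square_integrable_mult_bounded:
  assumes "square_integrable M f" "b \<in> borel_measurable M" "\<And>x. x \<in> space M \<Longrightarrow> norm (b x) \<le> K"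
  shows "square_integrable M (\<lambda>x. b x * f x)"
proof -
  note [measurable] = square_integrableD(1)[OF assms(1)] assms(2)
  have "integrable M (\<lambda>x. (norm (b x * f x))\<^sup>2)"
  proof (rule Bochner_Integration.integrable_bound)
    show "integrable M (\<lambda>x. K\<^sup>2 * (norm (f x))\<^sup>2)"
      using square_integrableD(2)[OF assms(1)] by simp
    show "AE x in M. norm ((norm (b x * f x))\<^sup>2) \<le> norm (K\<^sup>2 * (norm (f x))\<^sup>2)"
      using assms(3) by (intro AE_I2) (auto simp: norm_mult power_mult_distrib intro!: mult_right_mono power_mono)
  qed measurable
  then show ?thesis by (simp add: square_integrable_def)
qed

lemma square_integrable_cmult: "square_integrable M f \<Longrightarrow> square_integrable M (\<lambda>x. c * f x)"
  by (rule square_integrable_mult_bounded[where K="norm c"]) auto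

lemma norm_add_square_le: "(norm (a + b))\<^sup>2 \<le> 2 * (norm a)\<^sup>2 + 2 * (norm (b :: 'a :: real_normed_vector))\<^sup>2"
proof -
  have "(norm (a + b))\<^sup>2 \<le> (norm a + norm b)\<^sup>2"
    by (intro power_mono norm_triangle_ineq) auto
  also have "\<dots> \<le> 2 * (norm a)\<^sup>2 + 2 * (norm b)\<^sup>2"
    using zero_le_power2[of "norm a - norm b"] by (simp add: power2_eq_square algebra_simps)
  finally show ?thesis .
qed

lemma square_integrable_add:
  assumes "square_integrable M f" "square_integrable M g"
  shows "square_integrable M (\<lambda>x. f x + g x)"
    and L2_norm_add_square_le: "(L2_norm M (\<lambda>x. f x + g x))\<^sup>2 \<le> 2 * (L2_norm M f)\<^sup>2 + 2 * (L2_norm M g)\<^sup>2"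
proof -
  note [measurable] = square_integrableD(1)[OF assms(1)] square_integrableD(1)[OF assms(2)]
  note i = square_integrableD(2)[OF assms(1)] square_integrableD(2)[OF assms(2)]
  have "integrable M (\<lambda>x. (norm (f x + g x))\<^sup>2)"
  proof (rule Bochner_Integration.integrable_bound)
    show "integrable M (\<lambda>x. 2 * (norm (f x))\<^sup>2 + 2 * (norm (g x))\<^sup>2)"
      using i by simp
    show "AE x in M. norm ((norm (f x + g x))\<^sup>2) \<le> norm (2 * (norm (f x))\<^sup>2 + 2 * (norm (g x))\<^sup>2)"
      using norm_add_square_le by (intro AE_I2) (auto intro!: order_trans[OF norm_add_square_le])
  qed measurable
  then show "square_integrable M (\<lambda>x. f x + g x)" by (simp add: square_integrable_def)
  have "(\<integral>x. (norm (f x + g x))\<^sup>2 \<partial>M) \<le> (\<integral>x. 2 * (norm (f x))\<^sup>2 + 2 * (norm (g x))\<^sup>2 \<partial>M)"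
    using \<open>integrable M (\<lambda>x. (norm (f x + g x))\<^sup>2)\<close> i by (intro integral_mono norm_add_square_le) auto
  then show "(L2_norm M (\<lambda>x. f x + g x))\<^sup>2 \<le> 2 * (L2_norm M f)\<^sup>2 + 2 * (L2_norm M g)\<^sup>2"
    using i by (simp add: L2_norm_square)
qed

lemma square_integrable_diff:
  assumes "square_integrable M f" "square_integrable M g"
  shows "square_integrable M (\<lambda>x. f x - g x)"
    and L2_norm_diff_square_le: "(L2_norm M (\<lambda>x. f x - g x))\<^sup>2 \<le> 2 * (L2_norm M f)\<^sup>2 + 2 * (L2_norm M g)\<^sup>2"
  using square_integrable_add[OF assms(1) square_integrable_cmult[OF assms(2), of "-1"]]
    L2_norm_add_square_le[OF assms(1) square_integrable_cmult[OF assms(2), of "-1"]]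
  by (simp_all add: L2_norm_def)

lemma square_integrable_sum:
  assumes "finite I" "\<And>i. i \<in> I \<Longrightarrow> square_integrable M (f i)"
  shows "square_integrable M (\<lambda>x. \<Sum>i\<in>I. f i x)"
  using assms
proof (induction I rule: finite_induct)
  case empty
  show ?case by (simp add: square_integrable_def)
next
  case (insert i I)
  have "square_integrable M (\<lambda>x. f i x + (\<Sum>i\<in>I. f i x))"
    by (rule square_integrable_add(1)) (use insert in auto)
  then show ?case using insert.hyps by simp
qed

lemma square_integrable_mult_integrable:
  assumes "square_integrable M f" "square_integrable M g"
  shows "integrable M (\<lambda>x. f x * g x)"
proof -
  note [measurable] = square_integrableD(1)[OF assms(1)] square_integrableD(1)[OF assms(2)]
  show ?thesis
  proof (rule Bochner_Integration.integrable_bound)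
  show "integrable M (\<lambda>x. (norm (f x))\<^sup>2 + (norm (g x))\<^sup>2)"
    using square_integrableD(2)[OF assms(1)] square_integrableD(2)[OF assms(2)] by simp
  have "norm (a * b) \<le> (norm a)\<^sup>2 + (norm b)\<^sup>2" for a b :: complex
    using sum_squares_bound[of "norm a" "norm b"] mult_nonneg_nonneg[OF norm_ge_zero norm_ge_zero, of a b]
    unfolding norm_mult by linarith
  then show "AE x in M. norm (f x * g x) \<le> norm ((norm (f x))\<^sup>2 + (norm (g x))\<^sup>2)"
    by (intro AE_I2) auto
  qed measurable
qed

text \<open>The Cauchy-Schwarz inequality, from the nonnegative quadratic
  \<open>t \<mapsto> \<integral> (|f| - t |g|)\<^sup>2\<close>.\<close>

lemma L2_norm_Cauchy_Schwarz:
  assumes "square_integrable M f" "square_integrable M g"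
  shows "(\<integral>x. norm (f x * g x) \<partial>M) \<le> L2_norm M f * L2_norm M g"
proof -
  define A B C where "A = (\<integral>x. (norm (f x))\<^sup>2 \<partial>M)" and "B = (\<integral>x. (norm (g x))\<^sup>2 \<partial>M)"
    and "C = (\<integral>x. norm (f x * g x) \<partial>M)"
  note i = square_integrableD(2)[OF assms(1)] square_integrableD(2)[OF assms(2)]
    integrable_norm[OF square_integrable_mult_integrable[OF assms]]
  have nonneg: "0 \<le> A" "0 \<le> B" "0 \<le> C" by (auto simp: A_def B_def C_def)
  have quad: "0 \<le> A - 2 * t * C + t\<^sup>2 * B" for t
  proof -
    have "0 \<le> (\<integral>x. (norm (f x) - t * norm (g x))\<^sup>2 \<partial>M)" by simp
    also have "\<dots> = (\<integral>x. (norm (f x))\<^sup>2 - 2 * t * norm (f x * g x) + t\<^sup>2 * (norm (g x))\<^sup>2 \<partial>M)"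
      by (simp add: power2_eq_square norm_mult algebra_simps)
    also have "\<dots> = A - 2 * t * C + t\<^sup>2 * B"
      using i by (simp add: A_def B_def C_def)
    finally show ?thesis .
  qed
  have "C\<^sup>2 \<le> A * B"
  proof (cases "B = 0")
    case True
    have "C = 0"
    proof (rule ccontr)
      assume "C \<noteq> 0"
      then show False using quad[of "(A + 1) / (2 * C)"] True nonneg by simp
    qed
    then show ?thesis using True by simp
  next
    case False
    then have eq: "A - 2 * (C / B) * C + (C / B)\<^sup>2 * B = A - C\<^sup>2 / B"
      by (simp add: power2_eq_square)
    have "C\<^sup>2 / B \<le> A" using quad[of "C / B"] unfolding eq by simp
    then show ?thesis using False nonneg by (simp add: pos_divide_le_eq)
  qed
  then have "C \<le> sqrt (A * B)" by (rule real_le_rsqrt)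
  then show ?thesis by (simp add: C_def A_def B_def L2_norm_def real_sqrt_mult)
qed

lemma L2_norm_integral_mult_le:
  assumes "square_integrable M f" "square_integrable M g"
  shows "norm (\<integral>x. f x * g x \<partial>M) \<le> L2_norm M f * L2_norm M g"
  by (rule order_trans[OF integral_norm_bound L2_norm_Cauchy_Schwarz[OF assms]])

lemma L2_norm_cong_AE:
  assumes "square_integrable M f" "square_integrable M g" "AE x in M. f x = g x"
  shows "L2_norm M f = L2_norm M g"
proof -
  note [measurable] = square_integrableD(1)[OF assms(1)] square_integrableD(1)[OF assms(2)]
  have "(\<integral>x. (norm (f x))\<^sup>2 \<partial>M) = (\<integral>x. (norm (g x))\<^sup>2 \<partial>M)"
    by (rule integral_cong_AE) (use assms(3) in auto)
  then show ?thesis by (simp add: L2_norm_def)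
qed

lemma square_integrable_test:
  assumes "test_function \<Omega> \<eta>" "\<Omega> \<in> sets lebesgue"
  shows "square_integrable (lebesgue_on \<Omega>) \<eta>"
proof -
  have "integrable (lebesgue_on \<Omega>) (\<lambda>x. norm (\<eta> x * cnj (\<eta> x)))"
    using assms
    by (intro integrable_norm integrable_lebesgue_on_test test_function_mult test_function_cnj)
      (auto simp: test_function_smooth)
  moreover have "\<eta> \<in> borel_measurable (lebesgue_on \<Omega>)"
    using integrable_lebesgue_on_test[OF assms] by auto
  ultimately show ?thesis by (simp add: square_integrable_def norm_mult power2_eq_square)
qed

lemma square_integrable_integrable:
  assumes "finite_measure M" "square_integrable M f"
  shows "integrable M f"
proof -
  have "square_integrable M (\<lambda>x. 1)"
    using assms(1) by (simp add: square_integrable_def finite_measure.integrable_const)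
  from square_integrable_mult_integrable[OF assms(2) this] show ?thesis by simp
qed

section \<open>Approximation in the space of Sobolev functions with vanishing boundary values\<close>

lemma has_weak_deriv_diff:
  assumes "square_integrable (lebesgue_on \<Omega>) u" "square_integrable (lebesgue_on \<Omega>) f"
    and "square_integrable (lebesgue_on \<Omega>) g" "square_integrable (lebesgue_on \<Omega>) h"
    and "has_weak_deriv \<Omega> \<alpha> u g" "has_weak_deriv \<Omega> \<alpha> f h" "\<Omega> \<in> sets lebesgue" "\<alpha> \<in> multi_indices"
  shows "has_weak_deriv \<Omega> \<alpha> (\<lambda>x. u x - f x) (\<lambda>x. g x - h x)"
  unfolding has_weak_deriv_def
proof (intro allI impI)
  fix \<eta> assume \<eta>: "test_function \<Omega> \<eta>"
  let ?N = "lebesgue_on \<Omega>"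
  note t = square_integrable_test[OF \<eta> assms(7)]
    square_integrable_test[OF test_function_iter_deriv[OF \<eta> assms(8)] assms(7)]
  have "(\<integral>x. (u x - f x) * iter_deriv \<alpha> \<eta> x \<partial>?N) =
      (\<integral>x. u x * iter_deriv \<alpha> \<eta> x \<partial>?N) - (\<integral>x. f x * iter_deriv \<alpha> \<eta> x \<partial>?N)"
    using square_integrable_mult_integrable[OF assms(1) t(2)] square_integrable_mult_integrable[OF assms(2) t(2)]
    by (simp add: left_diff_distrib)
  also have "\<dots> = (- 1) ^ length \<alpha> * ((\<integral>x. g x * \<eta> x \<partial>?N) - (\<integral>x. h x * \<eta> x \<partial>?N))"
    using assms(5,6) \<eta> by (simp add: has_weak_deriv_def algebra_simps)
  also have "(\<integral>x. g x * \<eta> x \<partial>?N) - (\<integral>x. h x * \<eta> x \<partial>?N) = (\<integral>x. (g x - h x) * \<eta> x \<partial>?N)"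
    using square_integrable_mult_integrable[OF assms(3) t(1)] square_integrable_mult_integrable[OF assms(4) t(1)]
    by (simp add: left_diff_distrib)
  finally show "(\<integral>x. (u x - f x) * iter_deriv \<alpha> \<eta> x \<partial>?N) = (- 1) ^ length \<alpha> * (\<integral>x. (g x - h x) * \<eta> x \<partial>?N)" .
qed

lemma has_weak_deriv_unique:
  assumes "open \<Omega>" "bounded \<Omega>" "square_integrable (lebesgue_on \<Omega>) g" "square_integrable (lebesgue_on \<Omega>) h"
    and "has_weak_deriv \<Omega> \<alpha> u g" "has_weak_deriv \<Omega> \<alpha> u h"
  shows "AE x in lebesgue_on \<Omega>. g x = h x"
proof -
  have \<Omega>: "\<Omega> \<in> sets lebesgue" using assms(1) by simp
  have fin: "finite_measure (lebesgue_on \<Omega>)"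
    using assms(1,2) by (intro finite_measure_lebesgue_on lmeasurable_open)
  have "AE x in lebesgue_on \<Omega>. g x - h x = 0"
  proof (rule fundamental_lemma_variations[OF assms(1)])
    show "integrable (lebesgue_on \<Omega>) (\<lambda>x. g x - h x)"
      using assms(3,4) by (intro square_integrable_integrable[OF fin] square_integrable_diff)
    fix \<eta> assume \<eta>: "test_function \<Omega> \<eta>"
    have "(- 1) ^ length \<alpha> * (\<integral>x. g x * \<eta> x \<partial>lebesgue_on \<Omega>) = (- 1) ^ length \<alpha> * (\<integral>x. h x * \<eta> x \<partial>lebesgue_on \<Omega>)"
      using assms(5,6) \<eta> by (simp add: has_weak_deriv_def)
    then show "(\<integral>x. (g x - h x) * \<eta> x \<partial>lebesgue_on \<Omega>) = 0"
      using square_integrable_mult_integrable[OF assms(3) square_integrable_test[OF \<eta> \<Omega>]]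
        square_integrable_mult_integrable[OF assms(4) square_integrable_test[OF \<eta> \<Omega>]]
      by (simp add: left_diff_distrib)
  qed
  then show ?thesis by eventually_elim simp
qed

lemma finite_multi_indices: "finite {\<alpha>::'a::euclidean_space list. \<alpha> \<in> multi_indices \<and> length \<alpha> \<le> m}"
  using finite_lists_length_le[OF finite_Basis, of m] by (simp add: multi_indices_def)

text \<open>The norm is defined through chosen weak derivatives; by uniqueness every other choice has the same
  norm.\<close>

lemma sobolev_norm_ge:
  assumes "open \<Omega>" "bounded \<Omega>" "\<alpha> \<in> multi_indices" "length \<alpha> \<le> m"
    and "square_integrable (lebesgue_on \<Omega>) g" "has_weak_deriv \<Omega> \<alpha> u g"
  shows "L2_norm (lebesgue_on \<Omega>) g \<le> sobolev_norm m \<Omega> u"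
proof -
  let ?d = "weak_deriv \<Omega> \<alpha> u" and ?N = "lebesgue_on \<Omega>"
  have d: "square_integrable ?N ?d \<and> has_weak_deriv \<Omega> \<alpha> u ?d"
    unfolding weak_deriv_def by (rule someI[of _ g]) (use assms in auto)
  then have "L2_norm ?N g = L2_norm ?N ?d"
    using assms by (intro L2_norm_cong_AE has_weak_deriv_unique[of \<Omega> g ?d \<alpha> u]) auto
  also have "\<dots> \<le> sobolev_norm m \<Omega> u"
    unfolding sobolev_norm_def
    by (intro real_le_rsqrt member_le_sum[of \<alpha> _ "\<lambda>\<alpha>. (L2_norm ?N (weak_deriv \<Omega> \<alpha> u))\<^sup>2"])
      (use assms finite_multi_indices in auto)
  finally show ?thesis .
qed

text \<open>Membership in \<open>H\<^sup>2\<^sub>0\<close> in the form used below: the classical second derivatives of the approximating test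
  functions converge to fixed weak derivatives of the limit.\<close>

lemma sobolev_H0_approximation:
  fixes \<Omega> :: "'a::euclidean_space set"
  assumes "open \<Omega>" "bounded \<Omega>" "u \<in> sobolev_H0 2 \<Omega>"
  obtains \<psi> g where "square_integrable (lebesgue_on \<Omega>) u"
    "\<And>i. i \<in> Basis \<Longrightarrow> square_integrable (lebesgue_on \<Omega>) (g i)"
    "\<And>i. i \<in> Basis \<Longrightarrow> has_weak_deriv \<Omega> [i, i] u (g i)"
    "\<And>j::nat. test_function \<Omega> (\<psi> j)"
    "(\<lambda>j. L2_norm (lebesgue_on \<Omega>) (\<lambda>x. u x - \<psi> j x)) \<longlonglongrightarrow> 0"
    "\<And>i. i \<in> Basis \<Longrightarrow> (\<lambda>j. L2_norm (lebesgue_on \<Omega>) (\<lambda>x. g i x - iter_deriv [i, i] (\<psi> j) x)) \<longlonglongrightarrow> 0"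
proof -
  let ?N = "lebesgue_on \<Omega>"
  have \<Omega>: "\<Omega> \<in> sets lebesgue" using assms(1) by simp
  obtain \<psi> where \<psi>: "\<And>j::nat. test_function \<Omega> (\<psi> j)"
    "(\<lambda>j. sobolev_norm 2 \<Omega> (\<lambda>x. u x - \<psi> j x)) \<longlonglongrightarrow> 0"
    using assms(3) by (auto simp: sobolev_H0_def)
  have u: "square_integrable ?N u"
    and "\<forall>\<alpha>\<in>multi_indices. length \<alpha> \<le> 2 \<longrightarrow> (\<exists>g. square_integrable ?N g \<and> has_weak_deriv \<Omega> \<alpha> u g)"
    using assms(3) by (auto simp: sobolev_H0_def sobolev_H_def)
  then have "\<forall>\<alpha>. \<exists>g. \<alpha> \<in> multi_indices \<longrightarrow> length \<alpha> \<le> 2 \<longrightarrow> square_integrable ?N g \<and> has_weak_deriv \<Omega> \<alpha> u g"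
    by blast
  then obtain G where G: "\<And>\<alpha>. \<alpha> \<in> multi_indices \<Longrightarrow> length \<alpha> \<le> 2 \<Longrightarrow>
      square_integrable ?N (G \<alpha>) \<and> has_weak_deriv \<Omega> \<alpha> u (G \<alpha>)"
    by metis
  have conv: "(\<lambda>j. L2_norm ?N (\<lambda>x. g x - iter_deriv (rev \<alpha>) (\<psi> j) x)) \<longlonglongrightarrow> 0"
    if \<alpha>: "\<alpha> \<in> multi_indices" "length \<alpha> \<le> 2" and g: "square_integrable ?N g" "has_weak_deriv \<Omega> \<alpha> u g" for \<alpha> g
  proof (rule tendsto_sandwich[OF _ _ tendsto_const \<psi>(2)])
    have rev: "rev \<alpha> \<in> multi_indices" using \<alpha> by (simp add: multi_indices_def)
    have "L2_norm ?N (\<lambda>x. g x - iter_deriv (rev \<alpha>) (\<psi> j) x) \<le> sobolev_norm 2 \<Omega> (\<lambda>x. u x - \<psi> j x)" for j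
    proof -
      note D = square_integrable_test[OF test_function_iter_deriv[OF \<psi>(1) rev] \<Omega>]
      show ?thesis
        by (rule sobolev_norm_ge[OF assms(1,2) \<alpha> square_integrable_diff(1)[OF g(1) D]
              has_weak_deriv_diff[OF u square_integrable_test[OF \<psi>(1) \<Omega>] g(1) D g(2)
                has_weak_deriv_smooth[OF test_function_smooth[OF \<psi>(1)] \<alpha>(1) \<Omega>] \<Omega> \<alpha>(1)]])
    qed
    then show "\<forall>\<^sub>F j in sequentially. L2_norm ?N (\<lambda>x. g x - iter_deriv (rev \<alpha>) (\<psi> j) x) \<le> sobolev_norm 2 \<Omega> (\<lambda>x. u x - \<psi> j x)"
      by simp
  qed (simp add: L2_norm_nonneg)
  have ii: "[i, i] \<in> multi_indices" if "i \<in> Basis" for i :: 'a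
    using that by (simp add: multi_indices_def)
  show ?thesis
  proof (rule that[of "\<lambda>i. G [i, i]" \<psi>])
    show "(\<lambda>j. L2_norm ?N (\<lambda>x. u x - \<psi> j x)) \<longlonglongrightarrow> 0"
      using conv[of "[]" u] u by (simp add: multi_indices_def iter_deriv_def has_weak_deriv_def)
    show "(\<lambda>j. L2_norm ?N (\<lambda>x. G [i, i] x - iter_deriv [i, i] (\<psi> j) x)) \<longlonglongrightarrow> 0" if "i \<in> Basis" for i
      using conv[OF ii[OF that], of "G [i, i]"] G[OF ii[OF that]] by simp
  qed (use G[OF ii] u \<psi>(1) in simp_all)
qed

section \<open>Testing against exponentials\<close>

lemma cexp_shift: "cexp p q (x - z) = cexp p q (- z) * cexp p q x"
  by (simp add: cexp_add[symmetric])

lemma smooth_cexp_shift: "smooth (\<lambda>x. cexp p q (x - z))"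
  unfolding cexp_shift[of p q _ z] by (intro smooth_mult smooth_const smooth_cexp)

lemma partial_deriv_cexp_shift:
  "partial_deriv i (\<lambda>x. cexp p q (x - z)) = (\<lambda>x. Complex (p \<bullet> i) (q \<bullet> i) * cexp p q (x - z))"
  unfolding cexp_shift[of p q _ z]
  by (simp add: partial_deriv_cmult[OF smooth_cexp] partial_deriv_cexp mult.left_commute)

lemma square_integrable_bounded:
  assumes "finite_measure M" "b \<in> borel_measurable M" "\<And>x. x \<in> space M \<Longrightarrow> norm (b x) \<le> K"
  shows "square_integrable M b"
proof -
  have "square_integrable M (\<lambda>x. 1)"
    using assms(1) by (simp add: square_integrable_def finite_measure.integrable_const)
  from square_integrable_mult_bounded[OF this assms(2,3)] show ?thesis by simp
qed

lemma borel_measurable_lebesgue_on_borel: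
  "f \<in> borel_measurable borel \<Longrightarrow> f \<in> borel_measurable (lebesgue_on \<Omega>)"
  by (simp add: measurable_completion measurable_restrict_space1)

lemma borel_measurable_cexp [measurable]: "cexp p q \<in> borel_measurable borel"
  by (rule borel_measurable_continuous_onI[OF smooth_continuous_on[OF smooth_cexp]])

lemma borel_measurable_cexp_shift: "(\<lambda>x. cexp p q (x - z)) \<in> borel_measurable (lebesgue_on \<Omega>)"
  by (rule borel_measurable_lebesgue_on_borel) measurable

lemma square_integrable_cexp:
  assumes "open \<Omega>" "bounded \<Omega>"
  shows "square_integrable (lebesgue_on \<Omega>) (\<lambda>x. cexp p q (x - z))"
proof -
  obtain r where r: "\<And>x. x \<in> \<Omega> \<Longrightarrow> norm x \<le> r" using assms(2) by (auto simp: bounded_iff)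
  show ?thesis
  proof (rule square_integrable_bounded[where K="exp (norm p * (r + norm z))"])
    show "finite_measure (lebesgue_on \<Omega>)"
      using assms by (intro finite_measure_lebesgue_on lmeasurable_open)
    show "norm (cexp p q (x - z)) \<le> exp (norm p * (r + norm z))" if "x \<in> space (lebesgue_on \<Omega>)" for x
    proof -
      have "p \<bullet> (x - z) \<le> norm p * norm (x - z)" by (rule norm_cauchy_schwarz)
      also have "norm (x - z) \<le> r + norm z"
        using norm_triangle_ineq4[of x z] r[of x] that by simp
      finally show ?thesis by (simp add: norm_cexp mult_left_mono)
    qed
  qed (rule borel_measurable_cexp_shift)
qed

text \<open>With \<open>f = e\<^bsup>p\<cdot>(x - z)\<^esup> \<psi>\<close> and \<open>g = e\<^bsup>p\<cdot>(x - z)\<^esup> \<partial>\<^sub>e\<psi>\<close> one has \<open>g = \<partial>\<^sub>e f - (p\<cdot>e) f\<close>, and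
  the real part of the inner product of \<open>\<partial>\<^sub>e f\<close> and \<open>f\<close> is zero.\<close>

lemma weighted_partial_deriv_ge:
  assumes \<psi>: "test_function \<Omega> \<psi>" and \<Omega>: "\<Omega> \<in> sets lebesgue" and e: "e \<in> Basis"
  shows "\<bar>p \<bullet> e\<bar> * L2_norm (lebesgue_on \<Omega>) (\<lambda>x. cexp p 0 (x - z) * \<psi> x)
     \<le> L2_norm (lebesgue_on \<Omega>) (\<lambda>x. cexp p 0 (x - z) * partial_deriv e \<psi> x)"
proof -
  let ?N = "lebesgue_on \<Omega>"
  define f where "f x = cexp p 0 (x - z) * \<psi> x" for x
  define g where "g x = cexp p 0 (x - z) * partial_deriv e \<psi> x" for x
  have ft: "test_function \<Omega> f" unfolding f_def[abs_def]
    by (rule test_function_mult[OF smooth_cexp_shift \<psi>])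
  have gt: "test_function \<Omega> g" unfolding g_def[abs_def]
    by (rule test_function_mult[OF smooth_cexp_shift test_function_partial_deriv[OF \<psi> e]])
  have df: "partial_deriv e f x = g x + of_real (p \<bullet> e) * f x" for x
    unfolding f_def[abs_def] g_def
    by (simp add: partial_deriv_mult[OF smooth_cexp_shift test_function_smooth[OF \<psi>]]
        partial_deriv_cexp_shift complex_of_real_def)
  note fi = square_integrable_test[OF ft \<Omega>] and gi = square_integrable_test[OF gt \<Omega>]
  note fci = square_integrable_test[OF test_function_cnj[OF ft] \<Omega>]
    and gci = square_integrable_test[OF test_function_cnj[OF gt] \<Omega>]
  have "(\<integral>x. partial_deriv e (\<lambda>x. f x * cnj (f x)) x \<partial>?N) = 0"
  proof -
    have t: "test_function \<Omega> (\<lambda>x. f x * cnj (f x))"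
      by (rule test_function_mult[OF test_function_smooth[OF ft] test_function_cnj[OF ft]])
    show ?thesis
      using integral_lebesgue_on_test[OF test_function_partial_deriv[OF t e] \<Omega>]
        integral_partial_deriv_test[OF t e] by simp
  qed
  moreover have "partial_deriv e (\<lambda>x. f x * cnj (f x)) x =
      g x * cnj (f x) + f x * cnj (g x) + 2 * of_real (p \<bullet> e) * (f x * cnj (f x))" for x
    by (simp add: partial_deriv_mult[OF test_function_smooth[OF ft] smooth_cnj[OF test_function_smooth[OF ft]]]
        partial_deriv_cnj[OF test_function_smooth[OF ft]] df algebra_simps)
  ultimately have "(\<integral>x. g x * cnj (f x) \<partial>?N) + (\<integral>x. f x * cnj (g x) \<partial>?N)
      + 2 * of_real (p \<bullet> e) * (\<integral>x. f x * cnj (f x) \<partial>?N) = 0"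
    using square_integrable_mult_integrable[OF gi fci] square_integrable_mult_integrable[OF fi gci]
      square_integrable_mult_integrable[OF fi fci] by simp
  then have "2 * of_real (p \<bullet> e) * (\<integral>x. f x * cnj (f x) \<partial>?N) =
      - ((\<integral>x. g x * cnj (f x) \<partial>?N) + (\<integral>x. f x * cnj (g x) \<partial>?N))"
    by (rule iffD1[OF add_eq_0_iff])
  moreover have "(\<integral>x. f x * cnj (f x) \<partial>?N) = of_real ((L2_norm ?N f)\<^sup>2)"
    unfolding L2_norm_square complex_norm_square[symmetric] by (rule integral_complex_of_real)
  ultimately have "2 * of_real (p \<bullet> e) * of_real ((L2_norm ?N f)\<^sup>2) =
      - ((\<integral>x. g x * cnj (f x) \<partial>?N) + (\<integral>x. f x * cnj (g x) \<partial>?N))"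
    by (simp only:)
  then have "norm (2 * of_real (p \<bullet> e) * of_real ((L2_norm ?N f)\<^sup>2) :: complex) \<le>
      norm (\<integral>x. g x * cnj (f x) \<partial>?N) + norm (\<integral>x. f x * cnj (g x) \<partial>?N)"
    by (simp only: norm_minus_cancel norm_triangle_ineq)
  also have "\<dots> \<le> 2 * (L2_norm ?N f * L2_norm ?N g)"
    using L2_norm_integral_mult_le[OF gi fci] L2_norm_integral_mult_le[OF fi gci]
    by (simp add: L2_norm_def mult.commute)
  finally have main: "\<bar>p \<bullet> e\<bar> * (L2_norm ?N f)\<^sup>2 \<le> L2_norm ?N f * L2_norm ?N g"
    by (simp add: norm_mult norm_power L2_norm_nonneg)
  have "\<bar>p \<bullet> e\<bar> * L2_norm ?N f \<le> L2_norm ?N g"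
  proof (cases "L2_norm ?N f = 0")
    case False
    then have "0 < L2_norm ?N f" using L2_norm_nonneg[of ?N f] by simp
    moreover from main have "L2_norm ?N f * (\<bar>p \<bullet> e\<bar> * L2_norm ?N f) \<le> L2_norm ?N f * L2_norm ?N g"
      by (simp add: power2_eq_square mult_ac)
    ultimately show ?thesis by simp
  qed (simp add: L2_norm_nonneg)
  then show ?thesis by (simp add: f_def[abs_def] g_def[abs_def])
qed

lemma L2_norm_mult_bounded_le:
  assumes "square_integrable M f" "b \<in> borel_measurable M" "\<And>x. x \<in> space M \<Longrightarrow> norm (b x) \<le> K" "0 \<le> K"
  shows "L2_norm M (\<lambda>x. b x * f x) \<le> K * L2_norm M f"
proof -
  have "(\<integral>x. (norm (b x * f x))\<^sup>2 \<partial>M) \<le> (\<integral>x. K\<^sup>2 * (norm (f x))\<^sup>2 \<partial>M)"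
  proof (intro integral_mono)
    show "(norm (b x * f x))\<^sup>2 \<le> K\<^sup>2 * (norm (f x))\<^sup>2" if "x \<in> space M" for x
      using assms(3)[OF that] unfolding norm_mult power_mult_distrib by (intro mult_right_mono power_mono) auto
  qed (use square_integrableD(2)[OF square_integrable_mult_bounded[OF assms(1-3)]] square_integrableD(2)[OF assms(1)] in auto)
  then have "sqrt (\<integral>x. (norm (b x * f x))\<^sup>2 \<partial>M) \<le> sqrt (K\<^sup>2 * (\<integral>x. (norm (f x))\<^sup>2 \<partial>M))"
    by (intro real_sqrt_le_mono) simp
  then show ?thesis using assms(4) by (simp add: L2_norm_def real_sqrt_mult)
qed

lemmas L2_norm_mult_le = L2_norm_mult_bounded_le[where K=1, simplified]

text \<open>Two applications of the preceding estimate to the approximating test functions. The bound does not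
  depend on \<open>p\<close>; so \<open>u\<close> behaves in weighted norms as if it vanished to second order at the boundary.\<close>

lemma sobolev_H0_exponential_decay:
  fixes \<Omega> :: "'a::euclidean_space set"
  assumes "open \<Omega>" "bounded \<Omega>" "u \<in> sobolev_H0 2 \<Omega>" and e: "e \<in> Basis"
  obtains K where "0 \<le> K" "\<And>p. (\<And>x. x \<in> \<Omega> \<Longrightarrow> p \<bullet> (x - z) \<le> 0) \<Longrightarrow>
     (p \<bullet> e)\<^sup>2 * L2_norm (lebesgue_on \<Omega>) (\<lambda>x. cexp p 0 (x - z) * u x) \<le> K"
proof -
  let ?N = "lebesgue_on \<Omega>"
  have \<Omega>: "\<Omega> \<in> sets lebesgue" using assms(1) by simp
  obtain \<psi> g where u: "square_integrable ?N u"
    and g: "\<And>i. i \<in> Basis \<Longrightarrow> square_integrable ?N (g i)"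
    and wd: "\<And>i. i \<in> Basis \<Longrightarrow> has_weak_deriv \<Omega> [i, i] u (g i)"
    and \<psi>: "\<And>j::nat. test_function \<Omega> (\<psi> j)"
    and lim: "(\<lambda>j. L2_norm ?N (\<lambda>x. u x - \<psi> j x)) \<longlonglongrightarrow> 0"
    and glim: "\<And>i. i \<in> Basis \<Longrightarrow> (\<lambda>j. L2_norm ?N (\<lambda>x. g i x - iter_deriv [i, i] (\<psi> j) x)) \<longlonglongrightarrow> 0"
    by (rule sobolev_H0_approximation[OF assms(1-3)]) (rule that, assumption+)
  show ?thesis
  proof (rule that[of "2 * L2_norm ?N (g e)"])
    fix p :: 'a assume neg: "\<And>x. x \<in> \<Omega> \<Longrightarrow> p \<bullet> (x - z) \<le> 0"
    let ?W = "\<lambda>x. cexp p 0 (x - z)"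
    have W: "norm (?W x) \<le> 1" if "x \<in> space ?N" for x
      using neg[of x] that by (simp add: norm_cexp)
    note Wm = borel_measurable_cexp_shift[of p 0 z \<Omega>]
    let ?A = "L2_norm ?N (\<lambda>x. ?W x * u x)"
    let ?a = "\<lambda>j. L2_norm ?N (\<lambda>x. u x - \<psi> j x)"
    let ?b = "\<lambda>j. L2_norm ?N (\<lambda>x. g e x - iter_deriv [e, e] (\<psi> j) x)"
    have bound: "(p \<bullet> e)^4 * ?A\<^sup>2 \<le> 2 * (p \<bullet> e)^4 * (?a j)\<^sup>2 + 2 * (2 * (L2_norm ?N (g e))\<^sup>2 + 2 * (?b j)\<^sup>2)" for j
    proof -
      note \<psi>i = square_integrable_test[OF \<psi>[of j] \<Omega>]
      have ee: "[e, e] \<in> multi_indices" using e by (simp add: multi_indices_def)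
      note \<psi>ei = square_integrable_test[OF test_function_iter_deriv[OF \<psi>[of j] ee] \<Omega>]
      note di = square_integrable_diff(1)[OF u \<psi>i]
      have "?A\<^sup>2 \<le> 2 * (L2_norm ?N (\<lambda>x. ?W x * (u x - \<psi> j x)))\<^sup>2 + 2 * (L2_norm ?N (\<lambda>x. ?W x * \<psi> j x))\<^sup>2"
        using L2_norm_add_square_le[OF square_integrable_mult_bounded[OF di Wm W] square_integrable_mult_bounded[OF \<psi>i Wm W]]
        by (simp add: algebra_simps)
      also have "\<dots> \<le> 2 * (?a j)\<^sup>2 + 2 * (L2_norm ?N (\<lambda>x. ?W x * \<psi> j x))\<^sup>2"
        using L2_norm_mult_le[OF di Wm W] by (simp add: power_mono L2_norm_nonneg)
      finally have "(p \<bullet> e)^4 * ?A\<^sup>2 \<le> (p \<bullet> e)^4 * (2 * (?a j)\<^sup>2 + 2 * (L2_norm ?N (\<lambda>x. ?W x * \<psi> j x))\<^sup>2)"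
        by (intro mult_left_mono) auto
      moreover have "(p \<bullet> e)^4 * (L2_norm ?N (\<lambda>x. ?W x * \<psi> j x))\<^sup>2 \<le> 2 * (L2_norm ?N (g e))\<^sup>2 + 2 * (?b j)\<^sup>2"
      proof -
        have "\<bar>p \<bullet> e\<bar> * (\<bar>p \<bullet> e\<bar> * L2_norm ?N (\<lambda>x. ?W x * \<psi> j x)) \<le> \<bar>p \<bullet> e\<bar> * L2_norm ?N (\<lambda>x. ?W x * partial_deriv e (\<psi> j) x)"
          by (intro mult_left_mono weighted_partial_deriv_ge \<psi> \<Omega> e) auto
        also have "\<dots> \<le> L2_norm ?N (\<lambda>x. ?W x * iter_deriv [e, e] (\<psi> j) x)"
          using weighted_partial_deriv_ge[OF test_function_partial_deriv[OF \<psi>[of j] e] \<Omega> e]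
          by (simp add: iter_deriv_def)
        also have "\<dots> \<le> L2_norm ?N (iter_deriv [e, e] (\<psi> j))"
          by (rule L2_norm_mult_le[OF \<psi>ei Wm W])
        finally have "(\<bar>p \<bullet> e\<bar> * (\<bar>p \<bullet> e\<bar> * L2_norm ?N (\<lambda>x. ?W x * \<psi> j x)))\<^sup>2 \<le> (L2_norm ?N (iter_deriv [e, e] (\<psi> j)))\<^sup>2"
          by (intro power_mono) (auto simp: L2_norm_nonneg)
        also have "\<dots> \<le> 2 * (L2_norm ?N (g e))\<^sup>2 + 2 * (?b j)\<^sup>2"
          using L2_norm_diff_square_le[OF g[OF e] square_integrable_diff(1)[OF g[OF e] \<psi>ei]] by simp
        finally show ?thesis by (simp add: power_mult_distrib mult.assoc[symmetric] power_add[symmetric])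
      qed
      ultimately show ?thesis by (simp add: algebra_simps)
    qed
    have "(\<lambda>j. 2 * (p \<bullet> e)^4 * (?a j)\<^sup>2 + 2 * (2 * (L2_norm ?N (g e))\<^sup>2 + 2 * (?b j)\<^sup>2)) \<longlonglongrightarrow>
       2 * (p \<bullet> e)^4 * 0\<^sup>2 + 2 * (2 * (L2_norm ?N (g e))\<^sup>2 + 2 * 0\<^sup>2)"
      by (intro tendsto_intros lim glim e)
    then have "(p \<bullet> e)^4 * ?A\<^sup>2 \<le> 2 * (p \<bullet> e)^4 * 0\<^sup>2 + 2 * (2 * (L2_norm ?N (g e))\<^sup>2 + 2 * 0\<^sup>2)"
      by (rule LIMSEQ_le_const) (use bound in auto)
    then have "((p \<bullet> e)\<^sup>2 * ?A)\<^sup>2 \<le> (2 * L2_norm ?N (g e))\<^sup>2"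
      by (simp add: power_mult_distrib)
    then show "(p \<bullet> e)\<^sup>2 * ?A \<le> 2 * L2_norm ?N (g e)"
      by (rule power2_le_imp_le) (simp add: L2_norm_nonneg)
  qed (simp add: L2_norm_nonneg)
qed

lemma integral_iter_deriv_cexp_test:
  assumes "test_function \<Omega> \<psi>" "\<Omega> \<in> sets lebesgue" "i \<in> Basis"
  shows "(\<integral>x. iter_deriv [i, i] \<psi> x * cexp p q (x - z) \<partial>lebesgue_on \<Omega>) =
    (Complex (p \<bullet> i) (q \<bullet> i))\<^sup>2 * (\<integral>x. \<psi> x * cexp p q (x - z) \<partial>lebesgue_on \<Omega>)"
proof -
  let ?E = "\<lambda>x. cexp p q (x - z)" and ?c = "Complex (p \<bullet> i) (q \<bullet> i)"
  have step: "(\<integral>x. ?E x * partial_deriv i \<eta> x \<partial>lborel) = - ?c * (\<integral>x. ?E x * \<eta> x \<partial>lborel)"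
    if "test_function \<Omega> \<eta>" for \<eta>
    using integral_by_parts_test[OF smooth_cexp_shift that assms(3), of p q z]
    by (simp add: partial_deriv_cexp_shift mult.assoc)
  have leb: "(\<integral>x. \<eta> x * ?E x \<partial>lebesgue_on \<Omega>) = (\<integral>x. ?E x * \<eta> x \<partial>lborel)" if "test_function \<Omega> \<eta>" for \<eta>
    using integral_lebesgue_on_test[OF test_function_mult[OF smooth_cexp_shift that] assms(2), of p q z]
    by (simp add: mult.commute)
  have ii: "[i, i] \<in> multi_indices" using assms(3) by (simp add: multi_indices_def)
  show ?thesis
    unfolding leb[OF assms(1)] leb[OF test_function_iter_deriv[OF assms(1) ii]]
    using step[OF test_function_partial_deriv[OF assms(1,3)]] step[OF assms(1)]
    by (simp add: iter_deriv_def power2_eq_square)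
qed

lemma sum_Complex_square_eq_0:
  assumes "p \<bullet> p = q \<bullet> q" "p \<bullet> q = 0"
  shows "(\<Sum>i\<in>Basis. (Complex (p \<bullet> i) (q \<bullet> i))\<^sup>2) = 0"
proof -
  have "(\<Sum>i\<in>Basis. (Complex (p \<bullet> i) (q \<bullet> i))\<^sup>2) =
      (\<Sum>i\<in>Basis. Complex ((p \<bullet> i) * (p \<bullet> i) - (q \<bullet> i) * (q \<bullet> i)) (2 * ((p \<bullet> i) * (q \<bullet> i))))"
    by (intro sum.cong) (auto simp: complex_eq_iff power2_eq_square)
  also have "\<dots> = Complex (p \<bullet> p - q \<bullet> q) (2 * (p \<bullet> q))"
    unfolding euclidean_inner[of p p] euclidean_inner[of q q] euclidean_inner[of p q]
    by (auto simp: complex_eq_iff sum_subtractf sum_distrib_left Re_sum Im_sum)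
  finally show ?thesis using assms by (simp add: complex_eq_iff)
qed

text \<open>The equation is known only against functions that vanish near the boundary, unlike an exponential. The
  fundamental lemma turns it into \<open>F = - \<Delta>u\<close> almost everywhere; and \<open>\<Delta>u\<close> is an \<open>L\<^sup>2\<close> limit of Laplacians of
  test functions, from which integration by parts moves the Laplacian onto the harmonic exponential.\<close>

lemma sobolev_H0_harmonic_orthogonality:
  fixes \<Omega> :: "'a::euclidean_space set"
  assumes "open \<Omega>" "bounded \<Omega>" "u \<in> sobolev_H0 2 \<Omega>"
    and F: "square_integrable (lebesgue_on \<Omega>) F"
    and eq: "\<And>\<eta>. test_function \<Omega> \<eta> \<Longrightarrow>
      (\<integral>x. u x * laplacian \<eta> x \<partial>lebesgue_on \<Omega>) + (\<integral>x. F x * \<eta> x \<partial>lebesgue_on \<Omega>) = 0"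
    and pq: "p \<bullet> p = q \<bullet> q" "p \<bullet> q = 0"
  shows "(\<integral>x. F x * cexp p q (x - z) \<partial>lebesgue_on \<Omega>) = 0"
proof -
  let ?N = "lebesgue_on \<Omega>"
  let ?E = "\<lambda>x. cexp p q (x - z)"
  have \<Omega>: "\<Omega> \<in> sets lebesgue" using assms(1) by simp
  have fin: "finite_measure ?N" using assms(1,2) by (intro finite_measure_lebesgue_on lmeasurable_open)
  obtain \<psi> g where u: "square_integrable ?N u"
    and g: "\<And>i. i \<in> Basis \<Longrightarrow> square_integrable ?N (g i)"
    and wd: "\<And>i. i \<in> Basis \<Longrightarrow> has_weak_deriv \<Omega> [i, i] u (g i)"
    and \<psi>: "\<And>j::nat. test_function \<Omega> (\<psi> j)"
    and lim: "(\<lambda>j. L2_norm ?N (\<lambda>x. u x - \<psi> j x)) \<longlonglongrightarrow> 0"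
    and glim: "\<And>i. i \<in> Basis \<Longrightarrow> (\<lambda>j. L2_norm ?N (\<lambda>x. g i x - iter_deriv [i, i] (\<psi> j) x)) \<longlonglongrightarrow> 0"
    by (rule sobolev_H0_approximation[OF assms(1-3)]) (rule that, assumption+)
  have ii: "[i, i] \<in> multi_indices" if "i \<in> Basis" for i :: 'a
    using that by (simp add: multi_indices_def)
  note E = square_integrable_cexp[OF assms(1,2), of p q z]
  define G where "G x = (\<Sum>i\<in>Basis. g i x)" for x
  have G: "square_integrable ?N G" unfolding G_def[abs_def]
    by (intro square_integrable_sum g) auto
  have int_G: "(\<integral>x. G x * h x \<partial>?N) = (\<Sum>i\<in>Basis. \<integral>x. g i x * h x \<partial>?N)" if "square_integrable ?N h" for h
    unfolding G_def sum_distrib_right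
    by (rule Bochner_Integration.integral_sum) (intro square_integrable_mult_integrable g that)
  have "AE x in ?N. G x + F x = 0"
  proof (rule fundamental_lemma_variations[OF assms(1)])
    show "integrable ?N (\<lambda>x. G x + F x)"
      by (intro square_integrable_integrable[OF fin] square_integrable_add(1) G F)
    fix \<eta> assume \<eta>: "test_function \<Omega> \<eta>"
    note \<eta>i = square_integrable_test[OF \<eta> \<Omega>]
    have "(\<integral>x. u x * laplacian \<eta> x \<partial>?N) = (\<Sum>i\<in>Basis. \<integral>x. u x * iter_deriv [i, i] \<eta> x \<partial>?N)"
      unfolding laplacian_def sum_distrib_left
      by (rule Bochner_Integration.integral_sum)
        (intro square_integrable_mult_integrable u square_integrable_test[OF test_function_iter_deriv[OF \<eta> ii] \<Omega>])
    also have "\<dots> = (\<integral>x. G x * \<eta> x \<partial>?N)"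
      using wd \<eta> unfolding int_G[OF \<eta>i] by (intro sum.cong) (auto simp: has_weak_deriv_def)
    finally show "(\<integral>x. (G x + F x) * \<eta> x \<partial>?N) = 0"
      using eq[OF \<eta>] square_integrable_mult_integrable[OF G \<eta>i] square_integrable_mult_integrable[OF F \<eta>i]
      by (simp add: distrib_right)
  qed
  then have "AE x in ?N. F x * ?E x = - (G x * ?E x)"
    by eventually_elim (simp add: add_eq_0_iff)
  moreover have "(\<lambda>x. F x * ?E x) \<in> borel_measurable ?N" "(\<lambda>x. - (G x * ?E x)) \<in> borel_measurable ?N"
    using square_integrable_mult_integrable[OF F E] square_integrable_mult_integrable[OF G E] by auto
  ultimately have "(\<integral>x. F x * ?E x \<partial>?N) = (\<integral>x. - (G x * ?E x) \<partial>?N)"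
    by (intro integral_cong_AE)
  moreover have "(\<integral>x. G x * ?E x \<partial>?N) = 0"
  proof -
    have conv: "(\<lambda>j. \<integral>x. iter_deriv [i, i] (\<psi> j) x * ?E x \<partial>?N) \<longlonglongrightarrow> (\<integral>x. g i x * ?E x \<partial>?N)"
      if i: "i \<in> Basis" for i
    proof (rule LIM_zero_cancel, rule Lim_null_comparison)
      note \<psi>i = square_integrable_test[OF test_function_iter_deriv[OF \<psi> ii[OF i]] \<Omega>]
      have "norm ((\<integral>x. iter_deriv [i, i] (\<psi> j) x * ?E x \<partial>?N) - (\<integral>x. g i x * ?E x \<partial>?N)) \<le>
          L2_norm ?N (\<lambda>x. g i x - iter_deriv [i, i] (\<psi> j) x) * L2_norm ?N ?E" for j
      proof -
        have "(\<integral>x. iter_deriv [i, i] (\<psi> j) x * ?E x \<partial>?N) - (\<integral>x. g i x * ?E x \<partial>?N) =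
            - (\<integral>x. (g i x - iter_deriv [i, i] (\<psi> j) x) * ?E x \<partial>?N)"
          using square_integrable_mult_integrable[OF g[OF i] E] square_integrable_mult_integrable[OF \<psi>i E]
          by (simp add: left_diff_distrib)
        then show ?thesis
          using L2_norm_integral_mult_le[OF square_integrable_diff(1)[OF g[OF i] \<psi>i] E] by simp
      qed
      then show "\<forall>\<^sub>F j in sequentially. norm ((\<integral>x. iter_deriv [i, i] (\<psi> j) x * ?E x \<partial>?N) - (\<integral>x. g i x * ?E x \<partial>?N)) \<le>
          L2_norm ?N (\<lambda>x. g i x - iter_deriv [i, i] (\<psi> j) x) * L2_norm ?N ?E" by simp
      show "(\<lambda>j. L2_norm ?N (\<lambda>x. g i x - iter_deriv [i, i] (\<psi> j) x) * L2_norm ?N ?E) \<longlonglongrightarrow> 0"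
        using tendsto_mult_right[OF glim[OF i], of "L2_norm ?N ?E"] by simp
    qed
    have "(\<lambda>j. \<Sum>i\<in>Basis. \<integral>x. iter_deriv [i, i] (\<psi> j) x * ?E x \<partial>?N) \<longlonglongrightarrow> (\<integral>x. G x * ?E x \<partial>?N)"
      unfolding int_G[OF E] by (rule tendsto_sum) (rule conv)
    moreover have "(\<Sum>i\<in>Basis. \<integral>x. iter_deriv [i, i] (\<psi> j) x * ?E x \<partial>?N) = 0" for j
    proof -
      have "(\<Sum>i\<in>Basis. \<integral>x. iter_deriv [i, i] (\<psi> j) x * ?E x \<partial>?N) =
          (\<Sum>i\<in>Basis. (Complex (p \<bullet> i) (q \<bullet> i))\<^sup>2) * (\<integral>x. \<psi> j x * ?E x \<partial>?N)"
        unfolding sum_distrib_right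
        by (rule sum.cong[OF refl]) (rule integral_iter_deriv_cexp_test[OF \<psi> \<Omega>])
      then show ?thesis by (simp add: sum_Complex_square_eq_0[OF pq])
    qed
    ultimately show ?thesis by (simp add: LIMSEQ_const_iff)
  qed
  ultimately show ?thesis by simp
qed

section \<open>Laplace integrals over simplicial cones\<close>

lemma nn_integral_exp_abs_finite:
  assumes "0 < (c::real)"
  shows "(\<integral>\<^sup>+t. ennreal (exp (- c * \<bar>t\<bar>)) \<partial>lborel) < \<infinity>"
proof -
  let ?h = "\<lambda>t. indicator {0..} t * ennreal (exp (- c * t))"
  have h: "(\<integral>\<^sup>+t. ?h t \<partial>lborel) = ennreal (exp (- c * 0) / c)"
  proof -
    have "(\<integral>\<^sup>+t. ennreal (indicator {0..} t * exp (- c * t)) \<partial>lborel) = ennreal (exp (- c * 0) / c)"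
    proof (rule nn_integral_has_integral_lborel)
      have "(\<lambda>t. indicator {0..} t * exp (- c * t)) = (\<lambda>t. if t \<in> {0..} then exp (- c * t) else 0)"
        by (auto simp: indicator_def)
      then show "((\<lambda>t. indicator {0..} t * exp (- c * t)) has_integral exp (- c * 0) / c) UNIV"
        using has_integral_exp_minus_to_infinity[OF assms, of 0] by (simp only: has_integral_restrict_UNIV)
    qed auto
    then show ?thesis by (simp add: ennreal_mult' ennreal_indicator)
  qed
  have "(\<integral>\<^sup>+t. ?h (- t) \<partial>lborel) = (\<integral>\<^sup>+t. ?h t \<partial>lborel)"
    using nn_integral_real_affine[of ?h "-1" 0] by simp
  moreover have "(\<integral>\<^sup>+t. ennreal (exp (- c * \<bar>t\<bar>)) \<partial>lborel) \<le> (\<integral>\<^sup>+t. ?h t + ?h (- t) \<partial>lborel)"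
    by (intro nn_integral_mono) (auto simp: indicator_def abs_if)
  moreover have "(\<integral>\<^sup>+t. ?h t + ?h (- t) \<partial>lborel) = (\<integral>\<^sup>+t. ?h t \<partial>lborel) + (\<integral>\<^sup>+t. ?h (- t) \<partial>lborel)"
    by (intro nn_integral_add) auto
  ultimately have "(\<integral>\<^sup>+t. ennreal (exp (- c * \<bar>t\<bar>)) \<partial>lborel) \<le> ennreal (exp (- c * 0) / c) + ennreal (exp (- c * 0) / c)"
    unfolding h by (simp add: h)
  also have "\<dots> < \<infinity>" by simp
  finally show ?thesis .
qed

lemma integrable_exp_minus_norm:
  assumes "0 < \<delta>"
  shows "integrable lborel (\<lambda>y::'a::euclidean_space. exp (- \<delta> * norm y))"
proof -
  define c where "c = \<delta> / DIM('a)"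
  have c: "0 < c" using assms by (simp add: c_def)
  have le: "exp (- \<delta> * norm y) \<le> (\<Prod>b\<in>Basis. exp (- c * \<bar>y \<bullet> b\<bar>))" for y :: 'a
  proof -
    have "(\<Sum>b\<in>Basis. \<bar>y \<bullet> b\<bar>) \<le> (\<Sum>b\<in>(Basis::'a set). norm y)"
      by (intro sum_mono Basis_le_norm)
    then have "c * (\<Sum>b\<in>Basis. \<bar>y \<bullet> b\<bar>) \<le> c * (DIM('a) * norm y)"
      using c by (intro mult_left_mono) auto
    also have "\<dots> = \<delta> * norm y" by (simp add: c_def)
    finally show ?thesis
      unfolding exp_sum[OF finite_Basis, symmetric] by (simp add: sum_negf sum_distrib_left[symmetric])
  qed
  have "(\<integral>\<^sup>+y. ennreal (exp (- \<delta> * norm (y::'a))) \<partial>lborel) \<le>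
      (\<integral>\<^sup>+y. (\<Prod>b\<in>Basis. ennreal (exp (- c * \<bar>(y::'a) \<bullet> b\<bar>))) \<partial>lborel)"
    using le by (intro nn_integral_mono) (simp add: prod_ennreal ennreal_leI)
  also have "\<dots> = (\<Prod>b\<in>(Basis::'a set). (\<integral>\<^sup>+t. ennreal (exp (- c * \<bar>t\<bar>)) \<partial>lborel))"
    by (intro nn_integral_lborel_prod) auto
  also have "\<dots> < \<infinity>"
    using nn_integral_exp_abs_finite[OF c] by (simp add: ennreal_prod_eq_top less_top[symmetric] del: prod_constant)
  finally show ?thesis by (auto simp: integrable_iff_bounded)
qed

lemma lborel_integral_affine:
  fixes f :: "'a::euclidean_space \<Rightarrow> complex"
  assumes "f \<in> borel_measurable borel" "c \<noteq> 0"
  shows "(\<integral>x. f x \<partial>lborel) = of_real (\<bar>c\<bar> ^ DIM('a)) * (\<integral>x. f (t + c *\<^sub>R x) \<partial>lborel)"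
proof -
  have "(\<integral>x. f x \<partial>lborel) =
      (\<integral>x. f x \<partial>density (distr lborel borel (\<lambda>x. t + c *\<^sub>R x)) (\<lambda>_. ennreal (\<bar>c\<bar> ^ DIM('a))))"
    using lborel_affine[OF assms(2), of t] by (simp add: ennreal_power)
  also have "\<dots> = (\<integral>x. \<bar>c\<bar> ^ DIM('a) *\<^sub>R f x \<partial>distr lborel borel (\<lambda>x. t + c *\<^sub>R x))"
    by (rule integral_density) (use assms in auto)
  also have "\<dots> = (\<integral>x. \<bar>c\<bar> ^ DIM('a) *\<^sub>R f (t + c *\<^sub>R x) \<partial>lborel)"
    by (rule integral_distr) (use assms in auto)
  finally show ?thesis by (simp add: scaleR_conv_of_real)
qed

text \<open>The vectors \<open>a i\<close> are the edges of a simplicial cone, and the \<open>l i\<close> the inner normals of its faces.\<close>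

locale dual_basis =
  fixes l a :: "'i::finite \<Rightarrow> 'a::euclidean_space"
  assumes dual: "l i \<bullet> a j = (if i = j then 1 else 0)"
    and expansion: "(\<Sum>i\<in>UNIV. (l i \<bullet> y) *\<^sub>R a i) = y"
begin

definition simplicial_cone :: "'a set" where "simplicial_cone = {y. \<forall>i. 0 < l i \<bullet> y}"

text \<open>Bounding the coordinates in \<open>S\<close> interpolates between the cone and a parallelepiped.\<close>

definition truncated :: "'i set \<Rightarrow> real \<Rightarrow> 'a set" where
  "truncated S t = {y \<in> simplicial_cone. \<forall>i\<in>S. l i \<bullet> y \<le> t}"

lemma cone_nonzero: "y \<in> simplicial_cone \<Longrightarrow> y \<noteq> 0"
  by (auto simp: simplicial_cone_def)

lemma cone_scale_iff: "0 < c \<Longrightarrow> c *\<^sub>R y \<in> simplicial_cone \<longleftrightarrow> y \<in> simplicial_cone"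
  by (simp add: simplicial_cone_def zero_less_mult_iff)

lemma inner_expansion: "w \<bullet> y = (\<Sum>i\<in>UNIV. (l i \<bullet> y) * (w \<bullet> a i))"
  by (subst expansion[of y, symmetric]) (simp add: inner_sum_right)

lemma open_cone: "open simplicial_cone"
proof -
  have "simplicial_cone = (\<Inter>i. {y. 0 < l i \<bullet> y})" by (auto simp: simplicial_cone_def)
  then show ?thesis by (auto intro!: open_INT open_halfspace_gt)
qed

lemma borel_truncated [measurable]: "truncated S t \<in> sets borel"
proof -
  have "truncated S t = simplicial_cone \<inter> (\<Inter>i\<in>S. {y. l i \<bullet> y \<le> t})" by (auto simp: truncated_def)
  moreover have "closed (\<Inter>i\<in>S. {y. l i \<bullet> y \<le> t})"
    by (intro closed_INT ballI closed_halfspace_le)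
  ultimately show ?thesis using open_cone by (auto intro!: sets.Int borel_open borel_closed)
qed

text \<open>Both sides are controlled by the coordinates \<open>l i \<bullet> y\<close>, which are positive on the cone.\<close>

lemma cone_decay:
  assumes "\<And>i. p \<bullet> a i < 0"
  obtains \<delta> where "0 < \<delta>" "\<And>y. y \<in> simplicial_cone \<Longrightarrow> p \<bullet> y \<le> - \<delta> * norm y"
proof -
  define \<delta> where "\<delta> = Min (range (\<lambda>i. - (p \<bullet> a i) / (norm (a i) + 1)))"
  have "\<delta> \<in> range (\<lambda>i. - (p \<bullet> a i) / (norm (a i) + 1))"
    unfolding \<delta>_def by (rule Min_in) auto
  then obtain i where i: "\<delta> = - (p \<bullet> a i) / (norm (a i) + 1)" by blast
  have \<delta>: "0 < \<delta>"
    unfolding i by (rule divide_pos_pos) (use assms[of i] in \<open>auto simp: add_nonneg_pos\<close>)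
  have le: "p \<bullet> a i \<le> - \<delta> * norm (a i)" for i
  proof -
    have "\<delta> \<le> - (p \<bullet> a i) / (norm (a i) + 1)" unfolding \<delta>_def by (rule Min_le) auto
    then have "\<delta> * (norm (a i) + 1) \<le> - (p \<bullet> a i)"
      by (subst (asm) pos_le_divide_eq) (auto simp: add_nonneg_pos)
    then show ?thesis using \<delta> by (simp add: algebra_simps)
  qed
  show ?thesis
  proof (rule that[OF \<delta>])
    fix y assume y: "y \<in> simplicial_cone"
    then have pos: "0 < l i \<bullet> y" for i by (simp add: simplicial_cone_def)
    have "norm y = norm (\<Sum>i\<in>UNIV. (l i \<bullet> y) *\<^sub>R a i)" by (simp add: expansion)
    also have "\<dots> \<le> (\<Sum>i\<in>UNIV. (l i \<bullet> y) * norm (a i))"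
      by (rule order_trans[OF norm_sum]) (simp add: pos less_imp_le)
    finally have "\<delta> * norm y \<le> \<delta> * (\<Sum>i\<in>UNIV. (l i \<bullet> y) * norm (a i))"
      using \<delta> by simp
    moreover have "p \<bullet> y \<le> (\<Sum>i\<in>UNIV. (l i \<bullet> y) * (- \<delta> * norm (a i)))"
      unfolding inner_expansion[of p y] by (intro sum_mono mult_left_mono le) (simp add: pos less_imp_le)
    moreover have "(\<Sum>i\<in>UNIV. (l i \<bullet> y) * (- \<delta> * norm (a i))) = - (\<delta> * (\<Sum>i\<in>UNIV. (l i \<bullet> y) * norm (a i)))"
      by (simp add: sum_distrib_left sum_negf[symmetric] mult_ac)
    ultimately show "p \<bullet> y \<le> - \<delta> * norm y" by simp
  qed
qed

text \<open>The Laplace transform of the indicator function of the cone at \<open>- (p + i q)\<close>.\<close>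

definition laplace :: "'a \<Rightarrow> 'a \<Rightarrow> complex" where
  "laplace p q = (\<integral>y. indicator simplicial_cone y *\<^sub>R cexp p q y \<partial>lborel)"

lemma integrable_cone_cexp:
  assumes "\<And>i. p \<bullet> a i < 0" "A \<in> sets borel" "A \<subseteq> simplicial_cone"
  shows "integrable lborel (\<lambda>y. indicator A y *\<^sub>R cexp p q y)"
proof -
  obtain \<delta> where \<delta>: "0 < \<delta>" "\<And>y. y \<in> simplicial_cone \<Longrightarrow> p \<bullet> y \<le> - \<delta> * norm y"
    using cone_decay[OF assms(1)] by blast
  show ?thesis
  proof (rule Bochner_Integration.integrable_bound[OF integrable_exp_minus_norm[OF \<delta>(1)]])
    show "AE y in lborel. norm (indicator A y *\<^sub>R cexp p q y) \<le> norm (exp (- \<delta> * norm y))"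
      using \<delta>(2) assms(3) by (intro AE_I2) (auto simp: indicator_def norm_cexp)
  qed (use assms(2) in measurable)
qed

text \<open>Translating by \<open>t a\<^sub>i\<close> maps the truncated cone onto the part with \<open>l\<^sub>i > t\<close>; so each new
  truncation multiplies the integral by \<open>1 - e\<^bsup>t \<rho>\<cdot>a\<^sub>i\<^esup>\<close>.\<close>

lemma integral_truncated:
  assumes p: "\<And>i. p \<bullet> a i < 0" and t: "0 < t"
  shows "(\<integral>y. indicator (truncated S t) y *\<^sub>R cexp p q y \<partial>lborel) =
    (\<Prod>i\<in>S. 1 - cexp p q (t *\<^sub>R a i)) * laplace p q"
proof (induction S rule: infinite_finite_induct)
  case (insert i S)
  let ?f = "\<lambda>y. indicator (truncated S t) y *\<^sub>R cexp p q y"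
  have f: "integrable lborel ?f"
    by (rule integrable_cone_cexp[OF p borel_truncated]) (auto simp: truncated_def)
  have shift: "- (t *\<^sub>R a i) + y \<in> truncated S t \<longleftrightarrow> y \<in> truncated S t \<and> t < l i \<bullet> y" for y
  proof -
    have eq: "l j \<bullet> (y - t *\<^sub>R a i) = (if j = i then l i \<bullet> y - t else l j \<bullet> y)" for j
      by (simp add: inner_diff_right dual)
    show ?thesis
      using insert.hyps t by (auto simp: truncated_def simplicial_cone_def eq split: if_splits)
  qed
  have 1: "indicator (truncated (insert i S) t) y *\<^sub>R cexp p q y =
      ?f y - cexp p q (t *\<^sub>R a i) * ?f (- (t *\<^sub>R a i) + y)" for y
  proof -
    have "cexp p q (t *\<^sub>R a i) * cexp p q (- (t *\<^sub>R a i) + y) = cexp p q y"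
      by (simp add: cexp_add[symmetric])
    moreover have "y \<in> truncated (insert i S) t \<longleftrightarrow> y \<in> truncated S t \<and> \<not> t < l i \<bullet> y"
      by (auto simp: truncated_def)
    ultimately show ?thesis using shift[of y] by (auto simp: indicator_def)
  qed
  have 2: "integrable lborel (\<lambda>y. ?f (- (t *\<^sub>R a i) + y))"
    "(\<integral>y. ?f (- (t *\<^sub>R a i) + y) \<partial>lborel) = (\<integral>y. ?f y \<partial>lborel)"
    using f integrable_distr_eq[of "(+) (- (t *\<^sub>R a i))" lborel borel ?f]
      integral_distr[of "(+) (- (t *\<^sub>R a i))" lborel borel ?f]
    by (auto simp: lborel_distr_plus)
  have "(\<integral>y. indicator (truncated (insert i S) t) y *\<^sub>R cexp p q y \<partial>lborel) =
      (\<integral>y. ?f y \<partial>lborel) - cexp p q (t *\<^sub>R a i) * (\<integral>y. ?f (- (t *\<^sub>R a i) + y) \<partial>lborel)"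
    unfolding 1 Bochner_Integration.integral_diff[OF f integrable_mult_right[OF 2(1)]]
    by (simp only: integral_mult_right_zero)
  also have "\<dots> = (1 - cexp p q (t *\<^sub>R a i)) * (\<integral>y. ?f y \<partial>lborel)"
    unfolding 2(2) by (simp only: left_diff_distrib mult_1)
  finally have "(\<integral>y. indicator (truncated (insert i S) t) y *\<^sub>R cexp p q y \<partial>lborel) =
      (1 - cexp p q (t *\<^sub>R a i)) * (\<integral>y. ?f y \<partial>lborel)" .
  then show ?case using insert by (simp add: mult.assoc)
qed (auto simp: truncated_def laplace_def)

text \<open>The integral over a parallelepiped is a multiple of the integral over the cone. If the
  parallelepiped is small, the exponential has positive real part on it.\<close>

lemma laplace_nonzero:
  assumes p: "\<And>i. p \<bullet> a i < 0"
  shows "laplace p q \<noteq> 0"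
proof
  assume "laplace p q = 0"
  define s where "s = (\<Sum>i\<in>UNIV. \<bar>q \<bullet> a i\<bar>)"
  \<comment> \<open>With this size the phase \<open>q \<bullet> y\<close> stays below \<open>1 < \<pi>/2\<close>.\<close>
  define t where "t = 1 / (1 + s)"
  have s: "0 \<le> s" by (simp add: s_def sum_nonneg)
  then have t: "0 < t" "t * s < 1" by (auto simp: t_def)
  let ?Q = "truncated UNIV t"
  have int: "integrable lborel (\<lambda>y. indicator ?Q y *\<^sub>R cexp p q y)"
    by (rule integrable_cone_cexp[OF p borel_truncated]) (auto simp: truncated_def)
  have Re_pos: "0 < Re (cexp p q y)" if "y \<in> ?Q" for y
  proof -
    have "\<bar>q \<bullet> y\<bar> \<le> (\<Sum>i\<in>UNIV. \<bar>(l i \<bullet> y) * (q \<bullet> a i)\<bar>)"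
      unfolding inner_expansion[of q y] by (rule sum_abs)
    also have "\<dots> \<le> (\<Sum>i\<in>UNIV. t * \<bar>q \<bullet> a i\<bar>)"
      using that by (intro sum_mono) (auto simp: abs_mult truncated_def simplicial_cone_def less_imp_le intro!: mult_right_mono)
    also have "\<dots> < 1" using t by (simp add: s_def sum_distrib_left)
    finally have "\<bar>q \<bullet> y\<bar> < pi / 2" using pi_gt3 by linarith
    then have "0 < cos (q \<bullet> y)" by (intro cos_gt_zero_pi) auto
    then show ?thesis by (simp add: cexp_def Re_exp)
  qed
  have "(\<integral>y. indicator ?Q y *\<^sub>R cexp p q y \<partial>lborel) = 0"
    using integral_truncated[OF p t(1), of UNIV q] \<open>laplace p q = 0\<close> by simp
  then have "(\<integral>y. Re (indicator ?Q y *\<^sub>R cexp p q y) \<partial>lborel) = 0"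
    by (simp only: integral_Re[OF int] zero_complex.sel)
  moreover have "AE y in lborel. 0 \<le> Re (indicator ?Q y *\<^sub>R cexp p q y)"
    using Re_pos by (intro AE_I2) (auto simp: indicator_def less_imp_le)
  ultimately have "AE y in lborel. Re (indicator ?Q y *\<^sub>R cexp p q y) = 0"
    by (rule iffD1[OF integral_nonneg_eq_0_iff_AE[OF integrable_Re[OF int]], rotated])
  then have "AE y in lborel. y \<notin> ?Q"
    by eventually_elim (use Re_pos in \<open>force simp: indicator_def\<close>)
  then have "?Q \<in> null_sets lborel" by (subst AE_iff_null_sets) auto
  then have "negligible ?Q" by (simp add: negligible_iff_null_sets null_sets_completionI)
  moreover define U where "U = (\<Inter>i. {y. 0 < l i \<bullet> y} \<inter> {y. l i \<bullet> y < t})"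
  have "U \<subseteq> ?Q" by (auto simp: U_def truncated_def simplicial_cone_def less_imp_le)
  moreover have "open U" unfolding U_def
    by (intro open_INT open_Int ballI open_halfspace_gt open_halfspace_lt) (auto intro: open_halfspace_gt)
  moreover have "(\<Sum>j\<in>UNIV. (t / 2) *\<^sub>R a j) \<in> U"
  proof -
    have eq: "l i \<bullet> (\<Sum>j\<in>UNIV. (t / 2) *\<^sub>R a j) = t / 2" for i
    proof -
      have "l i \<bullet> (\<Sum>j\<in>UNIV. (t / 2) *\<^sub>R a j) = (\<Sum>j\<in>UNIV. if j = i then t / 2 else 0)"
        unfolding inner_sum_right by (rule sum.cong) (auto simp: dual)
      then show ?thesis by simp
    qed
    show ?thesis unfolding U_def using t by (simp only: eq INT_iff Int_iff mem_Collect_eq) simp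
  qed
  ultimately show False
    using open_not_negligible negligible_subset by blast
qed

end

text \<open>A domain which fills a simplicial cone near its boundary point \<open>z\<close> and is contained in it, together with
  an isotropic complex vector \<open>p + i q\<close> whose exponential decays along all edges.\<close>

locale corner = dual_basis l a
  for l a :: "'i::finite \<Rightarrow> 'a::euclidean_space" +
  fixes p q :: 'a and \<Omega> :: "'a set" and z :: 'a
  assumes neg: "p \<bullet> a i < 0"
    and isotropic: "p \<bullet> p = q \<bullet> q" "p \<bullet> q = 0"
    and open_domain: "open \<Omega>" and bounded_domain: "bounded \<Omega>"
    and in_cone: "x \<in> \<Omega> \<Longrightarrow> x - z \<in> simplicial_cone"
    and fills_cone: "y \<in> simplicial_cone \<Longrightarrow> \<forall>\<^sub>F t in at_right 0. z + t *\<^sub>R y \<in> \<Omega>"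
begin

text \<open>The substitution \<open>x = z + y / m\<close> takes \<open>e\<^bsup>m \<rho>\<cdot>(x - z)\<^esup>\<close> to \<open>e\<^bsup>\<rho>\<cdot>y\<^esup>\<close>, absorbs the power of \<open>m\<close>, and blows up the domain
  to the cone. It is stated for other exponents \<open>p'\<close>, \<open>q'\<close> too, since absolute values lead to \<open>q' = 0\<close>.\<close>

lemma scaled_integral_tendsto:
  assumes G: "G \<in> borel_measurable borel" "\<And>x. x \<in> \<Omega> \<Longrightarrow> norm (G x) \<le> B" "(G \<longlongrightarrow> G0) (at z within \<Omega>)"
    and p': "\<And>i. p' \<bullet> a i < 0"
  shows "(\<lambda>m. of_real (real m ^ DIM('a)) *
      (\<integral>x. G x * cexp (real m *\<^sub>R p') (real m *\<^sub>R q') (x - z) \<partial>lebesgue_on \<Omega>)) \<longlonglongrightarrow> G0 * laplace p' q'"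
proof -
  have [measurable]: "\<Omega> \<in> sets borel" using open_domain by simp
  note [measurable] = G(1)
  obtain \<delta> where \<delta>: "0 < \<delta>" "\<And>y. y \<in> simplicial_cone \<Longrightarrow> p' \<bullet> y \<le> - \<delta> * norm y"
    using cone_decay[OF p'] by blast
  define h where "h m y = indicator \<Omega> (z + (1 / real m) *\<^sub>R y) *\<^sub>R (G (z + (1 / real m) *\<^sub>R y) * cexp p' q' y)"
    for m y
  have eq: "of_real (real m ^ DIM('a)) *
      (\<integral>x. G x * cexp (real m *\<^sub>R p') (real m *\<^sub>R q') (x - z) \<partial>lebesgue_on \<Omega>) = (\<integral>y. h m y \<partial>lborel)"
    if "0 < m" for m
  proof -
    let ?f = "\<lambda>x. indicator \<Omega> x *\<^sub>R (G x * cexp (real m *\<^sub>R p') (real m *\<^sub>R q') (x - z))"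
    have [measurable]: "?f \<in> borel_measurable borel" by measurable
    have "(\<integral>x. G x * cexp (real m *\<^sub>R p') (real m *\<^sub>R q') (x - z) \<partial>lebesgue_on \<Omega>) = (\<integral>x. ?f x \<partial>lborel)"
      by (simp add: integral_restrict_space integral_completion)
    also have "\<dots> = of_real (\<bar>1 / real m\<bar> ^ DIM('a)) * (\<integral>y. ?f (z + (1 / real m) *\<^sub>R y) \<partial>lborel)"
      using that by (intro lborel_integral_affine) auto
    also have "(\<lambda>y. ?f (z + (1 / real m) *\<^sub>R y)) = h m"
      using that by (auto simp: h_def cexp_def fun_eq_iff)
    finally show ?thesis using that by (simp add: power_divide)
  qed
  have "(\<lambda>m. \<integral>y. h m y \<partial>lborel) \<longlonglongrightarrow> (\<integral>y. G0 * (indicator simplicial_cone y *\<^sub>R cexp p' q' y) \<partial>lborel)"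
  proof (rule integral_dominated_convergence[where w="\<lambda>y. \<bar>B\<bar> * exp (- \<delta> * norm y)"])
    show "integrable lborel (\<lambda>y::'a. \<bar>B\<bar> * exp (- \<delta> * norm y))"
      by (intro integrable_mult_right integrable_exp_minus_norm \<delta>)
    have in_cone': "y \<in> simplicial_cone" if "z + (1 / real m) *\<^sub>R y \<in> \<Omega>" for m y
    proof (cases "m = 0")
      case True
      then show ?thesis using in_cone[OF that] cone_nonzero[of 0] by simp
    next
      case False
      then show ?thesis using in_cone[OF that] cone_scale_iff[of "1 / real m" y] by simp
    qed
    show "AE y in lborel. norm (h m y) \<le> \<bar>B\<bar> * exp (- \<delta> * norm y)" for m
    proof (rule AE_I2)
      fix y
      show "norm (h m y) \<le> \<bar>B\<bar> * exp (- \<delta> * norm y)"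
      proof (cases "z + (1 / real m) *\<^sub>R y \<in> \<Omega>")
        case True
        have "norm (G (z + (1 / real m) *\<^sub>R y)) * exp (p' \<bullet> y) \<le> \<bar>B\<bar> * exp (- \<delta> * norm y)"
          using G(2)[OF True] \<delta>(2)[OF in_cone'[OF True]] by (intro mult_mono) auto
        then show ?thesis using True by (simp add: h_def norm_mult norm_cexp)
      qed (simp add: h_def)
    qed
    show "AE y in lborel. (\<lambda>m. h m y) \<longlonglongrightarrow> G0 * (indicator simplicial_cone y *\<^sub>R cexp p' q' y)"
    proof (rule AE_I2)
      fix y
      show "(\<lambda>m. h m y) \<longlonglongrightarrow> G0 * (indicator simplicial_cone y *\<^sub>R cexp p' q' y)"
      proof (cases "y \<in> simplicial_cone")
        case True
        have inv: "filterlim (\<lambda>m. 1 / real m) (at_right 0) sequentially"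
          using filterlim_compose[OF filterlim_inverse_at_right_top filterlim_real_sequentially]
          by (simp add: inverse_eq_divide)
        have ev: "\<forall>\<^sub>F m in sequentially. z + (1 / real m) *\<^sub>R y \<in> \<Omega>"
          using eventually_compose_filterlim[OF fills_cone[OF True] inv] .
        have ne: "\<forall>\<^sub>F m in sequentially. z + (1 / real m) *\<^sub>R y \<noteq> z"
          using eventually_gt_at_top[of 0] by eventually_elim (use cone_nonzero[OF True] in auto)
        have "(\<lambda>m. z + (1 / real m) *\<^sub>R y) \<longlonglongrightarrow> z + 0 *\<^sub>R y"
          using lim_inverse_n' by (intro tendsto_intros)
        then have "filterlim (\<lambda>m. z + (1 / real m) *\<^sub>R y) (at z within \<Omega>) sequentially"
          using ev ne by (auto simp: filterlim_at elim: eventually_elim2)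
        from filterlim_compose[OF G(3) this]
        have "(\<lambda>m. G (z + (1 / real m) *\<^sub>R y) * cexp p' q' y) \<longlonglongrightarrow> G0 * cexp p' q' y"
          by (intro tendsto_intros)
        moreover have "\<forall>\<^sub>F m in sequentially. G (z + (1 / real m) *\<^sub>R y) * cexp p' q' y = h m y"
          using ev by eventually_elim (simp add: h_def)
        ultimately show ?thesis using True by (auto elim: Lim_transform_eventually)
      next
        case False
        then have "h m y = 0" for m using in_cone'[of m y] by (auto simp: h_def indicator_def)
        then show ?thesis using False by simp
      qed
    qed
  qed (use open_cone in \<open>auto simp: h_def[abs_def]\<close>)
  then have "(\<lambda>m. \<integral>y. h m y \<partial>lborel) \<longlonglongrightarrow> G0 * laplace p' q'"
    by (simp only: integral_mult_right_zero laplace_def)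
  moreover have "\<forall>\<^sub>F m in sequentially. (\<integral>y. h m y \<partial>lborel) = of_real (real m ^ DIM('a)) *
      (\<integral>x. G x * cexp (real m *\<^sub>R p') (real m *\<^sub>R q') (x - z) \<partial>lebesgue_on \<Omega>)"
    using eventually_gt_at_top[of 0] by eventually_elim (simp only: eq)
  ultimately show ?thesis by (rule Lim_transform_eventually)
qed

end

section \<open>Vanishing at a corner\<close>

lemma cexp_real: "cexp p 0 x = of_real (exp (p \<bullet> x))"
  by (simp add: cexp_def exp_of_real complex_of_real_def[symmetric])

context corner
begin

lemma inner_neg: "x \<in> \<Omega> \<Longrightarrow> p \<bullet> (x - z) \<le> 0"
proof -
  assume x: "x \<in> \<Omega>"
  obtain \<delta> where \<delta>: "0 < \<delta>" "\<And>y. y \<in> simplicial_cone \<Longrightarrow> p \<bullet> y \<le> - \<delta> * norm y"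
    using cone_decay[OF neg] by blast
  have "- \<delta> * norm (x - z) \<le> 0" using \<delta>(1) by simp
  then show ?thesis using \<delta>(2)[OF in_cone[OF x]] by linarith
qed

text \<open>With half of the weight given to each factor, the Cauchy-Schwarz inequality bounds the integral by the
  product of a weighted norm of \<open>u\<close>, of order \<open>m\<^sup>-\<^sup>2\<close>, and of the norm of an exponential, of order \<open>m\<^bsup>-n/2\<^esup>\<close>. This
  beats \<open>m\<^bsup>-n\<^esup>\<close> because the dimension is below four.\<close>

lemma remainder_tendsto_0:
  assumes dim: "DIM('a) < 4" and u: "u \<in> sobolev_H0 2 \<Omega>"
    and b: "b \<in> borel_measurable (lebesgue_on \<Omega>)" "\<And>x. x \<in> \<Omega> \<Longrightarrow> norm (b x) \<le> B"
  shows "(\<lambda>m. of_real (real m ^ DIM('a)) *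
    (\<integral>x. b x * u x * cexp (real m *\<^sub>R p) (real m *\<^sub>R q) (x - z) \<partial>lebesgue_on \<Omega>)) \<longlonglongrightarrow> 0"
proof -
  let ?N = "lebesgue_on \<Omega>" and ?n = "DIM('a)"
  have "p \<noteq> 0" using neg by auto
  then obtain e where e: "e \<in> Basis" "p \<bullet> e \<noteq> 0" using euclidean_all_zero_iff by blast
  have u2: "square_integrable ?N u" using u by (simp add: sobolev_H0_def sobolev_H_def)
  obtain K where K: "0 \<le> K" "\<And>p. (\<And>x. x \<in> \<Omega> \<Longrightarrow> p \<bullet> (x - z) \<le> 0) \<Longrightarrow>
     (p \<bullet> e)\<^sup>2 * L2_norm ?N (\<lambda>x. cexp p 0 (x - z) * u x) \<le> K"
    using sobolev_H0_exponential_decay[OF open_domain bounded_domain u e(1)] by blast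
  define S where "S m = (\<integral>x. 1 * cexp (real m *\<^sub>R p) (real m *\<^sub>R 0) (x - z) \<partial>?N)" for m
  have "(\<lambda>m. of_real (real m ^ ?n) * S m) \<longlonglongrightarrow> 1 * laplace p 0"
    unfolding S_def by (rule scaled_integral_tendsto[where B=1]) (auto intro: neg)
  from convergent_imp_Bseq[OF convergentI[OF this]]
  obtain M where M: "\<And>m. norm (of_real (real m ^ ?n) * S m) \<le> M"
    unfolding Bseq_def by blast
  define T where "T m = of_real (real m ^ ?n) *
    (\<integral>x. b x * u x * cexp (real m *\<^sub>R p) (real m *\<^sub>R q) (x - z) \<partial>?N)" for m
  define K1 where "K1 = \<bar>B\<bar> * (4 * K / (p \<bullet> e)\<^sup>2)"
  have bound: "(norm (T m))\<^sup>2 \<le> K1\<^sup>2 * M * (1 / real m)" if m: "0 < m" for m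
  proof -
    let ?p = "(real m / 2) *\<^sub>R p" and ?q = "real m *\<^sub>R q"
    \<comment> \<open>The exponential is \<open>W\<close> times \<open>W2\<close>; the phase goes into \<open>W2\<close>, as the decay estimate is for real weights.\<close>
    define W where "W x = cexp ?p 0 (x - z)" for x
    define W2 where "W2 x = cexp ?p ?q (x - z)" for x
    have Wm: "W \<in> borel_measurable ?N" unfolding W_def[abs_def] by (rule borel_measurable_cexp_shift)
    have p_neg: "?p \<bullet> (x - z) \<le> 0" if "x \<in> \<Omega>" for x
      using inner_neg[OF that] m by (simp add: mult_nonneg_nonpos)
    have W_le: "norm (W x) \<le> 1" if "x \<in> space ?N" for x
      using p_neg[of x] that unfolding W_def norm_cexp by (simp only: exp_le_one_iff) simp
    have Wu: "square_integrable ?N (\<lambda>x. W x * u x)"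
      by (rule square_integrable_mult_bounded[OF u2 Wm W_le])
    have B: "norm (b x) \<le> \<bar>B\<bar>" if "x \<in> space ?N" for x using b(2)[of x] that by simp
    have W2: "square_integrable ?N W2" unfolding W2_def[abs_def]
      by (rule square_integrable_cexp[OF open_domain bounded_domain])
    have factor: "b x * u x * cexp (real m *\<^sub>R p) ?q (x - z) = b x * (W x * u x) * W2 x" for x
    proof -
      have "cexp (real m *\<^sub>R p) ?q (x - z) = W x * W2 x"
        by (simp add: W_def W2_def cexp_def exp_add[symmetric] plus_complex.ctr)
      then show ?thesis by simp
    qed
    have Wu_le: "L2_norm ?N (\<lambda>x. W x * u x) \<le> (4 * K / (p \<bullet> e)\<^sup>2) / (real m)\<^sup>2"
    proof -
      have e2: "(?p \<bullet> e)\<^sup>2 = (real m)\<^sup>2 * (p \<bullet> e)\<^sup>2 / 4" by (simp add: power2_eq_square)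
      have "(?p \<bullet> e)\<^sup>2 * L2_norm ?N (\<lambda>x. W x * u x) \<le> K"
        using K(2)[of ?p, OF p_neg] by (simp only: W_def)
      then have "(real m)\<^sup>2 * (p \<bullet> e)\<^sup>2 * L2_norm ?N (\<lambda>x. W x * u x) \<le> 4 * K"
        unfolding e2 by (simp only: times_divide_eq_left pos_divide_le_eq zero_less_numeral mult.commute[of K])
      moreover have "0 < (real m)\<^sup>2 * (p \<bullet> e)\<^sup>2" using m e(2) by simp
      ultimately show ?thesis by (simp add: field_simps)
    qed
    have "norm (\<integral>x. b x * u x * cexp (real m *\<^sub>R p) ?q (x - z) \<partial>?N) \<le>
        L2_norm ?N (\<lambda>x. b x * (W x * u x)) * L2_norm ?N W2"
      unfolding factor by (rule L2_norm_integral_mult_le[OF square_integrable_mult_bounded[OF Wu b(1) B] W2])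
    also have "\<dots> \<le> (\<bar>B\<bar> * L2_norm ?N (\<lambda>x. W x * u x)) * L2_norm ?N W2"
      by (intro mult_right_mono L2_norm_mult_bounded_le[OF Wu b(1) B]) (auto simp: L2_norm_nonneg)
    also have "\<dots> \<le> (\<bar>B\<bar> * ((4 * K / (p \<bullet> e)\<^sup>2) / (real m)\<^sup>2)) * L2_norm ?N W2"
      by (intro mult_right_mono mult_left_mono Wu_le) (auto simp: L2_norm_nonneg)
    also have "\<dots> = (K1 / (real m)\<^sup>2) * L2_norm ?N W2" by (simp add: K1_def)
    finally have "norm (\<integral>x. b x * u x * cexp (real m *\<^sub>R p) ?q (x - z) \<partial>?N) \<le> (K1 / (real m)\<^sup>2) * L2_norm ?N W2" .
    then have "norm (T m) \<le> real m ^ ?n * ((K1 / (real m)\<^sup>2) * L2_norm ?N W2)"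
      unfolding T_def norm_mult norm_of_real by (intro mult_mono) auto
    then have "(norm (T m))\<^sup>2 \<le> (real m ^ ?n * ((K1 / (real m)\<^sup>2) * L2_norm ?N W2))\<^sup>2"
      by (intro power_mono) auto
    also have "\<dots> = K1\<^sup>2 * (real m ^ ?n * (L2_norm ?N W2)\<^sup>2) * (real m ^ ?n / real m ^ 4)"
      by (simp add: power_mult_distrib power_divide power2_eq_square numeral_eq_Suc mult_ac)
    \<comment> \<open>Squaring doubles the exponent, which explains the definition of \<open>S\<close>.\<close>
    also have "(L2_norm ?N W2)\<^sup>2 = norm (S m)"
    proof -
      have "S m = (\<integral>x. of_real ((norm (W2 x))\<^sup>2) \<partial>?N)"
        unfolding S_def
        by (intro Bochner_Integration.integral_cong)
          (auto simp: W2_def norm_cexp cexp_real exp_double[symmetric])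
      also have "\<dots> = of_real ((L2_norm ?N W2)\<^sup>2)"
        unfolding L2_norm_square by (rule integral_complex_of_real)
      finally show ?thesis by (simp add: norm_power)
    qed
    also have "K1\<^sup>2 * (real m ^ ?n * norm (S m)) * (real m ^ ?n / real m ^ 4) \<le> K1\<^sup>2 * M * (1 / real m)"
    proof (intro mult_mono)
      show le: "real m ^ ?n * norm (S m) \<le> M"
        using M[of m] by (simp add: norm_mult norm_power)
      have "real m ^ ?n \<le> real m ^ 3" using dim m by (intro power_increasing) auto
      then have "real m ^ ?n / real m ^ 4 \<le> real m ^ 3 / real m ^ 4" by (intro divide_right_mono) auto
      also have "\<dots> = 1 / real m" using m by (simp add: numeral_eq_Suc)
      finally show "real m ^ ?n / real m ^ 4 \<le> 1 / real m" .
      have "0 \<le> real m ^ ?n * norm (S m)" by simp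
      then have "0 \<le> M" using le by linarith
      then show "0 \<le> K1\<^sup>2 * M" by simp
    qed auto
    finally show ?thesis .
  qed
  have "(\<lambda>m. (norm (T m))\<^sup>2) \<longlonglongrightarrow> 0"
  proof (rule tendsto_sandwich[OF _ _ tendsto_const])
    show "\<forall>\<^sub>F m in sequentially. (norm (T m))\<^sup>2 \<le> K1\<^sup>2 * M * (1 / real m)"
      using eventually_gt_at_top[of 0] by eventually_elim (rule bound)
    show "(\<lambda>m. K1\<^sup>2 * M * (1 / real m)) \<longlonglongrightarrow> 0"
      using tendsto_mult_right[OF lim_1_over_n, of "K1\<^sup>2 * M"] by simp
  qed simp
  then have "(\<lambda>m. sqrt ((norm (T m))\<^sup>2)) \<longlonglongrightarrow> sqrt 0" by (rule tendsto_real_sqrt)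
  then have "(\<lambda>m. norm (T m)) \<longlonglongrightarrow> 0" by simp
  then show ?thesis unfolding T_def by (rule tendsto_norm_zero_cancel)
qed

text \<open>The constant part of \<open>F\<close> gives the limit. The rest is dominated by \<open>|x - z|\<^sup>\<alpha>\<close> times a real exponential, to which
  the scaling limit applies with limiting value zero at the corner.\<close>

lemma leading_term_tendsto:
  assumes F: "square_integrable (lebesgue_on \<Omega>) F"
    and F0: "AE x in lebesgue_on \<Omega>. norm (F x - F0) \<le> C * norm (x - z) powr \<alpha>" and \<alpha>: "0 < \<alpha>"
  shows "(\<lambda>m. of_real (real m ^ DIM('a)) *
    (\<integral>x. F x * cexp (real m *\<^sub>R p) (real m *\<^sub>R q) (x - z) \<partial>lebesgue_on \<Omega>)) \<longlonglongrightarrow> F0 * laplace p q"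
proof -
  let ?N = "lebesgue_on \<Omega>" and ?n = "DIM('a)"
  let ?E = "\<lambda>m x. cexp (real m *\<^sub>R p) (real m *\<^sub>R q) (x - z)"
  have fin: "finite_measure ?N" by (intro finite_measure_lebesgue_on lmeasurable_open bounded_domain open_domain)
  obtain r where r: "\<And>x. x \<in> \<Omega> \<Longrightarrow> norm x \<le> r" using bounded_domain by (auto simp: bounded_iff)
  define G :: "'a \<Rightarrow> complex" where "G x = of_real (norm (x - z) powr \<alpha>)" for x
  have Gm: "G \<in> borel_measurable borel" unfolding G_def[abs_def] by measurable
  have GB: "norm (G x) \<le> (r + norm z) powr \<alpha>" if "x \<in> \<Omega>" for x
    using r[OF that] norm_triangle_ineq4[of x z] \<alpha> by (auto simp: G_def intro!: powr_mono2)
  have Glim: "(G \<longlongrightarrow> 0) (at z within \<Omega>)"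
  proof -
    have "((\<lambda>x. norm (x - z)) \<longlongrightarrow> norm (z - z)) (at z within \<Omega>)" by (intro tendsto_intros)
    then have "((\<lambda>x. norm (x - z) powr \<alpha>) \<longlongrightarrow> 0 powr \<alpha>) (at z within \<Omega>)"
      using \<alpha> by (intro tendsto_powr') auto
    then have "((\<lambda>x. of_real (norm (x - z) powr \<alpha>) :: complex) \<longlongrightarrow> of_real 0) (at z within \<Omega>)"
      by (intro tendsto_of_real) simp
    then show ?thesis by (simp add: G_def[abs_def])
  qed
  note E = square_integrable_cexp[OF open_domain bounded_domain]
  have c: "square_integrable ?N (\<lambda>x. F0)"
    by (rule square_integrable_bounded[OF fin, where K="norm F0"]) auto
  have Gi: "square_integrable ?N G"
    by (rule square_integrable_bounded[OF fin borel_measurable_lebesgue_on_borel[OF Gm]]) (use GB in auto)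
  have 1: "(\<lambda>m. of_real (real m ^ ?n) * (\<integral>x. 1 * ?E m x \<partial>?N)) \<longlonglongrightarrow> 1 * laplace p q"
    by (rule scaled_integral_tendsto[where B=1]) (auto intro: neg)
  have 2: "(\<lambda>m. of_real (real m ^ ?n) * (\<integral>x. G x * cexp (real m *\<^sub>R p) (real m *\<^sub>R 0) (x - z) \<partial>?N)) \<longlonglongrightarrow> 0 * laplace p 0"
    by (rule scaled_integral_tendsto[OF Gm GB Glim neg])
  have 3: "norm (\<integral>x. (F x - F0) * ?E m x \<partial>?N) \<le> C * norm (\<integral>x. G x * cexp (real m *\<^sub>R p) (real m *\<^sub>R 0) (x - z) \<partial>?N)" for m
  proof -
    let ?h = "\<lambda>x. norm (x - z) powr \<alpha> * exp ((real m *\<^sub>R p) \<bullet> (x - z))"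
    have eq: "G x * cexp (real m *\<^sub>R p) (real m *\<^sub>R 0) (x - z) = of_real (?h x)" for x
      by (simp add: G_def cexp_real)
    have hi: "integrable ?N ?h"
      using integrable_norm[OF square_integrable_mult_integrable[OF Gi E, of "real m *\<^sub>R p" "real m *\<^sub>R 0" z]]
      by (simp only: eq norm_of_real abs_of_nonneg[OF mult_nonneg_nonneg[OF powr_ge_zero exp_ge_zero]])
    have Fi: "integrable ?N (\<lambda>x. (F x - F0) * ?E m x)"
      by (intro square_integrable_mult_integrable square_integrable_diff(1) F c E)
    have "norm (\<integral>x. (F x - F0) * ?E m x \<partial>?N) \<le> (\<integral>x. norm ((F x - F0) * ?E m x) \<partial>?N)"
      by (rule integral_norm_bound)
    also have "\<dots> \<le> (\<integral>x. C * ?h x \<partial>?N)"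
    proof (rule integral_mono_AE)
      show "AE x in ?N. norm ((F x - F0) * ?E m x) \<le> C * ?h x"
        using F0 by eventually_elim (simp add: norm_mult norm_cexp mult_right_mono mult.assoc[symmetric])
    qed (use Fi hi in auto)
    also have "\<dots> = C * (\<integral>x. ?h x \<partial>?N)" by (rule integral_mult_right_zero)
    also have "(\<integral>x. ?h x \<partial>?N) = norm (\<integral>x. G x * cexp (real m *\<^sub>R p) (real m *\<^sub>R 0) (x - z) \<partial>?N)"
    proof -
      have "0 \<le> (\<integral>x. ?h x \<partial>?N)" by (intro Bochner_Integration.integral_nonneg) simp
      moreover have "(\<integral>x. G x * cexp (real m *\<^sub>R p) (real m *\<^sub>R 0) (x - z) \<partial>?N) = of_real (\<integral>x. ?h x \<partial>?N)"
        unfolding eq by (rule integral_complex_of_real)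
      ultimately show ?thesis by (simp only: norm_of_real abs_of_nonneg)
    qed
    finally show ?thesis .
  qed
  have "(\<lambda>m. of_real (real m ^ ?n) * (\<integral>x. (F x - F0) * ?E m x \<partial>?N)) \<longlonglongrightarrow> 0"
  proof (rule Lim_null_comparison)
    show "\<forall>\<^sub>F m in sequentially. norm (of_real (real m ^ ?n) * (\<integral>x. (F x - F0) * ?E m x \<partial>?N)) \<le>
        C * norm (of_real (real m ^ ?n) * (\<integral>x. G x * cexp (real m *\<^sub>R p) (real m *\<^sub>R 0) (x - z) \<partial>?N))"
    proof (rule always_eventually, rule allI)
      fix m
      show "norm (of_real (real m ^ ?n) * (\<integral>x. (F x - F0) * ?E m x \<partial>?N)) \<le>
        C * norm (of_real (real m ^ ?n) * (\<integral>x. G x * cexp (real m *\<^sub>R p) (real m *\<^sub>R 0) (x - z) \<partial>?N))"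
        using mult_left_mono[OF 3[of m], of "real m ^ ?n"]
        by (simp only: norm_mult norm_of_real) (simp add: mult_ac)
    qed
    show "(\<lambda>m. C * norm (of_real (real m ^ ?n) * (\<integral>x. G x * cexp (real m *\<^sub>R p) (real m *\<^sub>R 0) (x - z) \<partial>?N))) \<longlonglongrightarrow> 0"
      using tendsto_mult_right_zero[OF tendsto_norm_zero] 2 by simp
  qed
  moreover have "(\<lambda>m. F0 * (of_real (real m ^ ?n) * (\<integral>x. 1 * ?E m x \<partial>?N))) \<longlonglongrightarrow> F0 * (1 * laplace p q)"
    by (intro tendsto_mult 1 tendsto_const)
  ultimately have "(\<lambda>m. F0 * (of_real (real m ^ ?n) * (\<integral>x. 1 * ?E m x \<partial>?N)) +
      of_real (real m ^ ?n) * (\<integral>x. (F x - F0) * ?E m x \<partial>?N)) \<longlonglongrightarrow> F0 * (1 * laplace p q) + 0"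
    by (intro tendsto_add)
  moreover have "F0 * (of_real (real m ^ ?n) * (\<integral>x. 1 * ?E m x \<partial>?N)) +
      of_real (real m ^ ?n) * (\<integral>x. (F x - F0) * ?E m x \<partial>?N) = of_real (real m ^ ?n) * (\<integral>x. F x * ?E m x \<partial>?N)" for m
  proof -
    have "(\<integral>x. F x * ?E m x \<partial>?N) = (\<integral>x. F0 * ?E m x + (F x - F0) * ?E m x \<partial>?N)"
      by (simp add: algebra_simps)
    also have "\<dots> = (\<integral>x. F0 * ?E m x \<partial>?N) + (\<integral>x. (F x - F0) * ?E m x \<partial>?N)"
      by (intro Bochner_Integration.integral_add square_integrable_mult_integrable square_integrable_diff(1) F c E)
    also have "(\<integral>x. F0 * ?E m x \<partial>?N) = F0 * (\<integral>x. 1 * ?E m x \<partial>?N)" by simp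
    finally show ?thesis by (simp add: algebra_simps)
  qed
  ultimately show ?thesis by simp
qed

text \<open>Multiplied by \<open>m\<^sup>n\<close>, the two parts of the orthogonality relation tend to \<open>F0\<close> times the nonzero cone integral
  and to zero.\<close>

lemma vanishing_at_corner:
  assumes dim: "DIM('a) < 4" and u: "u \<in> sobolev_H0 2 \<Omega>"
    and b: "b \<in> borel_measurable (lebesgue_on \<Omega>)" "\<And>x. x \<in> \<Omega> \<Longrightarrow> norm (b x) \<le> B"
    and F: "square_integrable (lebesgue_on \<Omega>) F"
    and F0: "AE x in lebesgue_on \<Omega>. norm (F x - F0) \<le> C * norm (x - z) powr \<alpha>" "0 < \<alpha>"
    and eq: "\<And>\<eta>. test_function \<Omega> \<eta> \<Longrightarrow>
      (\<integral>x. u x * laplacian \<eta> x \<partial>lebesgue_on \<Omega>) + (\<integral>x. (b x * u x + F x) * \<eta> x \<partial>lebesgue_on \<Omega>) = 0"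
  shows "F0 = 0"
proof -
  let ?N = "lebesgue_on \<Omega>" and ?n = "DIM('a)"
  let ?E = "\<lambda>m x. cexp (real m *\<^sub>R p) (real m *\<^sub>R q) (x - z)"
  have bu: "square_integrable ?N (\<lambda>x. b x * u x)"
    using u by (intro square_integrable_mult_bounded[where K=B] b)
      (auto simp: sobolev_H0_def sobolev_H_def intro: b)
  note E = square_integrable_cexp[OF open_domain bounded_domain]
  have zero: "(\<integral>x. F x * ?E m x \<partial>?N) = - (\<integral>x. b x * u x * ?E m x \<partial>?N)" for m
  proof -
    have "(\<integral>x. (b x * u x + F x) * ?E m x \<partial>?N) = 0"
      using isotropic by (intro sobolev_H0_harmonic_orthogonality[OF open_domain bounded_domain u _ eq]
          square_integrable_add(1) bu F) auto
    moreover have "(\<integral>x. (b x * u x + F x) * ?E m x \<partial>?N) =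
        (\<integral>x. b x * u x * ?E m x \<partial>?N) + (\<integral>x. F x * ?E m x \<partial>?N)"
      unfolding distrib_right by (intro Bochner_Integration.integral_add square_integrable_mult_integrable bu F E)
    ultimately show ?thesis by (simp add: add_eq_0_iff)
  qed
  have "(\<lambda>m. - (of_real (real m ^ ?n) * (\<integral>x. b x * u x * ?E m x \<partial>?N))) \<longlonglongrightarrow> - 0"
    by (intro tendsto_minus remainder_tendsto_0[OF dim u b])
  moreover have "(\<lambda>m. of_real (real m ^ ?n) * (\<integral>x. F x * ?E m x \<partial>?N)) \<longlonglongrightarrow> F0 * laplace p q"
    by (rule leading_term_tendsto[OF F F0])
  ultimately have "F0 * laplace p q = 0"
    unfolding zero using LIMSEQ_unique by fastforce
  then show ?thesis using laplace_nonzero[OF neg] by simp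
qed

end

section \<open>Limits of Herglotz waves\<close>

lemma space_sphere_measure: "space sphere_measure = sphere 0 1"
  by (simp add: sphere_measure_def space_scale_measure space_restrict_space)

lemma sets_sphere_measure: "sets sphere_measure = sets (restrict_space borel (sphere 0 1))"
  by (simp add: sphere_measure_def)

lemma finite_measure_sphere: "finite_measure (sphere_measure :: 'a::euclidean_space measure)"
proof (rule finite_measureI)
  have "emeasure lborel {x \<in> ball 0 1 - {0::'a}. x /\<^sub>R norm x \<in> sphere 0 1} \<le> emeasure lborel (ball (0::'a) 1)"
    by (intro emeasure_mono) auto
  also have "\<dots> < \<infinity>" by (rule emeasure_lborel_ball_finite)
  finally show "emeasure (sphere_measure :: 'a measure) (space sphere_measure) \<noteq> \<infinity>"
    unfolding space_sphere_measure
    by (subst emeasure_sphere_measure) (auto simp: ennreal_mult_eq_top_iff)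
qed

lemma norm_exp_i_diff_le: "norm (exp (\<i> * of_real s) - exp (\<i> * of_real t)) \<le> \<bar>s - t\<bar>"
proof -
  have "exp (\<i> * of_real s) - exp (\<i> * of_real t) = exp (\<i> * of_real t) * (exp (\<i> * of_real (s - t)) - 1)"
    by (simp add: algebra_simps exp_add[symmetric])
  then have "norm (exp (\<i> * of_real s) - exp (\<i> * of_real t)) = 2 * \<bar>sin ((s - t) / 2)\<bar>"
    by (simp only: norm_mult norm_exp_i_times dist_exp_i_1 mult_1)
  also have "\<dots> \<le> 2 * \<bar>(s - t) / 2\<bar>"
    by (intro mult_left_mono abs_sin_x_le_abs_x) auto
  finally show ?thesis by simp
qed

text \<open>The sphere has finite measure, so square integrable kernels are integrable; and the plane wave of
  direction \<open>\<theta>\<close> has Lipschitz constant \<open>|k|\<close>.\<close>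

lemma herglotz_wave_bounds:
  fixes g :: "'a::euclidean_space \<Rightarrow> complex"
  assumes "square_integrable sphere_measure g"
  shows "norm (herglotz_wave k g x) \<le> (\<integral>\<theta>. norm (g \<theta>) \<partial>sphere_measure)"
    and "norm (herglotz_wave k g x - herglotz_wave k g y) \<le> \<bar>k\<bar> * norm (x - y) * (\<integral>\<theta>. norm (g \<theta>) \<partial>sphere_measure)"
proof -
  let ?S = "sphere_measure :: 'a measure"
  let ?e = "\<lambda>x \<theta>. exp (\<i> * of_real (k * (\<theta> \<bullet> x)))"
  have g: "integrable ?S g" by (rule square_integrable_integrable[OF finite_measure_sphere assms])
  have meas: "?e x \<in> borel_measurable ?S" for x
    by (subst measurable_cong_sets[OF sets_sphere_measure refl], rule measurable_restrict_space1) measurable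
  have int: "integrable ?S (\<lambda>\<theta>. ?e x \<theta> * g \<theta>)" for x
  proof (rule Bochner_Integration.integrable_bound[OF g])
    show "(\<lambda>\<theta>. ?e x \<theta> * g \<theta>) \<in> borel_measurable ?S"
      using meas[of x] g by (intro borel_measurable_times) auto
  qed (auto simp: norm_mult)
  show "norm (herglotz_wave k g x) \<le> (\<integral>\<theta>. norm (g \<theta>) \<partial>?S)"
    unfolding herglotz_wave_def
    by (rule order_trans[OF integral_norm_bound]) (simp add: norm_mult)
  have "herglotz_wave k g x - herglotz_wave k g y = (\<integral>\<theta>. ?e x \<theta> * g \<theta> - ?e y \<theta> * g \<theta> \<partial>?S)"
    unfolding herglotz_wave_def by (rule Bochner_Integration.integral_diff[OF int int, symmetric])
  also have "norm \<dots> \<le> (\<integral>\<theta>. norm (?e x \<theta> * g \<theta> - ?e y \<theta> * g \<theta>) \<partial>?S)"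
    by (rule integral_norm_bound)
  also have "\<dots> \<le> (\<integral>\<theta>. \<bar>k\<bar> * norm (x - y) * norm (g \<theta>) \<partial>?S)"
  proof (rule integral_mono)
    fix \<theta> :: 'a assume "\<theta> \<in> space ?S"
    then have \<theta>: "norm \<theta> = 1" by (simp add: space_sphere_measure)
    have "norm (?e x \<theta> - ?e y \<theta>) \<le> \<bar>k * (\<theta> \<bullet> x) - k * (\<theta> \<bullet> y)\<bar>" by (rule norm_exp_i_diff_le)
    also have "\<dots> = \<bar>k\<bar> * \<bar>\<theta> \<bullet> (x - y)\<bar>" by (simp add: inner_diff_right abs_mult[symmetric] algebra_simps)
    also have "\<dots> \<le> \<bar>k\<bar> * (norm \<theta> * norm (x - y))"
      by (intro mult_left_mono Cauchy_Schwarz_ineq2) auto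
    finally have "norm (?e x \<theta> - ?e y \<theta>) * norm (g \<theta>) \<le> \<bar>k\<bar> * norm (x - y) * norm (g \<theta>)"
      using \<theta> by (intro mult_right_mono) auto
    then show "norm (?e x \<theta> * g \<theta> - ?e y \<theta> * g \<theta>) \<le> \<bar>k\<bar> * norm (x - y) * norm (g \<theta>)"
      by (simp only: left_diff_distrib[symmetric] norm_mult)
  qed (use int g in auto)
  also have "\<dots> = \<bar>k\<bar> * norm (x - y) * (\<integral>\<theta>. norm (g \<theta>) \<partial>?S)" by (rule integral_mult_right_zero)
  finally show "norm (herglotz_wave k g x - herglotz_wave k g y) \<le> \<bar>k\<bar> * norm (x - y) * (\<integral>\<theta>. norm (g \<theta>) \<partial>?S)" .
qed

text \<open>Uniformly bounded kernels make the waves equibounded and equi-Lipschitz, and these properties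
  survive the limit: a subsequence converges at \<open>z\<close>, a further one almost everywhere.\<close>

lemma herglotz_limit_Lipschitz:
  fixes \<Omega> :: "'a::euclidean_space set"
  assumes \<Omega>: "open \<Omega>" "bounded \<Omega>"
    and v: "square_integrable (lebesgue_on \<Omega>) v"
    and g: "\<And>j. square_integrable sphere_measure (g j)"
    and lim: "(\<lambda>j. L2_norm (lebesgue_on \<Omega>) (\<lambda>x. v x - herglotz_wave k (g j) x)) \<longlonglongrightarrow> 0"
    and bdd: "bdd_above (range (\<lambda>j. L2_norm sphere_measure (g j)))"
  obtains c M where "0 \<le> M" "AE x in lebesgue_on \<Omega>. norm (v x - c) \<le> M * norm (x - z)"
proof -
  let ?N = "lebesgue_on \<Omega>" and ?S = "sphere_measure :: 'a measure"
  let ?H = "\<lambda>j. herglotz_wave k (g j)"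
  have fin: "finite_measure ?N" using \<Omega> by (intro finite_measure_lebesgue_on lmeasurable_open)
  have one: "square_integrable ?S (\<lambda>x. 1)"
    by (rule square_integrable_bounded[OF finite_measure_sphere, where K=1]) auto
  obtain G where G: "\<And>j. L2_norm ?S (g j) \<le> G" using bdd by (auto simp: bdd_above_def)
  define A where "A = L2_norm ?S (\<lambda>x. 1) * G"
  have A: "(\<integral>\<theta>. norm (g j \<theta>) \<partial>?S) \<le> A" for j
    using L2_norm_Cauchy_Schwarz[OF one g[of j]] mult_left_mono[OF G[of j] L2_norm_nonneg[of ?S "\<lambda>x. 1"]]
    by (simp add: A_def)
  have A0: "0 \<le> A"
    using order_trans[OF _ A[of 0]] by (simp add: Bochner_Integration.integral_nonneg)
  have H_le: "norm (?H j x) \<le> A" for j x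
    by (rule order_trans[OF herglotz_wave_bounds(1)[OF g] A])
  have H_Lip: "norm (?H j x - ?H j y) \<le> \<bar>k\<bar> * A * norm (x - y)" for j x y
    using order_trans[OF herglotz_wave_bounds(2)[OF g[of j]] mult_left_mono[OF A[of j], of "\<bar>k\<bar> * norm (x - y)"]]
    by (simp add: mult_ac)
  have H_meas: "?H j \<in> borel_measurable borel" for j
  proof (rule borel_measurable_continuous_onI)
    have "(\<bar>k\<bar> * A)-lipschitz_on UNIV (?H j)"
      using H_Lip A0 by (intro lipschitz_onI) (auto simp: dist_norm)
    then show "continuous_on UNIV (?H j)" by (rule lipschitz_on_continuous_on)
  qed
  have H2: "square_integrable ?N (?H j)" for j
    by (rule square_integrable_bounded[OF fin borel_measurable_lebesgue_on_borel[OF H_meas] H_le])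
  have "bounded (range (\<lambda>j. ?H j z))" using H_le by (auto simp: bounded_iff)
  then obtain c r where r: "strict_mono (r :: nat \<Rightarrow> nat)" "((\<lambda>j. ?H j z) \<circ> r) \<longlonglongrightarrow> c"
    using bounded_imp_convergent_subsequence by blast
  have "\<exists>s::nat\<Rightarrow>nat. strict_mono s \<and> (AE x in ?N. (\<lambda>n. (norm (v x - ?H (r (s n)) x))\<^sup>2) \<longlonglongrightarrow> 0)"
  proof (rule tendsto_L1_AE_subseq[where u="\<lambda>n x. (norm (v x - ?H (r n) x))\<^sup>2"])
    show "integrable ?N (\<lambda>x. (norm (v x - ?H (r n) x))\<^sup>2)" for n
      by (rule square_integrableD(2)[OF square_integrable_diff(1)[OF v H2]])
    have "(\<lambda>n. (L2_norm ?N (\<lambda>x. v x - ?H (r n) x))\<^sup>2) \<longlonglongrightarrow> 0\<^sup>2"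
      using LIMSEQ_subseq_LIMSEQ[OF lim r(1)] by (intro tendsto_power) (simp add: o_def)
    then show "(\<lambda>n. \<integral>x. norm ((norm (v x - ?H (r n) x))\<^sup>2) \<partial>?N) \<longlonglongrightarrow> 0"
      by (simp add: L2_norm_square)
  qed
  then obtain s where s: "strict_mono (s :: nat \<Rightarrow> nat)"
    "AE x in ?N. (\<lambda>n. (norm (v x - ?H (r (s n)) x))\<^sup>2) \<longlonglongrightarrow> 0" by blast
  have c: "(\<lambda>n. ?H (r (s n)) z) \<longlonglongrightarrow> c"
    using LIMSEQ_subseq_LIMSEQ[OF r(2) s(1)] by (simp add: o_def)
  have "AE x in ?N. norm (v x - c) \<le> \<bar>k\<bar> * A * norm (x - z)"
    using s(2)
  proof eventually_elim
    case (elim x)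
    have "(\<lambda>n. sqrt ((norm (v x - ?H (r (s n)) x))\<^sup>2)) \<longlonglongrightarrow> sqrt 0" by (rule tendsto_real_sqrt[OF elim])
    then have "(\<lambda>n. norm (v x - ?H (r (s n)) x)) \<longlonglongrightarrow> 0" by simp
    then have "(\<lambda>n. v x - ?H (r (s n)) x) \<longlonglongrightarrow> 0" by (rule tendsto_norm_zero_cancel)
    then have "(\<lambda>n. v x - (v x - ?H (r (s n)) x) - ?H (r (s n)) z) \<longlonglongrightarrow> v x - 0 - c"
      by (intro tendsto_diff tendsto_const c)
    then have "(\<lambda>n. norm (?H (r (s n)) x - ?H (r (s n)) z)) \<longlonglongrightarrow> norm (v x - c)"
      by (intro tendsto_norm) simp
    then show ?case by (rule LIMSEQ_le_const2) (use H_Lip in auto)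
  qed
  then show ?thesis using A0 by (intro that[of "\<bar>k\<bar> * A" c]) auto
qed

section \<open>Corners of polygons and cuboids\<close>

lemma eventually_in_open_convex:
  fixes \<Omega> :: "'a::euclidean_space set"
  assumes "convex \<Omega>" "open \<Omega>" "z \<in> closure \<Omega>" "0 < t0" "z + t0 *\<^sub>R y \<in> \<Omega>"
  shows "\<forall>\<^sub>F t in at_right 0. z + t *\<^sub>R y \<in> \<Omega>"
  unfolding eventually_at_right_field
proof (intro exI[of _ t0] conjI allI impI)
  fix t assume t: "0 < t" "t < t0"
  have "z - (t / t0) *\<^sub>R (z - (z + t0 *\<^sub>R y)) \<in> interior \<Omega>"
    by (rule mem_interior_closure_convex_shrink[OF assms(1) _ assms(3)])
      (use assms(2,4,5) t in \<open>auto simp: interior_open\<close>)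
  moreover have "z - (t / t0) *\<^sub>R (z - (z + t0 *\<^sub>R y)) = z + t *\<^sub>R y"
    using t assms(4) by (simp add: algebra_simps)
  ultimately show "z + t *\<^sub>R y \<in> \<Omega>" by (simp only: interior_open[OF assms(2)])
qed (rule assms)

text \<open>At a vertex of a polygon there is a supporting line meeting the polygon only there. In
  coordinates \<open>d\<cdot>y\<close>, \<open>e\<cdot>y\<close> along and across its inner normal the polygon is seen from the vertex under
  a bounded interval of slopes, whose end points span the cone.\<close>

lemma polygon_corner:
  fixes \<Omega> :: "(real ^ 'n) set"
  assumes card: "CARD('n) = 2" and poly: "open_convex_polytope \<Omega>" and z: "z \<in> vertices \<Omega>"
  shows "\<exists>(l :: 'n \<Rightarrow> real ^ 'n) a p q. corner l a p q \<Omega> z"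
proof -
  obtain P where P: "polytope P" "\<Omega> = interior P" "\<Omega> \<noteq> {}"
    using poly by (auto simp: open_convex_polytope_def)
  have conv: "convex P" "closed P" "bounded P"
    using P(1) by (auto simp: polytope_imp_convex polytope_imp_closed polytope_imp_bounded)
  have closure: "closure \<Omega> = P"
    using convex_closure_interior[OF conv(1)] P conv(2) by simp
  have zP: "z extreme_point_of P" using z closure by (simp add: vertices_def)
  then have "{z} exposed_face_of P"
    using exposed_face_of_polyhedron[OF polytope_imp_polyhedron[OF P(1)]] by (simp add: face_of_singleton)
  then obtain d' b where d': "P \<subseteq> {x. d' \<bullet> x \<le> b}" "{z} = P \<inter> {x. d' \<bullet> x = b}"
    by (auto simp: exposed_face_of_def)
  define d where "d = - d'"
  have zb: "z \<in> P" "d' \<bullet> z = b" using d'(2) by auto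
  have d_pos: "0 < d \<bullet> (x - z)" if "x \<in> P" "x \<noteq> z" for x
  proof -
    have "d' \<bullet> x \<le> b" "d' \<bullet> x \<noteq> b" using d' that by auto
    then show ?thesis using zb by (simp add: d_def inner_diff_right)
  qed
  have open\<Omega>: "open \<Omega>" using P(2) by simp
  have conv\<Omega>: "convex \<Omega>" using P(2) conv(1) by (simp add: convex_interior)
  have sub: "\<Omega> \<subseteq> P" using P(2) interior_subset by auto
  have push: "\<exists>\<eta>>0. x + \<eta> *\<^sub>R y \<in> \<Omega>" if "x \<in> \<Omega>" for x y
  proof -
    have "((\<lambda>\<eta>. x + \<eta> *\<^sub>R y) \<longlongrightarrow> x + 0 *\<^sub>R y) (at_right 0)" by (intro tendsto_intros)
    from topological_tendstoD[OF this open\<Omega>] that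
    obtain r where "0 < r" "\<And>\<eta>. 0 < \<eta> \<Longrightarrow> \<eta> < r \<Longrightarrow> x + \<eta> *\<^sub>R y \<in> \<Omega>"
      by (auto simp: eventually_at_right_field)
    then show ?thesis by (intro exI[of _ "r / 2"]) auto
  qed
  have "\<Omega> \<noteq> {z}" using open\<Omega> not_open_singleton[of z] by blast
  then obtain x0 where x0: "x0 \<in> \<Omega>" "x0 \<noteq> z" using P(3) by blast
  define N where "N = d \<bullet> d"
  have "d \<noteq> 0" using d_pos[of x0] x0 sub by auto
  then have N: "0 < N" by (simp add: N_def)
  have D_pos: "0 < d \<bullet> (x - z)" if x: "x \<in> \<Omega>" for x
  proof (rule d_pos)
    show "x \<noteq> z"
    proof
      assume "x = z"
      obtain \<eta> where \<eta>: "0 < \<eta>" "x + \<eta> *\<^sub>R (- d) \<in> \<Omega>" using push[OF x] by blast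
      have "0 < d \<bullet> (x + \<eta> *\<^sub>R (- d) - z)"
        using \<eta> \<open>x = z\<close> \<open>d \<noteq> 0\<close> sub by (intro d_pos) auto
      then show False using \<eta> N \<open>x = z\<close> by (simp add: N_def mult_less_0_iff) (metis inner_ge_zero not_less)
    qed
  qed (use x sub in auto)
  obtain i j where ij: "(UNIV :: 'n set) = {i, j}" "i \<noteq> j"
    using card by (auto simp: card_2_iff)
  have inner2: "x \<bullet> y = x $ i * y $ i + x $ j * y $ j" for x y :: "real ^ 'n"
    unfolding inner_vec_def ij(1) using ij(2) by simp
  \<comment> \<open>The inner normal \<open>d\<close> turned by a right angle.\<close>
  define e :: "real ^ 'n" where "e = (\<chi> m. if m = i then - d $ j else d $ i)"
  have e: "e $ i = - d $ j" "e $ j = d $ i" using ij(2) by (auto simp: e_def)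
  have ee: "e \<bullet> e = N" "d \<bullet> e = 0" "e \<bullet> d = 0" by (auto simp: inner2 e N_def)
  have coords: "((d \<bullet> y) / N) *\<^sub>R d + ((e \<bullet> y) / N) *\<^sub>R e = y" for y
  proof -
    have "(d \<bullet> y) *\<^sub>R d + (e \<bullet> y) *\<^sub>R e = N *\<^sub>R y"
      unfolding vec_eq_iff
    proof
      fix m
      have "m = i \<or> m = j" using ij(1) by auto
      then show "((d \<bullet> y) *\<^sub>R d + (e \<bullet> y) *\<^sub>R e) $ m = (N *\<^sub>R y) $ m"
        by (auto simp: inner2 e N_def algebra_simps)
    qed
    then have "(1 / N) *\<^sub>R ((d \<bullet> y) *\<^sub>R d + (e \<bullet> y) *\<^sub>R e) = (1 / N) *\<^sub>R (N *\<^sub>R y)" by simp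
    then show ?thesis using N by (simp add: scaleR_add_right)
  qed
  define slope where "slope x = (e \<bullet> (x - z)) / (d \<bullet> (x - z))" for x
  \<comment> \<open>Slopes are bounded: the claim is convex in \<open>x\<close> and holds at the finitely many vertices.\<close>
  have "\<exists>K. \<forall>x\<in>P. \<bar>e \<bullet> (x - z)\<bar> \<le> K * (d \<bullet> (x - z))"
  proof -
    obtain W where W: "finite W" "P = convex hull W" using P(1) by (auto simp: polytope_def)
    define K where "K = (\<Sum>w\<in>W. \<bar>e \<bullet> (w - z)\<bar> / (d \<bullet> (w - z)))"
    let ?H = "{x. (e - K *\<^sub>R d) \<bullet> x \<le> (e - K *\<^sub>R d) \<bullet> z} \<inter> {x. (- e - K *\<^sub>R d) \<bullet> x \<le> (- e - K *\<^sub>R d) \<bullet> z}"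
    have H: "x \<in> ?H \<longleftrightarrow> \<bar>e \<bullet> (x - z)\<bar> \<le> K * (d \<bullet> (x - z))" for x
      by (auto simp: abs_le_iff inner_diff_left inner_diff_right inner_minus_left algebra_simps)
    have WP: "W \<subseteq> P" using W(2) hull_subset by metis
    have nonneg: "0 \<le> \<bar>e \<bullet> (w - z)\<bar> / (d \<bullet> (w - z))" if "w \<in> W" for w
      using d_pos[of w] that WP by (cases "w = z") (auto intro!: divide_nonneg_pos)
    have "W \<subseteq> ?H"
    proof
      fix w assume w: "w \<in> W"
      have "\<bar>e \<bullet> (w - z)\<bar> \<le> K * (d \<bullet> (w - z))"
      proof (cases "w = z")
        case False
        then have pos: "0 < d \<bullet> (w - z)" using d_pos w WP by auto
        have "\<bar>e \<bullet> (w - z)\<bar> / (d \<bullet> (w - z)) \<le> K"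
          unfolding K_def using w W(1) nonneg by (intro member_le_sum) auto
        then show ?thesis using pos by (simp add: pos_divide_le_eq)
      qed simp
      then show "w \<in> ?H" using H by blast
    qed
    then have "P \<subseteq> ?H" unfolding W(2) by (intro hull_minimal convex_Int convex_halfspace_le)
    then show ?thesis using H by blast
  qed
  then obtain K where K: "\<And>x. x \<in> P \<Longrightarrow> \<bar>e \<bullet> (x - z)\<bar> \<le> K * (d \<bullet> (x - z))" by blast
  have slope_le: "\<bar>slope x\<bar> \<le> K" if "x \<in> \<Omega>" for x
    using K[of x] D_pos[OF that] that sub by (auto simp: slope_def abs_divide pos_divide_le_eq)
  define \<alpha> where "\<alpha> = Inf (slope ` \<Omega>)"
  define \<beta> where "\<beta> = Sup (slope ` \<Omega>)"
  have bdd: "bdd_above (slope ` \<Omega>)" "bdd_below (slope ` \<Omega>)"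
  proof -
    show "bdd_above (slope ` \<Omega>)" using slope_le by (intro bdd_aboveI[of _ K]) (auto simp: abs_le_iff)
    show "bdd_below (slope ` \<Omega>)" using slope_le by (intro bdd_belowI[of _ "- K"]) (auto simp: abs_le_iff minus_le_iff)
  qed
  \<comment> \<open>The extreme slopes are not attained, because \<open>\<Omega>\<close> is open.\<close>
  have strict: "\<alpha> < slope x" "slope x < \<beta>" if x: "x \<in> \<Omega>" for x
  proof -
    obtain \<eta> where \<eta>: "0 < \<eta>" "x + \<eta> *\<^sub>R e \<in> \<Omega>" using push[OF x] by blast
    have "slope (x + \<eta> *\<^sub>R e) = slope x + \<eta> * N / (d \<bullet> (x - z))"
      by (simp add: slope_def inner_diff_right inner_add_right ee add_divide_distrib[symmetric] algebra_simps)
    then have "slope x < slope (x + \<eta> *\<^sub>R e)" using \<eta>(1) N D_pos[OF x] by simp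
    also have "\<dots> \<le> \<beta>" unfolding \<beta>_def using \<eta>(2) bdd by (intro cSup_upper) auto
    finally show "slope x < \<beta>" .
    obtain \<eta> where \<eta>: "0 < \<eta>" "x + \<eta> *\<^sub>R (- e) \<in> \<Omega>" using push[OF x] by blast
    have "\<alpha> \<le> slope (x + \<eta> *\<^sub>R (- e))" unfolding \<alpha>_def using \<eta>(2) bdd by (intro cInf_lower) auto
    also have "slope (x + \<eta> *\<^sub>R (- e)) = slope x - \<eta> * N / (d \<bullet> (x - z))"
      by (simp add: slope_def inner_diff_right inner_add_right ee diff_divide_distrib[symmetric] algebra_simps)
    also have "\<dots> < slope x" using \<eta>(1) N D_pos[OF x] by simp
    finally show "\<alpha> < slope x" .
  qed
  have \<alpha>\<beta>: "0 < \<beta> - \<alpha>" using strict[OF x0(1)] by simp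
  \<comment> \<open>The edges \<open>a\<close> have slopes \<open>\<alpha>\<close> and \<open>\<beta>\<close>; \<open>l\<close> is the dual basis.\<close>
  define l where "l m = (1 / (N * (\<beta> - \<alpha>))) *\<^sub>R (if m = i then \<beta> *\<^sub>R d - e else e - \<alpha> *\<^sub>R d)" for m
  define a where "a m = (if m = i then d + \<alpha> *\<^sub>R e else d + \<beta> *\<^sub>R e)" for m
  have l_inner: "l i \<bullet> y = (\<beta> * (d \<bullet> y) - e \<bullet> y) / (N * (\<beta> - \<alpha>))" "l j \<bullet> y = (e \<bullet> y - \<alpha> * (d \<bullet> y)) / (N * (\<beta> - \<alpha>))" for y
    using ij(2) by (auto simp: l_def inner_diff_left)
  have ij_cases: "m = i \<or> m = j" for m using ij(1) by auto
  have a_inner: "d \<bullet> a i = N" "d \<bullet> a j = N" "e \<bullet> a i = \<alpha> * N" "e \<bullet> a j = \<beta> * N"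
    using ij(2) by (auto simp: a_def inner_add_right ee N_def)
  have unit: "(\<beta> * N - \<alpha> * N) / (N * (\<beta> - \<alpha>)) = 1"
    unfolding left_diff_distrib[symmetric] using N \<alpha>\<beta> by simp
  have "dual_basis l a"
  proof
    fix m m'
    show "l m \<bullet> a m' = (if m = m' then 1 else 0)"
      using ij_cases[of m] ij_cases[of m'] ij(2) by (auto simp: l_inner a_inner unit)
  next
    fix y
    define s where "s = l i \<bullet> y"
    define t where "t = l j \<bullet> y"
    have "s + t = ((\<beta> - \<alpha>) * (d \<bullet> y)) / ((\<beta> - \<alpha>) * N)"
      unfolding s_def t_def l_inner add_divide_distrib[symmetric] by (simp add: algebra_simps)
    then have st: "s + t = (d \<bullet> y) / N" using \<alpha>\<beta> by simp
    have "s * \<alpha> + t * \<beta> = ((\<beta> - \<alpha>) * (e \<bullet> y)) / ((\<beta> - \<alpha>) * N)"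
      unfolding s_def t_def l_inner times_divide_eq_left add_divide_distrib[symmetric] by (simp add: algebra_simps)
    then have st': "s * \<alpha> + t * \<beta> = (e \<bullet> y) / N" using \<alpha>\<beta> by simp
    have "(\<Sum>m\<in>UNIV. (l m \<bullet> y) *\<^sub>R a m) = s *\<^sub>R (d + \<alpha> *\<^sub>R e) + t *\<^sub>R (d + \<beta> *\<^sub>R e)"
      unfolding ij(1) using ij(2) by (simp add: a_def s_def t_def)
    also have "\<dots> = (s + t) *\<^sub>R d + (s * \<alpha> + t * \<beta>) *\<^sub>R e" by (simp add: algebra_simps)
    also have "\<dots> = y" unfolding st st' by (rule coords)
    finally show "(\<Sum>m\<in>UNIV. (l m \<bullet> y) *\<^sub>R a m) = y" .
  qed
  then interpret dual_basis l a .
  have cone_iff: "y \<in> simplicial_cone \<longleftrightarrow> \<alpha> * (d \<bullet> y) < e \<bullet> y \<and> e \<bullet> y < \<beta> * (d \<bullet> y)" for y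
  proof -
    have "y \<in> simplicial_cone \<longleftrightarrow> 0 < l i \<bullet> y \<and> 0 < l j \<bullet> y"
      unfolding simplicial_cone_def mem_Collect_eq using ij_cases by metis
    moreover have "0 < x / (N * (\<beta> - \<alpha>)) \<longleftrightarrow> 0 < x" for x
      using mult_pos_pos[OF N \<alpha>\<beta>] by (simp add: zero_less_divide_iff less_not_sym)
    ultimately show ?thesis unfolding l_inner by auto
  qed
  have "corner l a (- d) e \<Omega> z"
  proof (intro corner.intro corner_axioms.intro \<open>dual_basis l a\<close>)
    show "- d \<bullet> a m < 0" for m
      using N by (auto simp: a_def inner_add_right ee N_def[symmetric])
    show "- d \<bullet> - d = e \<bullet> e" "- d \<bullet> e = 0" by (simp_all add: ee N_def)
    show "open \<Omega>" "bounded \<Omega>" using open\<Omega> bounded_subset[OF conv(3) sub] by auto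
    show "x - z \<in> simplicial_cone" if "x \<in> \<Omega>" for x
      using strict[OF that] D_pos[OF that]
      by (simp add: cone_iff slope_def pos_less_divide_eq pos_divide_less_eq)
    show "\<forall>\<^sub>F t in at_right 0. z + t *\<^sub>R y \<in> \<Omega>" if y: "y \<in> simplicial_cone" for y
    proof -
      have y': "\<alpha> * (d \<bullet> y) < e \<bullet> y" "e \<bullet> y < \<beta> * (d \<bullet> y)" using y by (auto simp: cone_iff)
      then have "0 < (\<beta> - \<alpha>) * (d \<bullet> y)" by (simp add: left_diff_distrib)
      then have dy: "0 < d \<bullet> y" using \<alpha>\<beta> by (simp add: zero_less_mult_iff)
      define s where "s = (e \<bullet> y) / (d \<bullet> y)"
      have s: "\<alpha> < s" "s < \<beta>" using y' dy by (auto simp: s_def pos_less_divide_eq pos_divide_less_eq)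
      \<comment> \<open>By connectedness some point of \<open>\<Omega>\<close> has the slope of \<open>y\<close>, hence lies on the ray through \<open>z + y\<close>.\<close>
      obtain x1 where x1: "x1 \<in> \<Omega>" "slope x1 < s"
        using s(1) bdd P(3) unfolding \<alpha>_def by (auto simp: cInf_less_iff)
      obtain x2 where x2: "x2 \<in> \<Omega>" "s < slope x2"
        using s(2) bdd P(3) unfolding \<beta>_def by (auto simp: less_cSup_iff)
      have "continuous_on \<Omega> slope" unfolding slope_def[abs_def]
        using D_pos by (intro continuous_intros) force
      then have "connected (slope ` \<Omega>)"
        using conv\<Omega> by (intro connected_continuous_image convex_connected)
      then have "s \<in> slope ` \<Omega>"
        by (rule connectedD_interval[of _ "slope x1" "slope x2"]) (use x1 x2 in auto)
      then obtain x where x: "x \<in> \<Omega>" "slope x = s" by auto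
      define t0 where "t0 = (d \<bullet> (x - z)) / (d \<bullet> y)"
      have t0: "0 < t0" using D_pos[OF x(1)] dy by (simp add: t0_def)
      have 1: "d \<bullet> (t0 *\<^sub>R y) = d \<bullet> (x - z)" using dy by (simp add: t0_def)
      have 2: "e \<bullet> (t0 *\<^sub>R y) = e \<bullet> (x - z)"
        using x(2) dy D_pos[OF x(1)] by (simp add: t0_def s_def slope_def field_simps)
      have "t0 *\<^sub>R y = x - z"
        by (rule trans[OF coords[of "t0 *\<^sub>R y", symmetric, unfolded 1 2] coords])
      then have "z + t0 *\<^sub>R y \<in> \<Omega>" using x(1) by simp
      then show ?thesis
        using eventually_in_open_convex[OF conv\<Omega> open\<Omega> _ t0] zb(1) closure by auto
    qed
  qed
  then show ?thesis by blast
qed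

text \<open>In terms of the orthonormal edge directions at the vertex one needs three complex numbers with negative
  real parts whose squares add up to zero. The cube roots of unity have sum zero, and they are the squares
  of \<open>- 1\<close> and \<open>- e\<^bsup>\<plusminus>\<pi>i/3\<^esup>\<close>.\<close>

lemma cuboid_corner:
  fixes \<Omega> :: "(real ^ 'n) set"
  assumes card: "CARD('n) = 3" and cub: "open_cuboid \<Omega>" and z: "z \<in> vertices \<Omega>"
  shows "\<exists>(l :: 'n \<Rightarrow> real ^ 'n) a p q. corner l a p q \<Omega> z"
proof -
  obtain T :: "real ^ 'n \<Rightarrow> real ^ 'n" and u w where T: "orthogonal_transformation T" "\<Omega> = T ` box u w" "\<Omega> \<noteq> {}"
    using cub by (auto simp: open_cuboid_def)
  have lin: "linear T" using T(1) by (rule orthogonal_transformation_linear)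
  have inj: "inj T" using T(1) by (rule orthogonal_transformation_inj)
  have surj: "surj T" using T(1) by (rule orthogonal_transformation_surj)
  have ne: "box u w \<noteq> {}" using T by auto
  then have uw: "u $ i < w $ i" for i by (auto simp: box_ne_empty Basis_vec_def inner_axis)
  have "closure \<Omega> = T ` cbox u w"
    using closure_injective_linear_image[OF lin inj, of "box u w"] closure_box[OF ne] T(2) by simp
  then have "z extreme_point_of (T ` cbox u w)" using z by (simp add: vertices_def)
  moreover from this obtain \<zeta> where "z = T \<zeta>" by (auto simp: extreme_point_of_def)
  ultimately have \<zeta>: "z = T \<zeta>" "\<zeta> extreme_point_of (cbox u w)"
    using face_of_linear_image[OF lin inj, of "{\<zeta>}" "cbox u w"] by (simp_all add: face_of_singleton)
  have end_point: "\<zeta> $ i = u $ i \<or> \<zeta> $ i = w $ i" for i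
  proof (rule ccontr)
    assume not: "\<not> (\<zeta> $ i = u $ i \<or> \<zeta> $ i = w $ i)"
    have in_box: "\<zeta> \<in> cbox u w" using \<zeta>(2) by (simp add: extreme_point_of_def)
    then have \<zeta>i: "u $ i < \<zeta> $ i" "\<zeta> $ i < w $ i"
      using not by (auto simp: mem_box_cart less_le)
    define r where "r = min (\<zeta> $ i - u $ i) (w $ i - \<zeta> $ i)"
    have r: "0 < r" "r \<le> \<zeta> $ i - u $ i" "r \<le> w $ i - \<zeta> $ i" using \<zeta>i by (auto simp: r_def)
    let ?a = "\<zeta> - r *\<^sub>R axis i 1" and ?b = "\<zeta> + r *\<^sub>R axis i 1"
    have "?a \<in> cbox u w" "?b \<in> cbox u w"
      using in_box r by (auto simp: mem_box_cart axis_def)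
    moreover have "\<zeta> \<in> open_segment ?a ?b"
    proof -
      have "?a \<noteq> ?b"
      proof
        assume "?a = ?b"
        then have "?a $ i = ?b $ i" by (rule arg_cong[where f="\<lambda>v. v $ i"])
        then show False using r by (simp add: axis_def)
      qed
      moreover have "\<zeta> = (1 - 1 / 2) *\<^sub>R ?a + (1 / 2) *\<^sub>R ?b"
        unfolding vec_eq_iff by (simp add: field_simps)
      ultimately show ?thesis unfolding in_segment by (intro conjI exI[of _ "1 / 2"]) auto
    qed
    ultimately show False using \<zeta>(2) by (auto simp: extreme_point_of_def)
  qed
  \<comment> \<open>The signs point from the vertex into the cuboid.\<close>
  define \<epsilon> :: "'n \<Rightarrow> real" where "\<epsilon> i = (if \<zeta> $ i = u $ i then 1 else - 1)" for i
  have \<epsilon>: "\<epsilon> i * \<epsilon> i = 1" for i by (simp add: \<epsilon>_def)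
  define l where "l i = \<epsilon> i *\<^sub>R T (axis i 1)" for i
  have T_inner: "T x \<bullet> T y = x \<bullet> y" for x y using T(1) by (simp add: orthogonal_transformation_def)
  have l_T: "l i \<bullet> T y = \<epsilon> i * y $ i" for i y
    by (simp add: l_def T_inner inner_axis' )
  have dual: "l i \<bullet> l j = (if i = j then 1 else 0)" for i j
    by (simp add: l_def T_inner inner_axis_axis \<epsilon>)
  have "dual_basis l l"
  proof
    show "l i \<bullet> l j = (if i = j then 1 else 0)" for i j by (rule dual)
    fix y
    obtain x where x: "y = T x" using surj by blast
    have "(\<Sum>i\<in>UNIV. (l i \<bullet> y) *\<^sub>R l i) = (\<Sum>i\<in>UNIV. (x $ i) *\<^sub>R T (axis i 1))"
      unfolding x l_T by (rule sum.cong) (auto simp: l_def mult.commute mult.left_commute \<epsilon> mult.assoc[symmetric])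
    also have "\<dots> = T (\<Sum>i\<in>UNIV. (x $ i) *\<^sub>R axis i 1)"
      by (simp add: linear_sum[OF lin] linear_scale[OF lin])
    also have "(\<Sum>i\<in>UNIV. (x $ i) *\<^sub>R axis i 1) = x"
      using basis_expansion[of x] by (simp add: scalar_mult_eq_scaleR)
    finally show "(\<Sum>i\<in>UNIV. (l i \<bullet> y) *\<^sub>R l i) = y" by (simp add: x)
  qed
  then interpret dual_basis l l .
  obtain i j k where ijk: "(UNIV :: 'n set) = {i, j, k}" "i \<noteq> j" "j \<noteq> k" "i \<noteq> k"
    using card by (auto simp: card_3_iff)
  define p where "p = - (l i + (1 / 2) *\<^sub>R l j + (1 / 2) *\<^sub>R l k)"
  define q where "q = (sqrt 3 / 2) *\<^sub>R l k - (sqrt 3 / 2) *\<^sub>R l j"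
  have "corner l l p q \<Omega> z"
  proof (intro corner.intro corner_axioms.intro \<open>dual_basis l l\<close>)
    show "p \<bullet> l m < 0" for m
    proof -
      have "m \<in> {i, j, k}" using ijk(1) by blast
      then show ?thesis using ijk(2-4) by (auto simp: p_def inner_add_left inner_diff_left dual)
    qed
    show "p \<bullet> p = q \<bullet> q" "p \<bullet> q = 0"
      using ijk(2-4) by (auto simp: p_def q_def inner_add_left inner_add_right inner_diff_left inner_diff_right dual)
    have opn: "open (box u w)" by (rule open_box)
    show "open \<Omega>" unfolding T(2) by (rule open_surjective_linear_image[OF opn lin surj])
    show "bounded \<Omega>" unfolding T(2) by (rule bounded_linear_image[OF bounded_box linear_conv_bounded_linear[THEN iffD1, OF lin]])
    show "x - z \<in> simplicial_cone" if x: "x \<in> \<Omega>" for x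
    proof -
      obtain y where y: "x = T y" "y \<in> box u w" using x T(2) by auto
      have "0 < \<epsilon> m * (y - \<zeta>) $ m" for m
        using y(2) end_point[of m] by (auto simp: \<epsilon>_def mem_box_cart)
      then show ?thesis
        by (simp add: simplicial_cone_def y(1) \<zeta>(1) linear_diff[OF lin, symmetric] l_T)
    qed
    show "\<forall>\<^sub>F t in at_right 0. z + t *\<^sub>R y \<in> \<Omega>" if y: "y \<in> simplicial_cone" for y
    proof -
      obtain x where x: "y = T x" using surj by blast
      have pos: "0 < \<epsilon> m * x $ m" for m using y by (simp add: simplicial_cone_def x l_T)
      have ev: "\<forall>\<^sub>F t in at_right 0. u $ m < \<zeta> $ m + t * x $ m \<and> \<zeta> $ m + t * x $ m < w $ m" for m
      proof -
        have lim: "((\<lambda>t. \<zeta> $ m + t * x $ m) \<longlongrightarrow> \<zeta> $ m + 0 * x $ m) (at_right 0)"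
          by (intro tendsto_intros)
        have t_pos: "\<forall>\<^sub>F t in at_right (0::real). 0 < t" by (simp add: eventually_at_filter)
        show ?thesis
        proof (cases "\<zeta> $ m = u $ m")
          case True
          then have "\<forall>\<^sub>F t in at_right 0. \<zeta> $ m + t * x $ m < w $ m"
            using uw[of m] by (intro order_tendstoD(2)[OF lim]) simp
          with t_pos show ?thesis
            by eventually_elim (use pos[of m] True in \<open>auto simp: \<epsilon>_def\<close>)
        next
          case False
          then have w: "\<zeta> $ m = w $ m" using end_point by auto
          then have "\<forall>\<^sub>F t in at_right 0. u $ m < \<zeta> $ m + t * x $ m"
            using uw[of m] by (intro order_tendstoD(1)[OF lim]) simp
          with t_pos show ?thesis
            by eventually_elim (use pos[of m] False w in \<open>auto simp: \<epsilon>_def mult_less_0_iff mult_pos_neg\<close>)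
        qed
      qed
      have "\<forall>\<^sub>F t in at_right 0. \<forall>m. u $ m < \<zeta> $ m + t * x $ m \<and> \<zeta> $ m + t * x $ m < w $ m"
        by (rule eventually_all_finite) (rule ev)
      then show ?thesis
      proof eventually_elim
        case (elim t)
        then have "\<zeta> + t *\<^sub>R x \<in> box u w" by (simp add: mem_box_cart)
        moreover have "z + t *\<^sub>R y = T (\<zeta> + t *\<^sub>R x)"
          by (simp add: \<zeta>(1) x linear_add[OF lin] linear_scale[OF lin])
        ultimately show ?case using T(2) by auto
      qed
    qed
  qed
  then show ?thesis by blast
qed

section \<open>Vanishing of transmission eigenfunctions\<close>

text \<open>The difference of the two equations, with \<open>c = k\<^sup>2\<close> and \<open>b = k\<^sup>2(1 + V)\<close> in the application: then the
  inhomogeneity \<open>(b - c) v\<close> is \<open>k\<^sup>2 V v\<close>.\<close>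

lemma transmission_difference_equation:
  assumes w: "square_integrable (lebesgue_on \<Omega>) w" and v: "square_integrable (lebesgue_on \<Omega>) v"
    and b: "b \<in> borel_measurable (lebesgue_on \<Omega>)" "\<And>x. x \<in> \<Omega> \<Longrightarrow> norm (b x) \<le> B"
    and \<Omega>: "\<Omega> \<in> sets lebesgue"
    and eqv: "helmholtz_distr \<Omega> (\<lambda>x. c) v" and eqw: "helmholtz_distr \<Omega> b w"
    and \<eta>: "test_function \<Omega> \<eta>"
  shows "(\<integral>x. (w x - v x) * laplacian \<eta> x \<partial>lebesgue_on \<Omega>) +
    (\<integral>x. (b x * (w x - v x) + (b x - c) * v x) * \<eta> x \<partial>lebesgue_on \<Omega>) = 0"
proof -
  let ?N = "lebesgue_on \<Omega>"
  have \<eta>i: "square_integrable ?N \<eta>" by (rule square_integrable_test[OF \<eta> \<Omega>])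
  have L: "square_integrable ?N (laplacian \<eta>)"
  proof -
    have "square_integrable ?N (\<lambda>x. \<Sum>i\<in>Basis. iter_deriv [i, i] \<eta> x)"
      by (rule square_integrable_sum[OF finite_Basis])
        (rule square_integrable_test[OF test_function_iter_deriv[OF \<eta>] \<Omega>], simp add: multi_indices_def)
    then show ?thesis by (simp add: laplacian_def[abs_def])
  qed
  have bw: "square_integrable ?N (\<lambda>x. b x * w x)"
    by (rule square_integrable_mult_bounded[OF w b(1), where K=B]) (use b(2) in auto)
  have cv: "square_integrable ?N (\<lambda>x. c * v x)" by (rule square_integrable_cmult[OF v])
  have "(\<integral>x. (w x - v x) * laplacian \<eta> x \<partial>?N) = (\<integral>x. w x * laplacian \<eta> x \<partial>?N) - (\<integral>x. v x * laplacian \<eta> x \<partial>?N)"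
    unfolding left_diff_distrib
    by (rule Bochner_Integration.integral_diff[OF square_integrable_mult_integrable[OF w L] square_integrable_mult_integrable[OF v L]])
  moreover have "(\<integral>x. (b x * (w x - v x) + (b x - c) * v x) * \<eta> x \<partial>?N) =
      (\<integral>x. b x * w x * \<eta> x \<partial>?N) - (\<integral>x. c * v x * \<eta> x \<partial>?N)"
  proof -
    have "(b x * (w x - v x) + (b x - c) * v x) * \<eta> x = b x * w x * \<eta> x - c * v x * \<eta> x" for x
      by (simp add: algebra_simps)
    then show ?thesis
      using Bochner_Integration.integral_diff[OF square_integrable_mult_integrable[OF bw \<eta>i] square_integrable_mult_integrable[OF cv \<eta>i]]
      by (simp only:)
  qed
  moreover have "(\<integral>x. w x * laplacian \<eta> x \<partial>?N) + (\<integral>x. b x * w x * \<eta> x \<partial>?N) = 0"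
    "(\<integral>x. v x * laplacian \<eta> x \<partial>?N) + (\<integral>x. c * v x * \<eta> x \<partial>?N) = 0"
    using eqv eqw \<eta> unfolding helmholtz_distr_def by blast+
  ultimately show ?thesis by (simp add: add_eq_0_iff)
qed

lemma hoelder_continuous_on:
  assumes "hoelder \<alpha> f" "0 < \<alpha>"
  shows "continuous_on S f"
proof -
  obtain C where C: "\<And>x y. dist (f x) (f y) \<le> C * dist x y powr \<alpha>" using assms(1) by (auto simp: hoelder_def)
  have "(f \<longlongrightarrow> f x) (at x within S)" for x
  proof -
    have "((\<lambda>y. dist (f y) (f x)) \<longlongrightarrow> 0) (at x within S)"
    proof (rule tendsto_sandwich[OF _ _ tendsto_const])
      have "((\<lambda>y. dist y x) \<longlongrightarrow> dist x x) (at x within S)" by (intro tendsto_intros)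
      then have "((\<lambda>y. C * dist y x powr \<alpha>) \<longlongrightarrow> C * 0 powr \<alpha>) (at x within S)"
        using assms(2) by (intro tendsto_mult tendsto_const tendsto_powr') auto
      then show "((\<lambda>y. C * dist y x powr \<alpha>) \<longlongrightarrow> 0) (at x within S)" by simp
    qed (use C in auto)
    then show ?thesis by (rule tendsto_dist_iff[THEN iffD2])
  qed
  then show ?thesis by (simp add: continuous_on_def)
qed

lemma average_tendsto_0:
  fixes v :: "'a::euclidean_space \<Rightarrow> complex"
  assumes "0 \<le> M" "\<Omega> \<in> sets lebesgue" "AE x in lebesgue_on \<Omega>. norm (v x) \<le> M * norm (x - z)"
  shows "((\<lambda>r. (\<integral>x. norm (v x) \<partial>lebesgue_on (ball z r \<inter> \<Omega>)) / measure lebesgue (ball z r)) \<longlongrightarrow> 0) (at_right 0)"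
proof (rule tendsto_sandwich[OF _ _ tendsto_const])
  show "((\<lambda>r. M * r) \<longlongrightarrow> 0) (at_right 0)"
    using tendsto_mult_left[OF tendsto_ident_at[of "0::real" "{0<..}"], of M] by simp
  show "\<forall>\<^sub>F r in at_right 0. 0 \<le> (\<integral>x. norm (v x) \<partial>lebesgue_on (ball z r \<inter> \<Omega>)) / measure lebesgue (ball z r)"
    by (simp add: Bochner_Integration.integral_nonneg)
  show "\<forall>\<^sub>F r in at_right 0. (\<integral>x. norm (v x) \<partial>lebesgue_on (ball z r \<inter> \<Omega>)) / measure lebesgue (ball z r) \<le> M * r"
  proof -
    have "(\<integral>x. norm (v x) \<partial>lebesgue_on (ball z r \<inter> \<Omega>)) / measure lebesgue (ball z r) \<le> M * r" if r: "0 < r" for r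
    proof -
      let ?D = "ball z r \<inter> \<Omega>"
      have D: "?D \<in> lmeasurable" using assms(2) by (intro fmeasurable_Int_fmeasurable) auto
      then have Ds: "?D \<in> sets lebesgue" by auto
      have pos: "0 < measure lebesgue (ball z r)" using r by (simp add: content_ball_pos)
      have ae: "AE x in lebesgue_on ?D. norm (v x) \<le> M * r"
      proof -
        have "AE x in lebesgue. x \<in> \<Omega> \<longrightarrow> norm (v x) \<le> M * norm (x - z)"
          using assms(2,3) by (simp add: AE_restrict_space_iff)
        then have "AE x in lebesgue. x \<in> ?D \<longrightarrow> norm (v x) \<le> M * r"
        proof eventually_elim
          case (elim x)
          show ?case
          proof
            assume x: "x \<in> ?D"
            then have "M * norm (x - z) \<le> M * r"
              using assms(1) by (intro mult_left_mono) (auto simp: dist_norm norm_minus_commute)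
            with elim x show "norm (v x) \<le> M * r" by auto
          qed
        qed
        then show ?thesis using Ds by (simp add: AE_restrict_space_iff)
      qed
      have "(\<integral>x. norm (v x) \<partial>lebesgue_on ?D) \<le> (\<integral>x. M * r \<partial>lebesgue_on ?D)"
      proof (cases "integrable (lebesgue_on ?D) (\<lambda>x. norm (v x))")
        case True
        then show ?thesis
          using ae finite_measure.integrable_const[OF finite_measure_lebesgue_on[OF D]] by (intro integral_mono_AE) auto
      next
        case False
        \<comment> \<open>The integral is then zero by convention.\<close>
        then have "(\<integral>x. norm (v x) \<partial>lebesgue_on ?D) = 0" by (rule not_integrable_integral_eq)
        moreover have "0 \<le> (\<integral>x. M * r \<partial>lebesgue_on ?D)"
          using assms(1) r by (intro Bochner_Integration.integral_nonneg) simp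
        ultimately show ?thesis by (simp only:)
      qed
      also have "\<dots> = measure lebesgue ?D * (M * r)"
        using Ds by (simp add: measure_restrict_space)
      also have "\<dots> \<le> measure lebesgue (ball z r) * (M * r)"
        using assms(1) r Ds by (intro mult_right_mono measure_mono_fmeasurable) auto
      finally show ?thesis using pos by (simp add: pos_divide_le_eq mult.commute)
    qed
    then show ?thesis by (auto simp: eventually_at_filter)
  qed
qed

lemma admissible_corner:
  fixes \<Omega> :: "(real ^ 'n) set"
  assumes "CARD('n) \<in> {2, 3}" "admissible_potential R \<Omega> \<phi> V" "z \<in> vertices \<Omega>"
  shows "\<exists>(l :: 'n \<Rightarrow> real ^ 'n) a p q. corner l a p q \<Omega> z"
proof -
  have "CARD('n) = 2 \<and> open_convex_polytope \<Omega> \<or> CARD('n) = 3 \<and> open_cuboid \<Omega>"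
    using assms(1,2) by (auto simp: admissible_potential_def)
  then show ?thesis using polygon_corner cuboid_corner assms(3) by blast
qed

theorem theorem3p2:
  fixes \<Omega> :: "(real ^ 'n) set" and \<phi> V v w :: "real ^ 'n \<Rightarrow> complex"
    and k R :: real and g :: "nat \<Rightarrow> real ^ 'n \<Rightarrow> complex"
  assumes "CARD('n) \<in> {2, 3}"
    and "R > 1"
    and "admissible_potential R \<Omega> \<phi> V"
    and "k > 0"
    and "square_integrable (lebesgue_on \<Omega>) v"
    and "square_integrable (lebesgue_on \<Omega>) w"
    and "helmholtz_distr \<Omega> (\<lambda>x. of_real (k\<^sup>2)) v"
    and "helmholtz_distr \<Omega> (\<lambda>x. of_real (k\<^sup>2) * (1 + V x)) w"
    and "(\<lambda>x. w x - v x) \<in> sobolev_H0 2 \<Omega>"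
    and "L2_norm (lebesgue_on \<Omega>) v = 1"
    and "\<And>j. square_integrable sphere_measure (g j)"
    and "(\<lambda>j. L2_norm (lebesgue_on \<Omega>) (\<lambda>x. v x - herglotz_wave k (g j) x)) \<longlonglongrightarrow> 0"
    and "bdd_above (range (\<lambda>j. L2_norm sphere_measure (g j)))"
  shows "\<forall>x\<^sub>c \<in> vertices \<Omega>. \<phi> x\<^sub>c \<noteq> 0 \<longrightarrow>
    ((\<lambda>r. (\<integral>x. norm (v x) \<partial>lebesgue_on (ball x\<^sub>c r \<inter> \<Omega>)) / measure lebesgue (ball x\<^sub>c r))
       \<longlongrightarrow> 0) (at_right 0)"
proof (intro ballI impI)
  fix z assume z: "z \<in> vertices \<Omega>" and \<phi>z: "\<phi> z \<noteq> 0"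
  let ?N = "lebesgue_on \<Omega>"
  obtain l :: "'n \<Rightarrow> real ^ 'n" and a p q where "corner l a p q \<Omega> z"
    using admissible_corner[OF assms(1,3) z] by blast
  then interpret corner l a p q \<Omega> z .
  have \<Omega>: "\<Omega> \<in> sets lebesgue" using open_domain by simp
  obtain c M where M: "0 \<le> M" "AE x in ?N. norm (v x - c) \<le> M * norm (x - z)"
    using herglotz_limit_Lipschitz[OF open_domain bounded_domain assms(5,11,12,13)] by blast
  have V: "V = (\<lambda>x. indicator \<Omega> x * \<phi> x)" using assms(3) by (simp add: admissible_potential_def)
  obtain \<alpha> where "0 < \<alpha> \<or> 1 / 4 < \<alpha>" and \<alpha>': "\<alpha> \<le> 1" "hoelder \<alpha> \<phi>"
    using assms(3) by (auto simp: admissible_potential_def)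
  then have \<alpha>: "0 < \<alpha>" "\<alpha> \<le> 1" "hoelder \<alpha> \<phi>" by auto
  obtain C where C: "\<And>x y. norm (\<phi> x - \<phi> y) \<le> C * norm (x - y) powr \<alpha>"
    using \<alpha>(3) by (auto simp: hoelder_def dist_norm)
  obtain B where B: "\<And>x. norm (\<phi> x) \<le> B" using \<alpha>(3) by (auto simp: hoelder_def bounded_iff)
  obtain r where r: "\<And>x. x \<in> \<Omega> \<Longrightarrow> norm (x - z) \<le> r" "0 \<le> r"
  proof -
    obtain r where r: "\<And>x. x \<in> \<Omega> \<Longrightarrow> norm x \<le> r" using bounded_domain by (auto simp: bounded_iff)
    show ?thesis
    proof (rule that[of "\<bar>r\<bar> + norm z"])
      show "norm (x - z) \<le> \<bar>r\<bar> + norm z" if "x \<in> \<Omega>" for x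
        using norm_triangle_ineq4[of x z] r[OF that] by linarith
    qed simp
  qed
  define b where "b x = of_real (k\<^sup>2) * (1 + V x)" for x
  define F where "F x = (b x - of_real (k\<^sup>2)) * v x" for x
  have \<phi>_meas: "\<phi> \<in> borel_measurable ?N"
    by (intro borel_measurable_lebesgue_on_borel borel_measurable_continuous_onI hoelder_continuous_on[OF \<alpha>(3,1)])
  have V_in: "V x = \<phi> x" if "x \<in> \<Omega>" for x using that by (simp add: V)
  have b_meas: "b \<in> borel_measurable ?N"
  proof -
    have "(\<lambda>x. of_real (k\<^sup>2) * (1 + \<phi> x)) \<in> borel_measurable ?N" using \<phi>_meas by measurable
    moreover have "b x = of_real (k\<^sup>2) * (1 + \<phi> x)" if "x \<in> space ?N" for x
      using that V_in by (simp add: b_def)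
    ultimately show ?thesis by (subst measurable_cong)
  qed
  have B0: "0 \<le> B" using order_trans[OF norm_ge_zero B] .
  have b_le: "norm (b x) \<le> k\<^sup>2 * (1 + B)" for x
  proof -
    have "norm (1 + V x) \<le> 1 + B"
      using norm_triangle_ineq[of 1 "V x"] B[of x] B0 by (auto simp: V indicator_def)
    then show ?thesis by (simp add: b_def norm_mult norm_power mult_left_mono)
  qed
  have F_sq: "square_integrable ?N F" unfolding F_def[abs_def]
  proof (rule square_integrable_mult_bounded[OF assms(5), where K="k\<^sup>2 * (1 + B) + k\<^sup>2"])
    show "(\<lambda>x. b x - of_real (k\<^sup>2)) \<in> borel_measurable ?N" using b_meas by measurable
    show "norm (b x - of_real (k\<^sup>2)) \<le> k\<^sup>2 * (1 + B) + k\<^sup>2" for x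
      using norm_triangle_ineq4[of "b x" "of_real (k\<^sup>2)"] b_le[of x] by (simp add: norm_power)
  qed
  \<comment> \<open>Write \<open>\<phi> v - \<phi>(z) c = (\<phi> - \<phi>(z)) v + \<phi>(z) (v - c)\<close>, and bound \<open>|x - z|\<close> by a multiple of \<open>|x - z|\<^sup>\<alpha>\<close>.\<close>
  define D where "D = k\<^sup>2 * (C * (norm c + M * r) + norm (\<phi> z) * (M * r powr (1 - \<alpha>)))"
  have C0: "0 \<le> C * norm (x - y) powr \<alpha>" for x y :: "real ^ 'n" using order_trans[OF norm_ge_zero C] .
  have F_near: "AE x in ?N. norm (F x - of_real (k\<^sup>2) * \<phi> z * c) \<le> D * norm (x - z) powr \<alpha>"
  proof -
    have "AE x in ?N. x \<in> \<Omega>" using AE_space[of ?N] by simp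
    with M(2) show ?thesis
    proof eventually_elim
      case (elim x)
      let ?s = "norm (x - z)"
      have s: "?s \<le> r" using r elim(2) by blast
      have v_le: "norm (v x) \<le> norm c + M * r"
      proof -
        have "norm (v x) \<le> norm c + norm (v x - c)" using norm_triangle_ineq[of c "v x - c"] by simp
        also have "\<dots> \<le> norm c + M * r"
          using elim(1) mult_left_mono[OF s M(1)] by linarith
        finally show ?thesis .
      qed
      have s_le: "?s \<le> r powr (1 - \<alpha>) * ?s powr \<alpha>"
      proof (cases "?s = 0")
        case False
        then have "?s = ?s powr (1 - \<alpha>) * ?s powr \<alpha>" by (simp add: powr_add[symmetric])
        also have "\<dots> \<le> r powr (1 - \<alpha>) * ?s powr \<alpha>"
          using s \<alpha> by (intro mult_right_mono powr_mono2) auto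
        finally show ?thesis .
      qed simp
      have "F x - of_real (k\<^sup>2) * \<phi> z * c = of_real (k\<^sup>2) * ((\<phi> x - \<phi> z) * v x + \<phi> z * (v x - c))"
        using V_in[OF elim(2)] by (simp add: F_def b_def algebra_simps)
      then have "norm (F x - of_real (k\<^sup>2) * \<phi> z * c) = k\<^sup>2 * norm ((\<phi> x - \<phi> z) * v x + \<phi> z * (v x - c))"
        by (simp add: norm_mult norm_power)
      also have "\<dots> \<le> k\<^sup>2 * (norm (\<phi> x - \<phi> z) * norm (v x) + norm (\<phi> z) * norm (v x - c))"
        using norm_triangle_ineq[of "(\<phi> x - \<phi> z) * v x" "\<phi> z * (v x - c)"]
        by (intro mult_left_mono) (auto simp: norm_mult)
      also have "\<dots> \<le> k\<^sup>2 * ((C * ?s powr \<alpha>) * (norm c + M * r) + norm (\<phi> z) * (M * (r powr (1 - \<alpha>) * ?s powr \<alpha>)))"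
        using C v_le C0 M(1) s_le
        by (intro mult_left_mono add_mono mult_mono order_trans[OF elim(1)]) auto
      also have "\<dots> = D * ?s powr \<alpha>" by (simp add: D_def algebra_simps)
      finally show ?case .
    qed
  qed
  have "of_real (k\<^sup>2) * \<phi> z * c = 0"
  proof (rule vanishing_at_corner[OF _ assms(9) b_meas b_le F_sq F_near \<alpha>(1)])
    show "DIM(real ^ 'n) < 4" using assms(1) by auto
    fix \<eta> :: "real ^ 'n \<Rightarrow> complex" assume "test_function \<Omega> \<eta>"
    from transmission_difference_equation[OF assms(6,5) b_meas b_le \<Omega> assms(7) assms(8)[folded b_def] this]
    show "(\<integral>x. (w x - v x) * laplacian \<eta> x \<partial>?N) + (\<integral>x. (b x * (w x - v x) + F x) * \<eta> x \<partial>?N) = 0"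
      by (simp only: F_def)
  qed
  then have "c = 0" using \<phi>z assms(4) by simp
  then show "((\<lambda>r. (\<integral>x. norm (v x) \<partial>lebesgue_on (ball z r \<inter> \<Omega>)) / measure lebesgue (ball z r)) \<longlongrightarrow> 0) (at_right 0)"
    using average_tendsto_0[OF M(1) \<Omega>] M(2) by simp
qed

end
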